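(* The braid monodromy factorization of $\mathcal{C}^{\mathrm{aff}}$, with respect to the choices described in the context, is $(\tau_1,\tau_2,\tau_3)\in\mathbb{B}_4^3$, where $$\tau_1=(\sigma_1\sigma_2)^4,$$ $$\tau_2=(\sigma_1\sigma_2\sigma_1^2)\,(\sigma_2\sigma_3)^2\,(\sigma_1\sigma_2\sigma_1^2)^{-1},$$ $$\tau_3=(\sigma_2\sigma_1^2\sigma_2\sigma_3)\,(\sigma_2\sigma_1)^4\,(\sigma_2\sigma_1^2\sigma_2\sigma_3)^{-1}.$$
   Context: $\mathcal{C}^{\mathrm{aff}}=\{h(x,y)=0\}\subset\mathbb{C}^2$ with $$h(x,y)=y^2\left(y-\frac{x^2-1}{4}\right)^2+\frac12\left(\frac{2a}{3}\,y-\frac{2a+3}{24}(x^2-1)\right)^3,\qquad a=\sqrt3,$$ a polynomial monic of degree $4$ in $y$. The discriminant of $h$ with respect to $y$ has exactly the roots $-1,0,1$. Braid monodromy: fix $x_0\in\mathbb{C}\setminus\{-1,0,1\}$ and let $y_1,\dots,y_4$ be the roots of $h(x_0,y)$. A loop $\gamma$ in $\mathbb{C}\setminus\{-1,0,1\}$ based at $x_0$ yields, by following the roots of $h(\gamma(t),y)$, a braid $\nabla(\gamma)$ based at $\{y_1,\dots,y_4\}$; this defines a homomorphism $\nabla:\pi_1(\mathbb{C}\setminus\{-1,0,1\};x_0)\to\mathbb{B}_4$. Loops and braids are composed from left to right. A braid monodromy factorization is the tuple $(\nabla(\gamma_1),\nabla(\gamma_2),\nabla(\gamma_3))$, where $\gamma_1,\gamma_2,\gamma_3$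 is a basis formed by meridians of the three discriminant points such that $(\gamma_3\gamma_2\gamma_1)^{-1}$ is a meridian of the point at infinity. Choices: $x_0$ is real, $x_0>1$ close to $1$, and the discriminant points are numbered $x_1=1$, $x_2=0$, $x_3=-1$. The loop $\gamma_i$ starts at $x_0$, moves to the left along the real axis, avoids each of $x_1,\dots,x_{i-1}$ along a small half-circle in the upper half-plane, arrives near $x_i$, turns once counterclockwise around $x_i$ on a small circle, and returns to $x_0$ along the same path. The braid group based at $\{y_1,\dots,y_4\}$ is identified with the Artin group $\mathbb{B}_4$ by ordering the roots by decreasing real part, a root with positive imaginary part preceding its complex conjugate (i.e. the roots are projected to the real line after a slight deformation moving the one of positive imaginary part to the right), so that $\sigma_i$ is the positive (counterclockwise) half-twist exchanging the $i$-th and $(i+1)$-th points, $i=1,2,3$. *)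

theory Defs
  imports
    "HOL-Analysis.Analysis"
    "HOL-Complex_Analysis.Contour_Integration"
    "HOL-Algebra.Group"
begin

text \<open>
  The points of a finite set are labelled by the finite type \<open>'n\<close>.  A braid based at the set
  \<open>{P $ k | k}\<close> is a loop in the space of \<open>n\<close>-element subsets of the plane.  Labelling its strands
  by their starting points turns it into a path of pairwise distinct labelled points which starts
  at \<open>P\<close> and ends at a rearrangement of \<open>P\<close>.  Two braids are equal when these paths are homotopic
  with fixed endpoints in the space of pairwise distinct labelled points.
\<close>

definition conf :: "(complex ^ 'n) set" where
  "conf = {z. inj (($) z)}"

definition braid_class :: "(real \<Rightarrow> complex ^ 'n) \<Rightarrow> (real \<Rightarrow> complex ^ 'n) set" where
  "braid_class b = {c. homotopic_paths conf b c}"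

text \<open>
  First \<open>a\<close>, then \<open>b\<close>: strand \<open>k\<close> of \<open>a\<close> is continued by the strand of \<open>b\<close> that starts at
  the endpoint of strand \<open>k\<close>.
\<close>

definition strand_join ::
    "(real \<Rightarrow> complex ^ 'n) \<Rightarrow> (real \<Rightarrow> complex ^ 'n) \<Rightarrow> real \<Rightarrow> complex ^ 'n" where
  "strand_join a b = a +++ (\<lambda>t. \<chi> k. b t $ (THE j. pathstart b $ j = pathfinish a $ k))"

definition braid_group :: "complex ^ 'n \<Rightarrow> (real \<Rightarrow> complex ^ 'n) set monoid" where
  "braid_group P =
     \<lparr> carrier = {braid_class b | b.
          path b \<and> path_image b \<subseteq> conf \<and> pathstart b = P \<and>
          range (($) (pathfinish b)) = range (($) P)},
       mult = (\<lambda>A B. \<Union>a\<in>A. \<Union>b\<in>B. braid_class (strand_join a b)),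
       one = braid_class (\<lambda>_. P) \<rparr>"

text \<open>
  The index type \<open>4\<close> consists of \<open>1, 2, 3, 4\<close> (where \<open>4 = 0\<close>).  The standard base points are
  real and numbered by decreasing real part: \<open>-1 > -2 > -3 > -4\<close>.
\<close>

definition std_base :: "complex ^ 4" where
  "std_base = vector [-1, -2, -3, -4]"

abbreviation B4 :: "(real \<Rightarrow> complex ^ 4) set monoid" where
  "B4 \<equiv> braid_group std_base"

text \<open>
  The points \<open>i\<close> and \<open>i + 1\<close> rotate counterclockwise by the angle \<open>pi\<close> about their midpoint.
  Only \<open>i = 1, 2, 3\<close> are meant.
\<close>

definition half_twist :: "4 \<Rightarrow> real \<Rightarrow> complex ^ 4" where
  "half_twist i t = (\<chi> k.
     let m = (std_base $ i + std_base $ (i + 1)) / 2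
     in if k = i \<or> k = i + 1 then m + cis (pi * t) * (std_base $ k - m) else std_base $ k)"

definition \<sigma> :: "4 \<Rightarrow> (real \<Rightarrow> complex ^ 4) set" where
  "\<sigma> i = braid_class (half_twist i)"

definition h :: "complex \<Rightarrow> complex \<Rightarrow> complex" where
  "h x y = (let a = complex_of_real (sqrt 3) in
     y\<^sup>2 * (y - (x\<^sup>2 - 1) / 4)\<^sup>2
       + 1 / 2 * (2 * a / 3 * y - (2 * a + 3) / 24 * (x\<^sup>2 - 1)) ^ 3)"

definition C_aff :: "(complex \<times> complex) set" where
  "C_aff = {(x, y). h x y = 0}"

text \<open>
  The roots of \<open>h x\<close> by decreasing real part, and by decreasing imaginary part when the real parts
  agree; in particular a non-real root with positive imaginary part precedes its conjugate when the
  latter is a root.  The description is meaningful only if there are four distinct roots.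
\<close>

definition root_tuple :: "complex \<Rightarrow> complex ^ 4" where
  "root_tuple x = (THE y. range (($) y) = {w. (x, w) \<in> C_aff} \<and>
     sorted_wrt (\<lambda>u v. Re v < Re u \<or> Re v = Re u \<and> Im v < Im u) [y $ 1, y $ 2, y $ 3, y $ 4])"

definition follows_roots :: "(real \<Rightarrow> complex) \<Rightarrow> (real \<Rightarrow> complex ^ 4) \<Rightarrow> bool" where
  "follows_roots \<gamma> b \<longleftrightarrow>
     path b \<and> path_image b \<subseteq> conf \<and> pathstart b = root_tuple (pathstart \<gamma>) \<and>
     (\<forall>t\<in>{0..1}. range (($) (b t)) = {w. (\<gamma> t, w) \<in> C_aff})"

text \<open>
  The braid based at the roots over the base point of \<open>\<gamma>\<close>.  On \<open>[0, 1]\<close> there is at most one path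
  following the roots, so the union is a single class; it would be empty if there were no such path.
\<close>

definition nabla :: "(real \<Rightarrow> complex) \<Rightarrow> (real \<Rightarrow> complex ^ 4) set" where
  "nabla \<gamma> = (\<Union>b\<in>{b. follows_roots \<gamma> b}. braid_class b)"

text \<open>
  The identification of the braid group based at \<open>y\<close> with \<open>B4\<close>, for a tuple \<open>y\<close> ordered as in
  \<open>root_tuple\<close>.  Along the straight segment from \<open>y\<close> to any real tuple in decreasing order the real
  parts are strictly decreasing except possibly at \<open>y\<close> itself, so the points stay distinct and the
  real tuple chosen does not matter: the segment to \<open>Re (y $ k) + \<delta> * Im (y $ k)\<close> for small
  \<open>\<delta> > 0\<close>, that is, the perturbed projection to the real line, gives the same identification.
\<close>

definition to_B4 ::
    "complex ^ 4 \<Rightarrow> (real \<Rightarrow> complex ^ 4) set \<Rightarrow> (real \<Rightarrow> complex ^ 4) set" where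
  "to_B4 y A =
     (\<Union>b\<in>A. braid_class (strand_join (strand_join (linepath std_base y) b) (linepath y std_base)))"

definition braid_monodromy :: "(real \<Rightarrow> complex) \<Rightarrow> (real \<Rightarrow> complex ^ 4) set" where
  "braid_monodromy \<gamma> = to_B4 (root_tuple (pathstart \<gamma>)) (nabla \<gamma>)"

text \<open>The discriminant points are \<open>1, 0, -1\<close> for \<open>i = 1, 2, 3\<close>.\<close>

definition discr_pt :: "nat \<Rightarrow> complex" where
  "discr_pt i = 2 - of_nat i"

text \<open>
  \<open>approach x0 \<epsilon> n\<close> runs from \<open>x0\<close> leftwards to the point at distance \<open>\<epsilon>\<close> to the right of
  \<open>discr_pt (n + 1)\<close>.  The arc from angle \<open>0\<close> to \<open>pi\<close> passes through the upper half-plane.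
\<close>

primrec approach :: "real \<Rightarrow> real \<Rightarrow> nat \<Rightarrow> real \<Rightarrow> complex" where
  "approach x0 \<epsilon> 0 = linepath (of_real x0) (discr_pt 1 + of_real \<epsilon>)"
| "approach x0 \<epsilon> (Suc n) =
     approach x0 \<epsilon> n +++
     (part_circlepath (discr_pt (n + 1)) \<epsilon> 0 pi +++
      linepath (discr_pt (n + 1) - of_real \<epsilon>) (discr_pt (n + 2) + of_real \<epsilon>))"

definition loop_around :: "real \<Rightarrow> real \<Rightarrow> nat \<Rightarrow> real \<Rightarrow> complex" where
  "loop_around x0 \<epsilon> i =
     approach x0 \<epsilon> (i - 1) +++
     (circlepath (discr_pt i) \<epsilon> +++ reversepath (approach x0 \<epsilon> (i - 1)))"

definition braid_monodromy_factorization ::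
    "real \<Rightarrow> real \<Rightarrow> (real \<Rightarrow> complex ^ 4) set \<times> (real \<Rightarrow> complex ^ 4) set \<times> (real \<Rightarrow> complex ^ 4) set"
  where
  "braid_monodromy_factorization x0 \<epsilon> =
     (braid_monodromy (loop_around x0 \<epsilon> 1),
      braid_monodromy (loop_around x0 \<epsilon> 2),
      braid_monodromy (loop_around x0 \<epsilon> 3))"

end

theory Submission
  imports Defs "HOL-Complex_Analysis.Conformal_Mappings"
begin

text \<open>
  Put \<open>u = (x\<^sup>2 - 1) / 4\<close>.  The polynomial \<open>h x\<close> depends on \<open>u\<close> only, and after the
  substitution \<open>y = u * s\<close> its roots are the solutions of \<open>g s = u\<close> for
  \<open>g s = - k * (s - s_zero)\<^sup>3 / (s\<^sup>2 * (s - 1)\<^sup>2)\<close> with \<open>k = 4 / 9 * sqrt 3\<close> (\<open>branch_map\<close>).  For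
  this special \<open>k\<close> and \<open>s_zero\<close> the numerator of the derivative of \<open>g\<close> is a constant times
  \<open>(s - s_zero)\<^sup>2 * (s - s_crit)\<^sup>2\<close>, so \<open>g\<close> takes the values \<open>0\<close> and \<open>- 1 / 4\<close> with multiplicity three.
  Near \<open>u = 0\<close>, that is \<open>x = 1\<close> or \<open>x = -1\<close>, and near \<open>u = - 1 / 4\<close>, that is \<open>x = 0\<close>, three of the
  solutions are \<open>s = G (\<omega>\<^sup>k * w)\<close>, where \<open>w\<close> is a cube root of \<open>-u\<close> or of \<open>u + 1 / 4\<close> and \<open>G\<close> is
  holomorphic at \<open>0\<close> with \<open>G' 0 > 0\<close> (\<open>local_cube_root\<close>).  The corresponding three roots \<open>y = u * s\<close>
  form almost an equilateral triangle: up to a translation and a positive factor the corners are close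
  to \<open>u * w * \<omega>\<^sup>k\<close>.  The triangle turns by \<open>4 / 3\<close> of the angle of a circle
  around \<open>x = 1\<close> or \<open>x = -1\<close>, and by \<open>2 / 3\<close> of the angle of a circle around \<open>x = 0\<close>, while the
  fourth root stays to the left of it, respectively to the right of it.

  A rotation of the triangle by 120 degrees is \<open>\<sigma> 1 * \<sigma> 2\<close>, respectively \<open>\<sigma> 2 * \<sigma> 3\<close>.  Hence a circle
  around \<open>1\<close> or \<open>-1\<close> yields \<open>(\<sigma> 1 * \<sigma> 2)\<^sup>4\<close>, a half-circle around \<open>1\<close> yields \<open>(\<sigma> 1 * \<sigma> 2)\<^sup>2\<close>, a
  circle around \<open>0\<close> yields \<open>(\<sigma> 2 * \<sigma> 3)\<^sup>2\<close> and a half-circle \<open>\<sigma> 2 * \<sigma> 3\<close>.  For \<open>x\<close> between \<open>0\<close> and \<open>1\<close>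
  two roots are real and two are conjugate; as \<open>x\<close> decreases, the larger real root passes from the
  left to the right through the gap between the conjugate ones, which is \<open>(\<sigma> 2)\<inverse> * \<sigma> 1\<close>.  Since \<open>h\<close>
  is even in \<open>x\<close>, the way from \<open>0\<close> to \<open>-1\<close> contributes the inverse.  So the conjugating braids are
  \<open>(\<sigma> 1 * \<sigma> 2)\<^sup>2 * (\<sigma> 2)\<inverse> * \<sigma> 1 = \<sigma> 1 * \<sigma> 2 * (\<sigma> 1)\<^sup>2\<close> and
  \<open>\<sigma> 1 * \<sigma> 2 * (\<sigma> 1)\<^sup>2 * \<sigma> 2 * \<sigma> 3 * (\<sigma> 1)\<inverse> * \<sigma> 2\<close>; the braid relations turn the latter into
  \<open>\<sigma> 2 * (\<sigma> 1)\<^sup>2 * \<sigma> 2 * \<sigma> 3 * \<sigma> 2\<close>, and its last letter changes \<open>(\<sigma> 1 * \<sigma> 2)\<^sup>4\<close> into \<open>(\<sigma> 2 * \<sigma> 1)\<^sup>4\<close>.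

  To make this rigorous, every path of four distinct labelled points gets a braid by joining its ends
  to the standard points in the same order (\<open>braid_of\<close>).  This is multiplicative under joins, so
  that the loops can be cut into the pieces above.  All homotopies are straight-line homotopies:
  two paths have the same braid if at no time the differences of two strands in the two paths point in
  opposite directions and the ends have the same order (\<open>braid_of_linear\<close>, \<open>segment_confI\<close>).
\<close>

section \<open>Relabelling the strands\<close>

definition relabel :: "('n \<Rightarrow> 'n) \<Rightarrow> complex ^ 'n \<Rightarrow> complex ^ 'n" where
  "relabel \<pi> z = (\<chi> k. z $ \<pi> k)"

lemma relabel_nth [simp]: "relabel \<pi> z $ k = z $ \<pi> k"
  by (simp add: relabel_def)

lemma relabel_relabel: "relabel \<pi> (relabel \<rho> z) = relabel (\<rho> \<circ> \<pi>) z"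
  by (simp add: vec_eq_iff)

lemma relabel_id [simp]: "relabel id z = z" "relabel (\<lambda>k. k) z = z"
  by (simp_all add: vec_eq_iff)

lemma continuous_on_relabel [continuous_intros]:
  "continuous_on S f \<Longrightarrow> continuous_on S (\<lambda>x. relabel \<pi> (f x))"
  unfolding relabel_def by (intro continuous_intros)

lemma conf_iff: "z \<in> conf \<longleftrightarrow> (\<forall>j k. z $ j = z $ k \<longrightarrow> j = k)"
  by (auto simp: conf_def inj_def)

lemma relabel_conf: "bij \<pi> \<Longrightarrow> relabel \<pi> z \<in> conf \<longleftrightarrow> z \<in> conf"
  unfolding conf_iff relabel_nth by (metis bij_def injD surjD)

lemma range_relabel: "bij \<pi> \<Longrightarrow> range (($) (relabel \<pi> z)) = range (($) z)"
  using bij_is_surj[of \<pi>] by (auto simp: surj_def) (metis rangeI)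

lemma relabel_inject: "z \<in> conf \<Longrightarrow> relabel \<pi> z = relabel \<rho> z \<longleftrightarrow> \<pi> = \<rho>"
  by (auto simp: vec_eq_iff conf_iff)

lemma relabel_if_same_range:
  fixes z w :: "complex ^ 'n"
  assumes "z \<in> conf" "w \<in> conf" "range (($) z) = range (($) w)"
  obtains \<pi> where "bij \<pi>" "w = relabel \<pi> z"
proof -
  have "\<forall>k. \<exists>j. z $ j = w $ k"
    using assms(3) by (metis rangeE rangeI)
  then obtain \<pi> where \<pi>: "\<And>k. z $ \<pi> k = w $ k" by metis
  have "inj \<pi>" using \<pi> assms(2) by (metis conf_iff injI)
  then have "bij \<pi>" by (simp add: bij_def finite_UNIV_inj_surj)
  moreover have "w = relabel \<pi> z" by (simp add: vec_eq_iff \<pi>)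
  ultimately show ?thesis using that by blast
qed

lemma path_relabel: "path p \<Longrightarrow> path (relabel \<pi> \<circ> p)"
  by (simp add: path_def o_def continuous_on_relabel)

lemma path_image_relabel_conf:
  "bij \<pi> \<Longrightarrow> path_image (relabel \<pi> \<circ> p) \<subseteq> conf \<longleftrightarrow> path_image p \<subseteq> conf"
  by (auto simp: path_image_def relabel_conf)

lemma relabel_linepath: "relabel \<pi> \<circ> linepath a b = linepath (relabel \<pi> a) (relabel \<pi> b)"
  by (rule ext) (simp add: linepath_def vec_eq_iff)

lemma homotopic_relabel:
  assumes "homotopic_paths conf p q" "bij \<pi>"
  shows "homotopic_paths conf (relabel \<pi> \<circ> p) (relabel \<pi> \<circ> q)"
  using assms by (intro homotopic_paths_continuous_image[OF assms(1)] continuous_on_relabel)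
     (auto simp: relabel_conf continuous_on_id)

section \<open>The braid group\<close>

definition braid_path :: "complex ^ 'n \<Rightarrow> (real \<Rightarrow> complex ^ 'n) \<Rightarrow> bool" where
  "braid_path P b \<longleftrightarrow> path b \<and> path_image b \<subseteq> conf \<and> pathstart b = P \<and>
     range (($) (pathfinish b)) = range (($) P)"

lemma carrier_braid_group: "carrier (braid_group P) = {braid_class b | b. braid_path P b}"
  by (simp add: braid_group_def braid_path_def)

lemma braid_class_in_carrier: "braid_path P b \<Longrightarrow> braid_class b \<in> carrier (braid_group P)"
  by (auto simp: carrier_braid_group)

lemma braid_class_eqI: "homotopic_paths conf a b \<Longrightarrow> braid_class a = braid_class b"
  unfolding braid_class_def using homotopic_paths_sym homotopic_paths_trans by blast

lemma mem_braid_class: "c \<in> braid_class b \<longleftrightarrow> homotopic_paths conf b c"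
  by (simp add: braid_class_def)

lemma strand_join_relabel:
  assumes "pathstart b \<in> conf" "pathfinish a = relabel \<pi> (pathstart b)"
  shows "strand_join a b = a +++ (relabel \<pi> \<circ> b)"
proof -
  have "(THE j. pathstart b $ j = pathfinish a $ k) = \<pi> k" for k
    using assms by (auto simp: conf_iff)
  then show ?thesis by (simp add: strand_join_def relabel_def o_def)
qed

lemma pathstart_in_conf: "path_image b \<subseteq> conf \<Longrightarrow> pathstart b \<in> conf"
  and pathfinish_in_conf: "path_image b \<subseteq> conf \<Longrightarrow> pathfinish b \<in> conf"
  by (meson pathstart_in_path_image subsetD) (meson pathfinish_in_path_image subsetD)

lemma braid_path_obtain:
  assumes "braid_path P b"
  obtains \<pi> where "bij \<pi>" "pathfinish b = relabel \<pi> P" "P \<in> conf"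
  using assms relabel_if_same_range[of P "pathfinish b"]
  by (metis braid_path_def pathfinish_in_conf pathstart_in_conf)

lemma braid_path_join:
  assumes "braid_path P a" "braid_path P b" "pathfinish a = relabel \<pi> P" "bij \<pi>"
  shows "braid_path P (a +++ (relabel \<pi> \<circ> b))"
  unfolding braid_path_def
proof (intro conjI)
  show "path (a +++ (relabel \<pi> \<circ> b))"
    using assms by (intro path_join_imp) (auto simp: braid_path_def path_relabel pathstart_compose)
  show "path_image (a +++ (relabel \<pi> \<circ> b)) \<subseteq> conf"
    using assms by (intro subset_path_image_join) (auto simp only: braid_path_def path_image_relabel_conf)
  show "pathstart (a +++ (relabel \<pi> \<circ> b)) = P"
    using assms by (simp add: braid_path_def)
  show "range (($) (pathfinish (a +++ (relabel \<pi> \<circ> b)))) = range (($) P)"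
    unfolding pathfinish_join pathfinish_compose range_relabel[OF assms(4)]
    using assms(2) by (simp add: braid_path_def)
qed

text \<open>
  The strand that continues strand \<open>k\<close> of \<open>a\<close> starts where \<open>a\<close> ends, at the point with label
  \<open>\<pi> k\<close>; so the product is represented by an ordinary join with a relabelled path.
\<close>

lemma mult_braid_class:
  assumes "braid_path P a" "braid_path P b" "pathfinish a = relabel \<pi> P" "bij \<pi>"
  shows "braid_class a \<otimes>\<^bsub>braid_group P\<^esub> braid_class b = braid_class (a +++ (relabel \<pi> \<circ> b))"
proof -
  have "braid_class (strand_join a' b') = braid_class (a +++ (relabel \<pi> \<circ> b))"
    if "homotopic_paths conf a a'" "homotopic_paths conf b b'" for a' b'
  proof -
    have ends: "pathfinish a' = pathfinish a" "pathstart b' = P"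
      using homotopic_paths_imp_pathfinish[OF that(1)] homotopic_paths_imp_pathstart[OF that(2)] assms(2)
      by (auto simp: braid_path_def)
    have "P \<in> conf" using assms(1) pathstart_in_conf braid_path_def by metis
    then have "strand_join a' b' = a' +++ (relabel \<pi> \<circ> b')"
      using ends assms(3) by (intro strand_join_relabel) auto
    moreover have "homotopic_paths conf (a +++ (relabel \<pi> \<circ> b)) (a' +++ (relabel \<pi> \<circ> b'))"
      using that assms ends
      by (intro homotopic_paths_join homotopic_relabel) (auto simp: pathstart_compose braid_path_def)
    ultimately show ?thesis using braid_class_eqI by metis
  qed
  then have "\<And>a' b'. a' \<in> braid_class a \<Longrightarrow> b' \<in> braid_class b \<Longrightarrow>
      braid_class (strand_join a' b') = braid_class (a +++ (relabel \<pi> \<circ> b))"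
    unfolding mem_braid_class .
  moreover have "a \<in> braid_class a" "b \<in> braid_class b"
    using assms by (auto simp: mem_braid_class braid_path_def)
  ultimately have "(\<Union>a'\<in>braid_class a. \<Union>b'\<in>braid_class b. braid_class (strand_join a' b')) =
      braid_class (a +++ (relabel \<pi> \<circ> b))"
    by blast
  then show ?thesis by (simp add: braid_group_def)
qed

lemma one_braid_group: "\<one>\<^bsub>braid_group P\<^esub> = braid_class (linepath P P)"
  by (simp add: braid_group_def linepath_refl)

lemma braid_path_const: "P \<in> conf \<Longrightarrow> braid_path P (linepath P P)"
  by (simp add: braid_path_def)

text \<open>
  The group laws are those of the fundamental groupoid of \<open>conf\<close>: relabelling by a permutation is
  a homeomorphism of \<open>conf\<close>, so that it respects homotopies, joins and reversals.
\<close>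

lemma group_braid_group:
  fixes P :: "complex ^ 'n"
  assumes P: "P \<in> conf"
  shows "group (braid_group P)"
proof (rule groupI)
  let ?G = "braid_group P"
  show "\<one>\<^bsub>?G\<^esub> \<in> carrier ?G"
    unfolding one_braid_group by (intro braid_class_in_carrier braid_path_const P)
next
  let ?G = "braid_group P"
  fix x y assume "x \<in> carrier ?G" "y \<in> carrier ?G"
  then obtain a b where ab: "braid_path P a" "braid_path P b" "x = braid_class a" "y = braid_class b"
    by (auto simp: carrier_braid_group)
  obtain \<pi> where "bij \<pi>" "pathfinish a = relabel \<pi> P" by (rule braid_path_obtain[OF ab(1)])
  then show "x \<otimes>\<^bsub>?G\<^esub> y \<in> carrier ?G"
    using ab by (simp add: mult_braid_class braid_class_in_carrier braid_path_join)
next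
  let ?G = "braid_group P"
  fix x y z assume "x \<in> carrier ?G" "y \<in> carrier ?G" "z \<in> carrier ?G"
  then obtain a b c where ab: "braid_path P a" "braid_path P b" "braid_path P c"
      "x = braid_class a" "y = braid_class b" "z = braid_class c"
    by (auto simp: carrier_braid_group)
  obtain \<pi> where \<pi>: "bij \<pi>" "pathfinish a = relabel \<pi> P" by (rule braid_path_obtain[OF ab(1)])
  obtain \<rho> where \<rho>: "bij \<rho>" "pathfinish b = relabel \<rho> P" by (rule braid_path_obtain[OF ab(2)])
  have *: "pathfinish (a +++ (relabel \<pi> \<circ> b)) = relabel (\<rho> \<circ> \<pi>) P"
    by (simp add: pathfinish_compose \<rho> relabel_relabel)
  have comp: "relabel \<pi> \<circ> (b +++ (relabel \<rho> \<circ> c)) = (relabel \<pi> \<circ> b) +++ (relabel (\<rho> \<circ> \<pi>) \<circ> c)"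
    by (simp add: path_compose_join) (simp add: o_def relabel_relabel)
  have bij: "bij (\<rho> \<circ> \<pi>)" using \<pi> \<rho> bij_comp by blast
  have "homotopic_paths conf (a +++ ((relabel \<pi> \<circ> b) +++ (relabel (\<rho> \<circ> \<pi>) \<circ> c)))
      ((a +++ (relabel \<pi> \<circ> b)) +++ (relabel (\<rho> \<circ> \<pi>) \<circ> c))"
    using ab \<pi> \<rho> bij
    by (intro homotopic_paths_assoc) 
       (auto simp: braid_path_def path_relabel path_image_relabel_conf pathstart_compose pathfinish_compose relabel_relabel)
  then show "x \<otimes>\<^bsub>?G\<^esub> y \<otimes>\<^bsub>?G\<^esub> z = x \<otimes>\<^bsub>?G\<^esub> (y \<otimes>\<^bsub>?G\<^esub> z)"
    using ab \<pi> \<rho> * bij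
    by (simp add: mult_braid_class braid_path_join comp braid_class_eqI homotopic_paths_sym)
next
  let ?G = "braid_group P"
  fix x assume "x \<in> carrier ?G"
  then obtain a where a: "braid_path P a" "x = braid_class a"
    by (auto simp: carrier_braid_group)
  have eq: "relabel id \<circ> a = a" by (simp add: fun_eq_iff)
  have "\<one>\<^bsub>?G\<^esub> \<otimes>\<^bsub>?G\<^esub> x = braid_class (linepath P P +++ a)"
    unfolding one_braid_group a(2)
    by (subst mult_braid_class[where \<pi>=id]) (auto simp: braid_path_const P a eq)
  also have "\<dots> = x"
    unfolding a(2) using a(1) by (intro braid_class_eqI homotopic_paths_lid') (auto simp: braid_path_def)
  finally show "\<one>\<^bsub>?G\<^esub> \<otimes>\<^bsub>?G\<^esub> x = x" .
next
  let ?G = "braid_group P"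
  fix x assume "x \<in> carrier ?G"
  then obtain a where a: "braid_path P a" "x = braid_class a"
    by (auto simp: carrier_braid_group)
  obtain \<pi> where \<pi>: "bij \<pi>" "pathfinish a = relabel \<pi> P" by (rule braid_path_obtain[OF a(1)])
  let ?c = "relabel (inv_into UNIV \<pi>) \<circ> reversepath a"
  have bij: "bij (inv_into UNIV \<pi>)" using \<pi> bij_imp_bij_inv by blast
  have inv: "relabel (inv_into UNIV \<pi>) (relabel \<pi> P) = P"
    using \<pi>(1) by (simp add: relabel_relabel surj_iff[THEN iffD1] bij_is_surj)
  have c: "braid_path P ?c"
    unfolding braid_path_def
  proof (intro conjI)
    show "range (($) (pathfinish ?c)) = range (($) P)"
      unfolding pathfinish_compose range_relabel[OF bij] using a(1) by (simp add: braid_path_def)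
  qed (use a(1) bij \<pi> inv in \<open>auto simp only: braid_path_def path_relabel path_image_relabel_conf
      path_reversepath path_image_reversepath pathstart_compose pathstart_reversepath\<close>)
  have end_c: "pathfinish ?c = relabel (inv_into UNIV \<pi>) P"
    using a(1) by (simp add: pathfinish_compose braid_path_def)
  have "braid_class ?c \<otimes>\<^bsub>?G\<^esub> x = braid_class (?c +++ (relabel (inv_into UNIV \<pi>) \<circ> a))"
    unfolding a(2) by (rule mult_braid_class[OF c a(1) end_c bij])
  also have "\<dots> = braid_class (relabel (inv_into UNIV \<pi>) \<circ> (reversepath a +++ a))"
    by (simp add: path_compose_join)
  also have "\<dots> = braid_class (relabel (inv_into UNIV \<pi>) \<circ> linepath (pathfinish a) (pathfinish a))"
    using a(1) bij by (intro braid_class_eqI homotopic_relabel homotopic_paths_linv) (auto simp: braid_path_def)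
  also have "\<dots> = \<one>\<^bsub>?G\<^esub>"
    by (simp add: one_braid_group relabel_linepath \<pi> inv)
  finally show "\<exists>y\<in>carrier ?G. y \<otimes>\<^bsub>?G\<^esub> x = \<one>\<^bsub>?G\<^esub>"
    using c braid_class_in_carrier by blast
qed

section \<open>Closing up paths of labelled points\<close>

text \<open>
  For the order of the roots: \<open>u\<close> precedes \<open>v\<close> iff \<open>lexpos (u - v)\<close>.  These differences form a
  convex cone without \<open>0\<close>; this is all that straight-line homotopies need, although the cone is not
  open.
\<close>

definition lexpos :: "complex \<Rightarrow> bool" where
  "lexpos d \<longleftrightarrow> Re d > 0 \<or> (Re d = 0 \<and> Im d > 0)"

lemma lexpos_add: "lexpos a \<Longrightarrow> lexpos b \<Longrightarrow> lexpos (a + b)"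
  by (auto simp: lexpos_def)

lemma lexpos_trans: "lexpos (a - b) \<Longrightarrow> lexpos (b - c) \<Longrightarrow> lexpos (a - c)"
  using lexpos_add[of "a - b" "b - c"] by simp

lemma lexpos_scale: "lexpos a \<Longrightarrow> t > 0 \<Longrightarrow> lexpos (t *\<^sub>R a)"
  by (auto simp: lexpos_def)

lemma lexpos_0 [simp]: "\<not> lexpos 0"
  by (simp add: lexpos_def)

lemma lexpos_total: "a \<noteq> b \<Longrightarrow> \<not> lexpos (b - a) \<longleftrightarrow> lexpos (a - b)"
  by (auto simp: lexpos_def complex_eq_iff)

lemma lexpos_not_sym: "lexpos (a - b) \<Longrightarrow> \<not> lexpos (b - a)"
  by (auto simp: lexpos_def)

lemma lexpos_convex:
  assumes "lexpos a" "lexpos b" "0 \<le> t" "t \<le> 1"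
  shows "lexpos ((1 - t) *\<^sub>R a + t *\<^sub>R b)"
proof (cases "t = 0 \<or> t = 1")
  case False
  then show ?thesis using assms by (intro lexpos_add lexpos_scale) auto
qed (use assms in auto)

text \<open>
  The classes of this relation on \<open>conf\<close> are convex, and each of them contains exactly one
  rearrangement of the standard points.  They play the part of a base point that is spread out.
\<close>

definition same_order :: "complex ^ 'n \<Rightarrow> complex ^ 'n \<Rightarrow> bool" where
  "same_order z w \<longleftrightarrow> (\<forall>j k. lexpos (z $ j - z $ k) \<longleftrightarrow> lexpos (w $ j - w $ k))"

lemma same_order_refl [simp]: "same_order z z"
  and same_order_sym: "same_order z w \<Longrightarrow> same_order w z"
  and same_order_trans: "same_order z w \<Longrightarrow> same_order w v \<Longrightarrow> same_order z v"
  by (simp_all add: same_order_def)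

lemma same_order_conf: "same_order z w \<Longrightarrow> z \<in> conf \<Longrightarrow> w \<in> conf"
  unfolding same_order_def conf_iff by (metis diff_self lexpos_0 lexpos_total)

lemma same_order_segment:
  assumes z: "z \<in> conf" and ord: "same_order z v" "same_order z w" and x: "x \<in> closed_segment v w"
  shows "same_order z x"
proof -
  obtain t where t: "0 \<le> t" "t \<le> 1" "x = (1 - t) *\<^sub>R v + t *\<^sub>R w"
    using x by (auto simp: closed_segment_def)
  have *: "lexpos (x $ j - x $ k)" if "lexpos (z $ j - z $ k)" for j k
  proof -
    have "lexpos ((1 - t) *\<^sub>R (v $ j - v $ k) + t *\<^sub>R (w $ j - w $ k))"
      using ord that t by (intro lexpos_convex) (auto simp: same_order_def)
    then show ?thesis by (simp add: t algebra_simps)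
  qed
  have "lexpos (z $ j - z $ k)" if "lexpos (x $ j - x $ k)" for j k
  proof (rule ccontr)
    assume no: "\<not> lexpos (z $ j - z $ k)"
    have "j \<noteq> k" using that by auto
    then have "z $ j \<noteq> z $ k" using z by (auto simp: conf_iff)
    then have "lexpos (z $ k - z $ j)" using no lexpos_total by metis
    then show False using * that lexpos_not_sym by blast
  qed
  with * show ?thesis unfolding same_order_def by blast
qed

text \<open>
  The rearrangement of the standard points in the same order as \<open>z\<close>: the label \<open>k\<close> is sent to
  \<open>-1, -2, \<dots>\<close> according to the number of labels that precede it.
\<close>

definition std_at :: "complex ^ 'n \<Rightarrow> complex ^ 'n" where
  "std_at z = (\<chi> k. - of_nat (Suc (card {j. lexpos (z $ j - z $ k)})))"

lemma std_at_eqI: "same_order z w \<Longrightarrow> std_at z = std_at w"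
  by (simp add: same_order_def std_at_def)

lemma std_at_relabel:
  assumes "bij \<pi>" shows "std_at (relabel \<pi> z) = relabel \<pi> (std_at z)"
proof -
  have "card {j. lexpos (z $ \<pi> j - z $ \<pi> k)} = card {j. lexpos (z $ j - z $ \<pi> k)}" for k
  proof (rule bij_betw_same_card[where f = \<pi>])
    show "bij_betw \<pi> {j. lexpos (z $ \<pi> j - z $ \<pi> k)} {j. lexpos (z $ j - z $ \<pi> k)}"
      using assms by (intro bij_betwI[where g = "inv_into UNIV \<pi>"])
        (auto simp: bij_is_surj surj_f_inv_f bij_is_inj)
  qed
  then show ?thesis by (simp add: vec_eq_iff std_at_def)
qed

lemma same_order_std_at:
  assumes z: "z \<in> conf" shows "same_order z (std_at z)"
proof -
  have less: "card {i. lexpos (z $ i - z $ j)} < card {i. lexpos (z $ i - z $ k)}"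
    if "lexpos (z $ j - z $ k)" for j k
  proof (rule psubset_card_mono)
    show "{i. lexpos (z $ i - z $ j)} \<subset> {i. lexpos (z $ i - z $ k)}"
      using that lexpos_trans by (auto intro!: psubsetI) (metis diff_self lexpos_0 mem_Collect_eq)
  qed simp
  have "lexpos (std_at z $ j - std_at z $ k) \<longleftrightarrow> lexpos (z $ j - z $ k)" for j k
  proof -
    have "lexpos (std_at z $ j - std_at z $ k) \<longleftrightarrow>
        card {i. lexpos (z $ i - z $ j)} < card {i. lexpos (z $ i - z $ k)}"
      by (simp add: std_at_def lexpos_def)
    also have "\<dots> \<longleftrightarrow> lexpos (z $ j - z $ k)"
      using less[of j k] less[of k j] lexpos_total[of "z $ j" "z $ k"] z
      by (cases "j = k") (auto simp: conf_iff, metis less_asym)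
    finally show ?thesis .
  qed
  then show ?thesis by (simp add: same_order_def)
qed

lemma std_at_conf: "z \<in> conf \<Longrightarrow> std_at z \<in> conf"
  using same_order_std_at same_order_conf by blast

lemma segment_same_order_conf:
  "z \<in> conf \<Longrightarrow> same_order z v \<Longrightarrow> same_order z w \<Longrightarrow> closed_segment v w \<subseteq> conf"
  using same_order_segment same_order_conf by blast

definition sorted4 :: "complex ^ 4 \<Rightarrow> bool" where
  "sorted4 z \<longleftrightarrow> lexpos (z $ 1 - z $ 2) \<and> lexpos (z $ 2 - z $ 3) \<and> lexpos (z $ 3 - z $ 4)"

lemma sorted4_lexpos:
  assumes "sorted4 z"
  shows "lexpos (z $ 1 - z $ 2)" "lexpos (z $ 1 - z $ 3)" "lexpos (z $ 1 - z $ 4)"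
    "lexpos (z $ 2 - z $ 3)" "lexpos (z $ 2 - z $ 4)" "lexpos (z $ 3 - z $ 4)"
  using assms lexpos_trans unfolding sorted4_def by blast+

lemma sorted4_same_order: "sorted4 z \<Longrightarrow> sorted4 w \<Longrightarrow> same_order z w"
  unfolding same_order_def forall_4
  using sorted4_lexpos[of z] sorted4_lexpos[of w] lexpos_not_sym by (simp; blast)

lemma vector_4 [simp]:
  "(vector [a, b, c, d] :: 'a::zero ^ 4) $ 1 = a" "(vector [a, b, c, d] :: 'a ^ 4) $ 2 = b"
  "(vector [a, b, c, d] :: 'a ^ 4) $ 3 = c" "(vector [a, b, c, d] :: 'a ^ 4) $ 4 = d"
  unfolding vector_def by simp_all

lemma std_base_nth [simp]:
  "std_base $ 1 = -1" "std_base $ 2 = -2" "std_base $ 3 = -3" "std_base $ 4 = -4"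
  by (simp_all add: std_base_def vector_4)

lemma sorted4_std_base: "sorted4 std_base"
  by (simp add: sorted4_def lexpos_def)

lemma neq_4 [simp]: "(1::4) \<noteq> 2" "(1::4) \<noteq> 3" "(1::4) \<noteq> 4" "(2::4) \<noteq> 3" "(2::4) \<noteq> 4" "(3::4) \<noteq> 4"
   "(2::4) \<noteq> 1" "(3::4) \<noteq> 1" "(4::4) \<noteq> 1" "(3::4) \<noteq> 2" "(4::4) \<noteq> 2" "(4::4) \<noteq> 3"
  by simp_all

lemma conf_4: "z \<in> conf \<longleftrightarrow> z $ 1 \<noteq> z $ 2 \<and> z $ 1 \<noteq> z $ 3 \<and> z $ 1 \<noteq> z $ 4 \<and>
    z $ 2 \<noteq> z $ 3 \<and> z $ 2 \<noteq> z $ (4::4) \<and> z $ 3 \<noteq> z $ 4"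
  unfolding conf_iff forall_4 by auto

lemma std_base_conf [simp]: "std_base \<in> conf"
  by (simp add: conf_4)

lemma range_4: "range (f :: 4 \<Rightarrow> 'a) = {f 1, f 2, f 3, f 4}"
  by (simp add: UNIV_4)

lemma Collect_4: "{j::4. P j} = (if P 1 then {1} else {}) \<union> (if P 2 then {2} else {}) \<union>
     (if P 3 then {3} else {}) \<union> (if P 4 then {4} else {})"
proof (rule Set.set_eqI)
  fix x :: 4
  show "x \<in> {j. P j} \<longleftrightarrow> x \<in> (if P 1 then {1} else {}) \<union> (if P 2 then {2} else {}) \<union>
     (if P 3 then {3} else {}) \<union> (if P 4 then {4} else {})"
    using exhaust_4[of x] by (elim disjE) simp_all
qed

lemma std_at_std_base [simp]: "std_at std_base = std_base"
  unfolding vec_eq_iff forall_4 std_at_def by (simp add: Collect_4 lexpos_def)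

lemma std_at_sorted4: "sorted4 z \<Longrightarrow> std_at z = std_base"
  using std_at_eqI[OF sorted4_same_order[OF _ sorted4_std_base]] by simp

lemma sorted4_iff: 
  assumes "z \<in> conf" shows "sorted4 z \<longleftrightarrow> std_at z = std_base"
proof
  assume "std_at z = std_base"
  then have "same_order z std_base" using same_order_std_at[OF assms] by simp
  then show "sorted4 z" using sorted4_std_base unfolding sorted4_def same_order_def by blast
qed (rule std_at_sorted4)

lemma range_std_at:
  fixes z :: "complex ^ 4"
  assumes z: "z \<in> conf" shows "range (($) (std_at z)) = range (($) std_base)"
proof (rule card_subset_eq)
  show "range (($) (std_at z)) \<subseteq> range (($) std_base)"
  proof
    fix w assume "w \<in> range (($) (std_at z))"
    then obtain k where k: "w = std_at z $ k" by blast
    have "{j. lexpos (z $ j - z $ k)} \<subseteq> UNIV - {k}" by auto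
    then have "card {j. lexpos (z $ j - z $ k)} \<le> card (UNIV - {k})" by (intro card_mono) auto
    also have "\<dots> = 3" by (subst card_Diff_subset) auto
    finally consider "card {j. lexpos (z $ j - z $ k)} = 0" | "card {j. lexpos (z $ j - z $ k)} = 1"
      | "card {j. lexpos (z $ j - z $ k)} = 2" | "card {j. lexpos (z $ j - z $ k)} = 3"
      by linarith
    then show "w \<in> range (($) std_base)"
      unfolding range_4 by cases (simp_all add: k std_at_def)
  qed
  have "card (range (($) w)) = 4" if "w \<in> conf" for w :: "complex ^ 4"
    using that by (subst card_image) (auto simp: conf_def)
  then show "card (range (($) (std_at z))) = card (range (($) std_base))"
    using z by (simp add: std_at_conf)
qed simp

lemma sorting:
  fixes z :: "complex ^ 4"
  assumes z: "z \<in> conf"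
  obtains \<pi> where "bij \<pi>" "relabel \<pi> (std_at z) = std_base"
  using relabel_if_same_range[OF std_at_conf[OF z] std_base_conf range_std_at[OF z]] by metis

text \<open>
  For a path that starts at a decreasing tuple this is, up to bracketing, the path by which braids
  based at the roots are carried to the standard points.
\<close>

definition closing :: "(real \<Rightarrow> complex ^ 'n) \<Rightarrow> real \<Rightarrow> complex ^ 'n" where
  "closing p = linepath (std_at (pathstart p)) (pathstart p) +++
     (p +++ linepath (pathfinish p) (std_at (pathfinish p)))"

abbreviation conf_path :: "(real \<Rightarrow> complex ^ 'n) \<Rightarrow> bool" where
  "conf_path p \<equiv> path p \<and> path_image p \<subseteq> conf"

lemma closing_ends [simp]: "pathstart (closing p) = std_at (pathstart p)"
    "pathfinish (closing p) = std_at (pathfinish p)"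
  by (simp_all add: closing_def)

lemma std_segment_conf: "z \<in> conf \<Longrightarrow> closed_segment (std_at z) z \<subseteq> conf"
    "z \<in> conf \<Longrightarrow> closed_segment z (std_at z) \<subseteq> conf"
  by (simp_all add: segment_same_order_conf same_order_std_at)

lemma conf_path_join:
  "conf_path p \<Longrightarrow> conf_path q \<Longrightarrow> pathfinish p = pathstart q \<Longrightarrow> conf_path (p +++ q)"
  by (simp add: subset_path_image_join)

lemma conf_path_closing:
  assumes "conf_path p" shows "conf_path (closing p)"
proof -
  have "conf_path (linepath (std_at (pathstart p)) (pathstart p))"
       "conf_path (linepath (pathfinish p) (std_at (pathfinish p)))"
    using assms by (simp_all add: std_segment_conf pathstart_in_conf pathfinish_in_conf)
  then show ?thesis unfolding closing_def using assms by (intro conf_path_join) simp_all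
qed

lemma homotopic_cancel:
  assumes "conf_path p" "conf_path r" "pathstart r = pathfinish p" 
  shows "homotopic_paths conf (reversepath p +++ (p +++ r)) r"
proof -
  have "homotopic_paths conf (reversepath p +++ (p +++ r)) ((reversepath p +++ p) +++ r)"
    using assms by (intro homotopic_paths_assoc) auto
  also have "homotopic_paths conf \<dots> (linepath (pathfinish p) (pathfinish p) +++ r)"
    using assms by (intro homotopic_paths_join homotopic_paths_linv) auto
  also have "homotopic_paths conf \<dots> r"
    using assms by (intro homotopic_paths_lid') auto
  finally show ?thesis .
qed

lemma closing_join:
  assumes p: "conf_path p" and q: "conf_path q" and pq: "pathfinish p = pathstart q"
  shows "homotopic_paths conf (closing p +++ closing q) (closing (p +++ q))"
proof -
  define A where "A = linepath (std_at (pathstart p)) (pathstart p)"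
  define B where "B = linepath (std_at (pathstart q)) (pathstart q)"
  define C where "C = linepath (pathfinish q) (std_at (pathfinish q))"
  have A: "conf_path A" and B: "conf_path B" and C: "conf_path C"
    using p q by (simp_all add: A_def B_def C_def std_segment_conf pathstart_in_conf pathfinish_in_conf)
  have ends: "pathfinish A = pathstart p" "pathfinish B = pathstart q" "pathstart C = pathfinish q"
    by (simp_all add: A_def B_def C_def)
  have qC: "conf_path (q +++ C)" using q C ends by (simp add: path_image_join)
  have BqC: "conf_path (B +++ (q +++ C))" using B q C ends by (simp add: path_image_join)
  have rB: "conf_path (reversepath B)" using B by simp
  have rBBqC: "conf_path (reversepath B +++ (B +++ (q +++ C)))"
    using B q C ends by (simp add: path_image_join)
  have pB: "conf_path (p +++ reversepath B)" using p rB ends pq by (intro conf_path_join) simp_all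
  have clp: "closing p = A +++ (p +++ reversepath B)" and clq: "closing q = B +++ (q +++ C)"
    and clpq: "closing (p +++ q) = A +++ ((p +++ q) +++ C)"
    by (simp_all add: closing_def A_def B_def C_def pq)
  have "homotopic_paths conf ((A +++ (p +++ reversepath B)) +++ (B +++ (q +++ C)))
      (A +++ ((p +++ reversepath B) +++ (B +++ (q +++ C))))"
    using A pB BqC ends pq by (intro homotopic_paths_sym[OF homotopic_paths_assoc]) auto
  also have "homotopic_paths conf \<dots> (A +++ (p +++ (reversepath B +++ (B +++ (q +++ C)))))"
    using A p rB BqC ends pq
    by (intro homotopic_paths_join homotopic_paths_sym[OF homotopic_paths_assoc]) auto
  also have "homotopic_paths conf \<dots> (A +++ (p +++ (q +++ C)))"
    using A p B qC ends pq by (intro homotopic_paths_join homotopic_cancel) auto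
  also have "homotopic_paths conf \<dots> (A +++ ((p +++ q) +++ C))"
    using A p q C ends pq by (intro homotopic_paths_join homotopic_paths_assoc) auto
  finally show ?thesis unfolding clp clq clpq .
qed

lemma segment_join:
  assumes "\<And>t. t \<in> {0..1} \<Longrightarrow> closed_segment (p t) (p' t) \<subseteq> S"
    "\<And>t. t \<in> {0..1} \<Longrightarrow> closed_segment (q t) (q' t) \<subseteq> S" "t \<in> {0..1::real}"
  shows "closed_segment ((p +++ q) t) ((p' +++ q') t) \<subseteq> S"
  using assms by (simp add: joinpaths_def)

text \<open>
  The straight-line homotopy extends over the two segments that close up the paths, because these
  stay in one convex class of \<open>same_order\<close>.
\<close>

lemma closing_linear:
  fixes p q :: "real \<Rightarrow> complex ^ 'n"
  assumes p: "conf_path p" and q: "conf_path q"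
    and seg: "\<And>t. t \<in> {0..1} \<Longrightarrow> closed_segment (p t) (q t) \<subseteq> conf"
    and start: "same_order (pathstart p) (pathstart q)"
    and finish: "same_order (pathfinish p) (pathfinish q)"
  shows "homotopic_paths conf (closing p) (closing q)"
proof (rule homotopic_paths_linear)
  have eq: "std_at (pathstart q) = std_at (pathstart p)" "std_at (pathfinish q) = std_at (pathfinish p)"
    by (rule std_at_eqI[symmetric], fact)+
  show "pathstart (closing q) = pathstart (closing p)" "pathfinish (closing q) = pathfinish (closing p)"
    by (simp_all add: eq)
  show "path (closing p)" "path (closing q)" using conf_path_closing p q by auto
  have *: "closed_segment (linepath v z t) (linepath v w t) \<subseteq> conf"
    if z: "z \<in> conf" and zw: "same_order z w" and v: "v = std_at z" and t: "t \<in> {0..1::real}"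
    for z w v :: "complex ^ 'n" and t
  proof (rule segment_same_order_conf[OF z])
    have zv: "same_order z v" unfolding v by (rule same_order_std_at[OF z])
    show "same_order z (linepath v z t)" and "same_order z (linepath v w t)"
      using same_order_segment[OF z zv same_order_refl linepath_in_path[OF t]]
        same_order_segment[OF z zv zw linepath_in_path[OF t]] by blast+
  qed
  have rev: "linepath a b t = linepath b a (1 - t)" for a b :: "complex ^ 'n" and t
    by (simp add: linepath_def)
  show "closed_segment (closing p t) (closing q t) \<subseteq> conf" if "t \<in> {0..1}" for t
    unfolding closing_def eq
  proof (intro segment_join that seg)
    fix t :: real assume t: "t \<in> {0..1}"
    show "closed_segment (linepath (std_at (pathstart p)) (pathstart p) t)
          (linepath (std_at (pathstart p)) (pathstart q) t) \<subseteq> conf"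
      using p by (intro * start t refl pathstart_in_conf) auto
    show "closed_segment (linepath (pathfinish p) (std_at (pathfinish p)) t)
          (linepath (pathfinish q) (std_at (pathfinish p)) t) \<subseteq> conf"
      unfolding rev[of "pathfinish p"] rev[of "pathfinish q"]
      using p t by (intro * finish refl pathfinish_in_conf) auto
  qed
qed

lemma closing_relabel: "bij \<pi> \<Longrightarrow> closing (relabel \<pi> \<circ> p) = relabel \<pi> \<circ> closing p"
  by (simp add: closing_def path_compose_join relabel_linepath pathstart_compose pathfinish_compose
      std_at_relabel)

lemma closing_homotopic:
  assumes "homotopic_paths conf p q"
  shows "homotopic_paths conf (closing p) (closing q)"
proof -
  have ends: "pathstart q = pathstart p" "pathfinish q = pathfinish p"
    using assms homotopic_paths_imp_pathstart homotopic_paths_imp_pathfinish by metis+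
  have p: "conf_path p" using assms homotopic_paths_imp_path homotopic_paths_imp_subset by blast
  have "conf_path (linepath (std_at (pathstart p)) (pathstart p))"
       "conf_path (linepath (pathfinish p) (std_at (pathfinish p)))"
    using p by (simp_all add: std_segment_conf pathstart_in_conf pathfinish_in_conf)
  then show ?thesis unfolding closing_def ends
    using assms by (intro homotopic_paths_join) auto
qed

section \<open>The braid of a path of labelled points\<close>

text \<open>
  The labels are permuted so that the closed up path starts at \<open>std_base\<close>.  The ends of \<open>p\<close> are
  arbitrary: \<open>braid_of\<close> is a functor from the fundamental groupoid of \<open>conf\<close> to the braid group, and it
  ignores the labelling.  This makes it possible to cut the path of the roots wherever convenient.
\<close>

definition braid_of :: "(real \<Rightarrow> complex ^ 4) \<Rightarrow> (real \<Rightarrow> complex ^ 4) set" where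
  "braid_of p = braid_class
     (relabel (SOME \<pi>. bij \<pi> \<and> relabel \<pi> (std_at (pathstart p)) = std_base) \<circ> closing p)"

lemma braid_of_eqI:
  assumes "conf_path p" "bij \<pi>" "relabel \<pi> (std_at (pathstart p)) = std_base"
  shows "braid_of p = braid_class (relabel \<pi> \<circ> closing p)"
proof -
  let ?\<rho> = "SOME \<pi>. bij \<pi> \<and> relabel \<pi> (std_at (pathstart p)) = std_base"
  have "bij ?\<rho> \<and> relabel ?\<rho> (std_at (pathstart p)) = std_base"
    by (rule someI[of _ \<pi>]) (use assms(2,3) in blast)
  moreover have "std_at (pathstart p) \<in> conf"
    using assms(1) by (simp add: std_at_conf pathstart_in_conf)
  ultimately have "?\<rho> = \<pi>"
    using assms(3) relabel_inject[of "std_at (pathstart p)" ?\<rho> \<pi>] by simp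
  then show ?thesis by (simp add: braid_of_def)
qed

lemma braid_of_obtain:
  assumes p: "conf_path p"
  obtains \<pi> where "bij \<pi>" "relabel \<pi> (std_at (pathstart p)) = std_base"
    "braid_of p = braid_class (relabel \<pi> \<circ> closing p)" "braid_path std_base (relabel \<pi> \<circ> closing p)"
proof -
  obtain \<pi> where \<pi>: "bij \<pi>" "relabel \<pi> (std_at (pathstart p)) = std_base"
    using sorting[OF pathstart_in_conf] p by metis
  have cl: "conf_path (closing p)" by (rule conf_path_closing[OF p])
  have "range (($) (pathfinish (relabel \<pi> \<circ> closing p))) = range (($) std_base)"
    unfolding pathfinish_compose range_relabel[OF \<pi>(1)] closing_ends
    using p by (intro range_std_at pathfinish_in_conf) auto
  moreover have "conf_path (relabel \<pi> \<circ> closing p)"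
    using cl \<pi>(1) by (simp only: path_relabel path_image_relabel_conf simp_thms)
  ultimately have "braid_path std_base (relabel \<pi> \<circ> closing p)"
    using \<pi> by (simp add: braid_path_def pathstart_compose)
  then show ?thesis using that \<pi> braid_of_eqI[OF p \<pi>] by blast
qed

lemma braid_of_in_carrier: "conf_path p \<Longrightarrow> braid_of p \<in> carrier B4"
  by (metis braid_of_obtain braid_class_in_carrier)

lemma braid_of_closing_homotopic:
  assumes p: "conf_path p" and q: "conf_path q" and hom: "homotopic_paths conf (closing p) (closing q)"
  shows "braid_of p = braid_of q"
proof -
  obtain \<pi> where \<pi>: "bij \<pi>" "relabel \<pi> (std_at (pathstart p)) = std_base"
    "braid_of p = braid_class (relabel \<pi> \<circ> closing p)" using braid_of_obtain[OF p] by metis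
  have "std_at (pathstart p) = std_at (pathstart q)"
    using homotopic_paths_imp_pathstart[OF hom] by simp
  then have "braid_of q = braid_class (relabel \<pi> \<circ> closing q)"
    using \<pi> by (intro braid_of_eqI[OF q]) auto
  then show ?thesis
    unfolding \<pi>(3) by (simp add: braid_class_eqI homotopic_relabel[OF hom \<pi>(1)])
qed

lemma braid_of_homotopic: "homotopic_paths conf p q \<Longrightarrow> braid_of p = braid_of q"
  by (meson braid_of_closing_homotopic closing_homotopic homotopic_paths_imp_path homotopic_paths_imp_subset)

text \<open>
  The source of all equalities between braids below.
\<close>

lemma braid_of_linear:
  assumes "conf_path p" "conf_path q"
    and "\<And>t. t \<in> {0..1} \<Longrightarrow> closed_segment (p t) (q t) \<subseteq> conf"
    and "same_order (pathstart p) (pathstart q)" "same_order (pathfinish p) (pathfinish q)"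
  shows "braid_of p = braid_of q"
  using assms by (intro braid_of_closing_homotopic closing_linear)

lemma braid_of_relabel:
  assumes p: "conf_path p" and \<rho>: "bij \<rho>"
  shows "braid_of (relabel \<rho> \<circ> p) = braid_of p"
proof -
  let ?q = "relabel \<rho> \<circ> p"
  have q: "conf_path ?q" using p \<rho> by (simp only: path_relabel path_image_relabel_conf simp_thms)
  obtain \<pi> where \<pi>: "bij \<pi>" "relabel \<pi> (std_at (pathstart ?q)) = std_base"
    "braid_of ?q = braid_class (relabel \<pi> \<circ> closing ?q)" using braid_of_obtain[OF q] by metis
  have "braid_of p = braid_class (relabel (\<rho> \<circ> \<pi>) \<circ> closing p)"
    using \<pi> \<rho> by (intro braid_of_eqI[OF p])
      (auto simp: bij_comp pathstart_compose std_at_relabel relabel_relabel)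
  also have "relabel (\<rho> \<circ> \<pi>) \<circ> closing p = relabel \<pi> \<circ> closing ?q"
    by (simp add: closing_relabel[OF \<rho>] fun_eq_iff relabel_relabel)
  finally show ?thesis using \<pi>(3) by (simp add: o_def)
qed

lemma braid_of_join:
  assumes p: "conf_path p" and q: "conf_path q" and pq: "pathfinish p = pathstart q"
  shows "braid_of (p +++ q) = braid_of p \<otimes>\<^bsub>B4\<^esub> braid_of q"
proof -
  obtain \<pi> where \<pi>: "bij \<pi>" "relabel \<pi> (std_at (pathstart p)) = std_base"
    "braid_of p = braid_class (relabel \<pi> \<circ> closing p)" "braid_path std_base (relabel \<pi> \<circ> closing p)"
    using braid_of_obtain[OF p] by metis
  obtain \<rho> where \<rho>: "bij \<rho>" "relabel \<rho> (std_at (pathstart q)) = std_base"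
    "braid_of q = braid_class (relabel \<rho> \<circ> closing q)" "braid_path std_base (relabel \<rho> \<circ> closing q)"
    using braid_of_obtain[OF q] by metis
  obtain \<mu> where \<mu>: "bij \<mu>" "pathfinish (relabel \<pi> \<circ> closing p) = relabel \<mu> std_base"
    using braid_path_obtain[OF \<pi>(4)] by metis
  have "relabel \<pi> (std_at (pathstart q)) = relabel \<mu> (relabel \<rho> (std_at (pathstart q)))"
    using \<mu>(2) \<rho>(2) by (simp add: pathfinish_compose pq)
  then have \<pi>_eq: "\<pi> = \<rho> \<circ> \<mu>"
    using q by (simp add: relabel_relabel relabel_inject std_at_conf pathstart_in_conf)
  have "braid_of p \<otimes>\<^bsub>B4\<^esub> braid_of q
      = braid_class ((relabel \<pi> \<circ> closing p) +++ (relabel \<mu> \<circ> (relabel \<rho> \<circ> closing q)))"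
    unfolding \<pi>(3) \<rho>(3) by (rule mult_braid_class[OF \<pi>(4) \<rho>(4) \<mu>(2) \<mu>(1)])
  also have "relabel \<mu> \<circ> (relabel \<rho> \<circ> closing q) = relabel \<pi> \<circ> closing q"
    by (simp add: fun_eq_iff relabel_relabel \<pi>_eq)
  also have "(relabel \<pi> \<circ> closing p) +++ (relabel \<pi> \<circ> closing q) = relabel \<pi> \<circ> (closing p +++ closing q)"
    by (simp add: path_compose_join)
  also have "braid_class \<dots> = braid_class (relabel \<pi> \<circ> closing (p +++ q))"
    by (intro braid_class_eqI homotopic_relabel closing_join p q pq \<pi>(1))
  also have "\<dots> = braid_of (p +++ q)"
    using \<pi> by (intro braid_of_eqI[symmetric] conf_path_join p q pq) auto
  finally show ?thesis by simp
qed

lemma group_B4: "group B4"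
  by (rule group_braid_group) simp

lemma braid_of_const:
  assumes "z \<in> conf" shows "braid_of (linepath z z) = \<one>\<^bsub>B4\<^esub>"
proof -
  interpret group B4 by (rule group_B4)
  have c: "conf_path (linepath z z)" using assms by simp
  \<comment> \<open>The braid of a constant path is idempotent.\<close>
  have "homotopic_paths conf (linepath z z +++ linepath z z) (linepath z z)"
    using c by (intro homotopic_paths_rid') auto
  then have "braid_of (linepath z z +++ linepath z z) = braid_of (linepath z z)"
    by (rule braid_of_homotopic)
  then have "braid_of (linepath z z) \<otimes>\<^bsub>B4\<^esub> braid_of (linepath z z) = braid_of (linepath z z)"
    using c by (simp add: braid_of_join)
  then show ?thesis using braid_of_in_carrier[OF c] by simp
qed

lemma braid_of_constant_order:
  assumes p: "conf_path p" and ord: "\<And>t. t \<in> {0..1} \<Longrightarrow> same_order (p 0) (p t)"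
  shows "braid_of p = \<one>\<^bsub>B4\<^esub>"
proof -
  have z: "p 0 \<in> conf" using pathstart_in_conf p by (metis pathstart_def)
  have "braid_of p = braid_of (linepath (p 0) (p 0))"
  proof (rule braid_of_linear[OF p])
    show "closed_segment (p t) (linepath (p 0) (p 0) t) \<subseteq> conf" if "t \<in> {0..1}" for t
      using ord[OF that] z by (intro segment_same_order_conf[OF z]) auto
  qed (use z ord[of 1] in \<open>auto simp: pathstart_def pathfinish_def same_order_sym\<close>)
  then show ?thesis by (simp add: braid_of_const[OF z])
qed

lemma braid_of_reverse:
  assumes p: "conf_path p"
  shows "braid_of (reversepath p) = inv\<^bsub>B4\<^esub> braid_of p"
proof -
  interpret group B4 by (rule group_B4)
  have "braid_of (reversepath p) \<otimes>\<^bsub>B4\<^esub> braid_of p = braid_of (reversepath p +++ p)"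
    using p by (simp add: braid_of_join)
  also have "\<dots> = braid_of (linepath (pathfinish p) (pathfinish p))"
    using p by (intro braid_of_homotopic homotopic_paths_linv) auto
  also have "\<dots> = \<one>\<^bsub>B4\<^esub>" using p by (simp add: braid_of_const pathfinish_in_conf)
  finally show ?thesis
    using p by (intro inv_equality[symmetric] braid_of_in_carrier) auto
qed

section \<open>Recognising half-twists\<close>

text \<open>
  The labels of type \<open>4\<close> in the order \<open>1, 2, 3, 4\<close>; since \<open>4 = 0\<close> in this type, the order of
  the type is not the one that is wanted.
\<close>

definition before :: "4 \<Rightarrow> 4 \<Rightarrow> bool" where
  "before j k \<longleftrightarrow> lexpos (std_base $ j - std_base $ k)"

lemma before_simps [simp]:
  "before 1 2" "before 1 3" "before 1 4" "before 2 3" "before 2 4" "before 3 4"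
  "\<not> before 2 1" "\<not> before 3 1" "\<not> before 4 1" "\<not> before 3 2" "\<not> before 4 2" "\<not> before 4 3" "\<not> before j j"
  by (simp_all add: before_def lexpos_def)

lemma forall_before: "(\<forall>j k. before j k \<longrightarrow> P j k) \<longleftrightarrow> P 1 2 \<and> P 1 3 \<and> P 1 4 \<and> P 2 3 \<and> P 2 4 \<and> P 3 4"
  unfolding forall_4 by simp

lemma conf_before: "z \<in> conf \<longleftrightarrow> (\<forall>j k. before j k \<longrightarrow> z $ j \<noteq> z $ k)"
  unfolding forall_before conf_4 by simp

text \<open>
  Along a segment two strands collide only if their differences at the two ends point in opposite
  directions.  The three lemmas that follow give reasons why this does not happen.
\<close>

lemma segment_confI:
  assumes "\<And>j k. before j k \<Longrightarrow> 0 \<notin> closed_segment (z $ j - z $ k) (w $ j - w $ k)"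
  shows "closed_segment z w \<subseteq> conf"
proof
  fix x assume "x \<in> closed_segment z w"
  then obtain t where t: "0 \<le> t" "t \<le> 1" "x = (1 - t) *\<^sub>R z + t *\<^sub>R w"
    by (auto simp: closed_segment_def)
  have "x $ j - x $ k \<in> closed_segment (z $ j - z $ k) (w $ j - w $ k)" for j k
    unfolding closed_segment_def mem_Collect_eq t(3)
    by (intro exI[of _ t]) (simp add: t(1,2) algebra_simps)
  then show "x \<in> conf"
    unfolding conf_before using assms by (metis right_minus_eq)
qed

lemma lexpos_segment: 
  assumes "lexpos a" "lexpos b" shows "0 \<notin> closed_segment a b"
proof
  assume "0 \<in> closed_segment a b"
  then obtain t where "0 \<le> t" "t \<le> 1" "0 = (1 - t) *\<^sub>R a + t *\<^sub>R b"
    by (auto simp: closed_segment_def)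
  then show False using lexpos_convex[OF assms, of t] by simp
qed

lemma halfplane_segment:
  assumes "Re (a * cnj c) > 0" "Re (b * cnj c) > 0" shows "0 \<notin> closed_segment a b"
proof
  assume "0 \<in> closed_segment a b"
  then obtain t where t: "0 \<le> t" "t \<le> 1" "0 = (1 - t) *\<^sub>R a + t *\<^sub>R b"
    by (auto simp: closed_segment_def)
  have "0 = Re (((1 - t) *\<^sub>R a + t *\<^sub>R b) * cnj c)" using t(3) by simp
  also have "\<dots> = (1 - t) * Re (a * cnj c) + t * Re (b * cnj c)"
    by (simp add: algebra_simps)
  also have "\<dots> > 0"
  proof (cases "t = 1")
    case False
    then have "(1 - t) * Re (a * cnj c) > 0" "t * Re (b * cnj c) \<ge> 0"
      using t assms by auto
    then show ?thesis by linarith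
  qed (use assms in simp)
  finally show False by simp
qed

lemma Im_segment:
  assumes "Im a > 0" "Im b \<ge> 0" "b \<noteq> 0" shows "0 \<notin> closed_segment a b"
proof
  assume "0 \<in> closed_segment a b"
  then obtain t where t: "0 \<le> t" "t \<le> 1" "0 = (1 - t) *\<^sub>R a + t *\<^sub>R b"
    by (auto simp: closed_segment_def)
  show False
  proof (cases "t = 1")
    case False
    then have "(1 - t) * Im a > 0" "t * Im b \<ge> 0" using t assms by auto
    moreover have "(1 - t) * Im a + t * Im b = 0" using arg_cong[OF t(3), of Im] by simp
    ultimately show False by linarith
  qed (use t assms in simp)
qed

lemma half_twist_diff:
  assumes "i = 1 \<or> i = 2 \<or> i = 3"
  shows "half_twist i t $ i - half_twist i t $ (i + 1) = cis (pi * t)"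
  using assms by (auto simp: half_twist_def Let_def field_simps)

lemma half_twist_lexpos:
  assumes "i = 1 \<or> i = 2 \<or> i = 3" "before j k" "(j, k) \<noteq> (i, i + 1)"
  shows "lexpos (half_twist i t $ j - half_twist i t $ k)"
proof -
  have *: "-3 < cos (pi * t)" "-5 < cos (pi * t)" "cos (pi * t) < 3" "cos (pi * t) < 5"
    using cos_ge_minus_one[of "pi * t"] cos_le_one[of "pi * t"] by linarith+
  have "\<forall>j k. before j k \<longrightarrow> (j, k) \<noteq> (i, i + 1) \<longrightarrow> 0 < Re (half_twist i t $ j - half_twist i t $ k)"
    using assms(1)
  proof (elim disjE)
    assume "i = 1" with * show ?thesis
      unfolding forall_before by (auto simp: half_twist_def Let_def field_simps)
  next
    assume "i = 2" with * show ?thesis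
      unfolding forall_before by (auto simp: half_twist_def Let_def field_simps)
  next
    assume "i = 3" with * show ?thesis
      unfolding forall_before by (auto simp: half_twist_def Let_def field_simps)
  qed
  then show ?thesis using assms by (simp add: lexpos_def)
qed

lemma path_half_twist: "path (half_twist i)"
  unfolding path_def half_twist_def Let_def
proof (rule continuous_on_vec_lambda)
  fix k :: 4
  show "continuous_on {0..1} (\<lambda>x. if k = i \<or> k = i + 1
      then (std_base $ i + std_base $ (i + 1)) / 2 +
           cis (pi * x) * (std_base $ k - (std_base $ i + std_base $ (i + 1)) / 2)
      else std_base $ k)"
    by (cases "k = i \<or> k = i + 1") (simp_all add: continuous_intros)
qed

lemma half_twist_conf:
  assumes "i = 1 \<or> i = 2 \<or> i = 3" shows "half_twist i t \<in> conf"
  unfolding conf_before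
proof (intro allI impI)
  fix j k assume "before j k"
  then show "half_twist i t $ j \<noteq> half_twist i t $ k"
    using half_twist_diff[OF assms, of t] half_twist_lexpos[OF assms \<open>before j k\<close>, of t]
    by (cases "(j, k) = (i, i + 1)") (auto simp del: cis_conv_exp)
qed

lemma conf_path_half_twist: "i = 1 \<or> i = 2 \<or> i = 3 \<Longrightarrow> conf_path (half_twist i)"
  using half_twist_conf[of i] path_half_twist[of i] by (auto simp: path_image_def)

lemma half_twist_0: "half_twist i 0 = std_base"
  by (simp add: half_twist_def Let_def vec_eq_iff)

lemma half_twist_1:
  assumes "i = 1 \<or> i = 2 \<or> i = 3"
  shows "half_twist i 1 = relabel (Transposition.transpose i (i + 1)) std_base"
  unfolding vec_eq_iff forall_4 using assms
  by (elim disjE) (simp_all add: half_twist_def Let_def transpose_def field_simps)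

lemma homotopic_closing_std:
  assumes "conf_path p" "std_at (pathstart p) = pathstart p" "std_at (pathfinish p) = pathfinish p"
  shows "homotopic_paths conf (closing p) p"
proof -
  have "homotopic_paths conf (closing p) (p +++ linepath (pathfinish p) (pathfinish p))"
    unfolding closing_def assms(2,3) using assms(1)
    by (intro homotopic_paths_lid') (auto simp: pathfinish_in_conf path_image_join)
  also have "homotopic_paths conf \<dots> p"
    using assms(1) by (intro homotopic_paths_rid') auto
  finally show ?thesis .
qed

lemma braid_of_half_twist:
  assumes i: "i = 1 \<or> i = 2 \<or> i = 3" shows "braid_of (half_twist i) = \<sigma> i"
proof -
  have ht: "conf_path (half_twist i)" by (rule conf_path_half_twist[OF i])
  have b: "bij (Transposition.transpose i (i + 1))" by simp
  have "braid_of (half_twist i) = braid_class (relabel id \<circ> closing (half_twist i))"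
    by (rule braid_of_eqI[OF ht]) (auto simp: pathstart_def half_twist_0)
  also have "relabel id \<circ> closing (half_twist i) = closing (half_twist i)" by (simp add: fun_eq_iff)
  also have "braid_class \<dots> = braid_class (half_twist i)"
    using ht i by (intro braid_class_eqI homotopic_closing_std)
      (auto simp: pathstart_def pathfinish_def half_twist_0 half_twist_1 std_at_relabel[OF b])
  finally show ?thesis by (simp add: \<sigma>_def)
qed

lemma \<sigma>_in_carrier: "i = 1 \<or> i = 2 \<or> i = 3 \<Longrightarrow> \<sigma> i \<in> carrier B4"
  by (metis braid_of_half_twist braid_of_in_carrier conf_path_half_twist)

lemma same_order_relabel:
  assumes "bij \<pi>" "same_order (relabel \<pi> z) (relabel \<pi> w)" shows "same_order z w"
  using assms unfolding same_order_def relabel_nth by (metis bij_def surj_def)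

text \<open>
  During a half-twist the difference of the two moving strands runs through the closed upper
  half-plane, and all other pairs keep their order.  So the half-twist and \<open>p\<close> never have opposite
  differences.
\<close>

lemma braid_of_crossing:
  assumes i: "i = 1 \<or> i = 2 \<or> i = 3"
    and p: "path p"
    and Im: "\<And>t. t \<in> {0..1} \<Longrightarrow> Im (p t $ i - p t $ (i + 1)) > 0"
    and Re: "\<And>t j k. t \<in> {0..1} \<Longrightarrow> before j k \<Longrightarrow> (j, k) \<noteq> (i, i + 1) \<Longrightarrow> lexpos (p t $ j - p t $ k)"
    and start: "sorted4 (p 0)" and finish: "sorted4 (relabel (Transposition.transpose i (i + 1)) (p 1))"
  shows "conf_path p" "braid_of p = \<sigma> i"
proof -
  let ?\<tau> = "Transposition.transpose i (i + 1)"
  have seg: "closed_segment (p t) (half_twist i t) \<subseteq> conf" if t: "t \<in> {0..1}" for t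
  proof (rule segment_confI)
    fix j k assume jk: "before j k"
    show "0 \<notin> closed_segment (p t $ j - p t $ k) (half_twist i t $ j - half_twist i t $ k)"
    proof (cases "(j, k) = (i, i + 1)")
      case True
      have "0 \<le> sin (pi * t)" using t by (intro sin_ge_zero) (auto simp: mult_le_cancel_left1)
      then show ?thesis using True Im[OF t] half_twist_diff[OF i, of t]
        by (intro Im_segment) (auto simp del: cis_conv_exp)
    next
      case False
      then show ?thesis using Re[OF t jk] half_twist_lexpos[OF i jk] by (intro lexpos_segment) auto
    qed
  qed
  then have "p t \<in> conf" if "t \<in> {0..1}" for t
    using that ends_in_segment(1) by blast
  then show cp: "conf_path p" using p by (auto simp: path_image_def)
  have "same_order (p 1) (half_twist i 1)"
    by (rule same_order_relabel[where \<pi> = ?\<tau>])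
      (use finish sorted4_std_base in \<open>auto simp: half_twist_1[OF i] relabel_relabel intro!: sorted4_same_order\<close>)
  then have "braid_of p = braid_of (half_twist i)"
    using start sorted4_std_base seg
    by (intro braid_of_linear cp conf_path_half_twist i)
      (auto simp: pathstart_def pathfinish_def half_twist_0 intro!: sorted4_same_order)
  then show "braid_of p = \<sigma> i" by (simp add: braid_of_half_twist[OF i])
qed

lemma bij_vector_4: "distinct [p, q, r, s] \<Longrightarrow> bij (($) (vector [p, q, r, s] :: 4 ^ 4))"
proof -
  assume "distinct [p, q, r, s]"
  then have "inj (($) (vector [p, q, r, s] :: 4 ^ 4))"
    unfolding inj_def forall_4 by auto
  then show ?thesis by (simp add: bij_def finite_UNIV_inj_surj)
qed

lemma linepath_diff:
  "linepath z w t $ j - linepath z w t $ k = (1 - t) *\<^sub>R (z $ j - z $ k) + t *\<^sub>R (w $ j - w $ k)"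
  by (simp add: linepath_def algebra_simps)

lemma linepath_Im_pos:
  "Im a > 0 \<Longrightarrow> Im b > 0 \<Longrightarrow> t \<in> {0..1} \<Longrightarrow> Im ((1 - t) *\<^sub>R a + t *\<^sub>R b) > 0"
  using convex_bound_lt[of "- Im a" 0 "- Im b" "1 - t" t] by simp

lemma relabel_vector: "relabel (($) (vector [p, q, r, s] :: 4 ^ 4)) z = vector [z $ p, z $ q, z $ r, z $ s]"
  unfolding vec_eq_iff forall_4 by simp

text \<open>
  The strands are listed in their order at the start, from right to left.  Everything can be read off
  from the two ends of the segment; this makes piecewise linear models easy to evaluate.
\<close>

lemma linepath_crossing:
  fixes z w :: "complex ^ 4"
  assumes i: "i = 1 \<or> i = 2 \<or> i = 3" and dist: "distinct [p, q, r, s]"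
    and z': "z' = vector [z $ p, z $ q, z $ r, z $ s]" and w': "w' = vector [w $ p, w $ q, w $ r, w $ s]"
    and start: "sorted4 z'" and finish: "sorted4 (relabel (Transposition.transpose i (i + 1)) w')"
    and Im: "Im (z' $ i - z' $ (i + 1)) > 0" "Im (w' $ i - w' $ (i + 1)) > 0"
  shows "conf_path (linepath z w) \<and> braid_of (linepath z w) = \<sigma> i"
proof -
  let ?\<pi> = "($) (vector [p, q, r, s] :: 4 ^ 4)"
  have \<pi>: "bij ?\<pi>" by (rule bij_vector_4[OF dist])
  have eq: "relabel ?\<pi> \<circ> linepath z w = linepath z' w'"
    by (simp add: relabel_linepath relabel_vector z' w')
  have lex_z: "\<And>j k. before j k \<Longrightarrow> lexpos (z' $ j - z' $ k)"
    using sorted4_same_order[OF sorted4_std_base start] by (simp add: same_order_def before_def)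
  have *: "\<forall>j k. before j k \<longrightarrow> (j, k) \<noteq> (i, i + 1) \<longrightarrow> lexpos (w' $ j - w' $ k)"
    using sorted4_lexpos[OF finish] i unfolding forall_before
    by (elim disjE) (simp_all add: transpose_def)
  have ends: "linepath z' w' 0 = z'" "linepath z' w' 1 = w'" by (simp_all add: linepath_def)
  have lex: "lexpos (linepath z' w' t $ j - linepath z' w' t $ k)"
    if "t \<in> {0..1}" "before j k" "(j, k) \<noteq> (i, i + 1)" for t j k
    unfolding linepath_diff using that * by (intro lexpos_convex lex_z) auto
  have im: "0 < Im (linepath z' w' t $ i - linepath z' w' t $ (i + 1))" if "t \<in> {0..1}" for t
    unfolding linepath_diff using that Im by (intro linepath_Im_pos)
  note crossing = braid_of_crossing[OF i path_linepath im lex, unfolded ends, OF _ _ _ _ start finish]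
  have "path_image (relabel ?\<pi> \<circ> linepath z w) \<subseteq> conf"
    unfolding eq using crossing(1) by blast
  then have c: "conf_path (linepath z w)"
    unfolding path_image_relabel_conf[OF \<pi>] by simp
  have "braid_of (linepath z w) = \<sigma> i"
    using crossing(2) braid_of_relabel[OF c \<pi>] unfolding eq by simp
  with c show ?thesis by blast
qed

section \<open>Convex cells\<close>

text \<open>
  A convex set of configurations, given by an open half-plane for the difference of each pair of
  strands.  Inside a cell the braid of a path depends on the order of its ends only.
\<close>

definition cell :: "(4 \<Rightarrow> 4 \<Rightarrow> complex) \<Rightarrow> (complex ^ 4) set" where
  "cell c = {z. \<forall>j k. before j k \<longrightarrow> Re ((z $ j - z $ k) * cnj (c j k)) > 0}"

lemma segment_cell:
  assumes "z \<in> cell c" "w \<in> cell c" shows "closed_segment z w \<subseteq> conf"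
  using assms by (intro segment_confI halfplane_segment) (auto simp: cell_def)

lemma convex_cell: "convex (cell c)"
proof -
  have "cell c = (\<Inter>jk\<in>{jk. before (fst jk) (snd jk)}.
     (\<lambda>z. Re ((z $ fst jk - z $ snd jk) * cnj (c (fst jk) (snd jk)))) -` {0<..})"
    by (auto simp: cell_def)
  moreover have "linear (\<lambda>z :: complex ^ 4. Re ((z $ j - z $ k) * cnj d))" for j k d
    by (rule linearI) (simp_all add: algebra_simps)
  ultimately show ?thesis by (auto intro!: convex_INT convex_linear_vimage)
qed

lemma braid_of_cell:
  assumes "conf_path p" "conf_path q" "path_image p \<subseteq> cell c" "path_image q \<subseteq> cell c"
    "same_order (pathstart p) (pathstart q)" "same_order (pathfinish p) (pathfinish q)"
  shows "braid_of p = braid_of q"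
  using assms by (intro braid_of_linear segment_cell) (auto simp: path_image_def)

lemma linepath_cell: "z \<in> cell c \<Longrightarrow> w \<in> cell c \<Longrightarrow> path_image (linepath z w) \<subseteq> cell c"
  by (simp add: closed_segment_subset convex_cell)

definition crosses :: "4 \<Rightarrow> complex ^ 4 \<Rightarrow> complex ^ 4 \<Rightarrow> bool" where
  "crosses i z w \<longleftrightarrow> conf_path (linepath z w) \<and> braid_of (linepath z w) = \<sigma> i"

lemma braid_of_linepath_join:
  assumes "conf_path p" "conf_path (linepath (pathfinish p) w)"
  shows "conf_path (p +++ linepath (pathfinish p) w)"
    "braid_of (p +++ linepath (pathfinish p) w) = braid_of p \<otimes>\<^bsub>B4\<^esub> braid_of (linepath (pathfinish p) w)"
  by (rule conf_path_join[OF assms], simp) (rule braid_of_join[OF assms], simp)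

lemma crosses_join:
  assumes "conf_path p" "pathfinish p = z" "crosses i z w"
  shows "conf_path (p +++ linepath z w)" "braid_of (p +++ linepath z w) = braid_of p \<otimes>\<^bsub>B4\<^esub> \<sigma> i"
proof -
  have c: "conf_path (linepath z w)" "braid_of (linepath z w) = \<sigma> i"
    using assms(3) unfolding crosses_def by blast+
  note join = braid_of_linepath_join[of p w, unfolded assms(2), OF assms(1) c(1)]
  show "conf_path (p +++ linepath z w)" by (rule join(1))
  show "braid_of (p +++ linepath z w) = braid_of p \<otimes>\<^bsub>B4\<^esub> \<sigma> i" using join(2) unfolding c(2) .
qed

text \<open>
  Two ways to exchange the same strands inside one cell are the same braid.
\<close>

lemma two_routes:
  assumes "crosses i z0 z1" "crosses j z1 z2" "crosses k z0 w" "crosses l w z2"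
    and cell: "z0 \<in> cell c" "z1 \<in> cell c" "z2 \<in> cell c" "w \<in> cell c"
  shows "\<sigma> i \<otimes>\<^bsub>B4\<^esub> \<sigma> j = \<sigma> k \<otimes>\<^bsub>B4\<^esub> \<sigma> l"
proof -
  have 1: "conf_path (linepath z0 z1)" "braid_of (linepath z0 z1) = \<sigma> i"
    and 2: "conf_path (linepath z0 w)" "braid_of (linepath z0 w) = \<sigma> k"
    using assms(1,3) unfolding crosses_def by blast+
  note p = crosses_join[OF 1(1) pathfinish_linepath assms(2)]
  note q = crosses_join[OF 2(1) pathfinish_linepath assms(4)]
  have "path_image (linepath z0 z1 +++ linepath z1 z2) \<subseteq> cell c"
    "path_image (linepath z0 w +++ linepath w z2) \<subseteq> cell c"
    by (intro subset_path_image_join linepath_cell cell)+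
  then show ?thesis
    using braid_of_cell[OF p(1) q(1)] unfolding p(2) q(2) 1 2 by simp
qed

lemma two_routes_3:
  assumes "crosses i1 z0 z1" "crosses i2 z1 z2" "crosses i3 z2 z3"
    and "crosses j1 z0 w1" "crosses j2 w1 w2" "crosses j3 w2 z3"
    and cell: "z0 \<in> cell c" "z1 \<in> cell c" "z2 \<in> cell c" "z3 \<in> cell c" "w1 \<in> cell c" "w2 \<in> cell c"
  shows "\<sigma> i1 \<otimes>\<^bsub>B4\<^esub> \<sigma> i2 \<otimes>\<^bsub>B4\<^esub> \<sigma> i3 = \<sigma> j1 \<otimes>\<^bsub>B4\<^esub> \<sigma> j2 \<otimes>\<^bsub>B4\<^esub> \<sigma> j3"
proof -
  have 1: "conf_path (linepath z0 z1)" "braid_of (linepath z0 z1) = \<sigma> i1"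
    and 2: "conf_path (linepath z0 w1)" "braid_of (linepath z0 w1) = \<sigma> j1"
    using assms(1,4) unfolding crosses_def by blast+
  note p = crosses_join[OF 1(1) pathfinish_linepath assms(2)]
  note q = crosses_join[OF 2(1) pathfinish_linepath assms(5)]
  have fin: "pathfinish (linepath z0 z1 +++ linepath z1 z2) = z2"
     "pathfinish (linepath z0 w1 +++ linepath w1 w2) = w2" by simp_all
  note p' = crosses_join[OF p(1) fin(1) assms(3)]
  note q' = crosses_join[OF q(1) fin(2) assms(6)]
  have "path_image ((linepath z0 z1 +++ linepath z1 z2) +++ linepath z2 z3) \<subseteq> cell c"
    "path_image ((linepath z0 w1 +++ linepath w1 w2) +++ linepath w2 z3) \<subseteq> cell c"
    by (intro subset_path_image_join linepath_cell cell)+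
  then show ?thesis
    using braid_of_cell[OF p'(1) q'(1)] unfolding p(2) q(2) p'(2) q'(2) 1 2 by simp
qed

text \<open>
  Keep the four strands at different heights, strand \<open>1\<close> on top.  As long as the heights decrease
  with the label the horizontal motion is free, and the three upper strands can be reversed
  by moving two neighbours at a time in two different orders.
\<close>

lemma \<sigma>_braid: "\<sigma> 1 \<otimes>\<^bsub>B4\<^esub> \<sigma> 2 \<otimes>\<^bsub>B4\<^esub> \<sigma> 1 = \<sigma> 2 \<otimes>\<^bsub>B4\<^esub> \<sigma> 1 \<otimes>\<^bsub>B4\<^esub> \<sigma> 2"
proof -
  let ?z = "\<lambda>a b c. vector [a + 4 * \<i>, b + 3 * \<i>, c + 2 * \<i>, -4 + \<i>] :: complex ^ 4"
  note simps = sorted4_def lexpos_def transpose_def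
  have 1: "crosses 1 (?z (-1) (-2) (-3)) (?z (-2) (-1) (-3))"
    and 4: "crosses 2 (?z (-1) (-2) (-3)) (?z (-1) (-3) (-2))"
    unfolding crosses_def by (rule linepath_crossing[of _ 1 2 3 4, OF _ _ refl refl]; simp add: simps)+
  have 2: "crosses 2 (?z (-2) (-1) (-3)) (?z (-3) (-1) (-2))"
    unfolding crosses_def by (rule linepath_crossing[of _ 2 1 3 4, OF _ _ refl refl]; simp add: simps)
  have 3: "crosses 1 (?z (-3) (-1) (-2)) (?z (-3) (-2) (-1))"
    unfolding crosses_def by (rule linepath_crossing[of _ 2 3 1 4, OF _ _ refl refl]; simp add: simps)
  have 5: "crosses 1 (?z (-1) (-3) (-2)) (?z (-2) (-3) (-1))"
    unfolding crosses_def by (rule linepath_crossing[of _ 1 3 2 4, OF _ _ refl refl]; simp add: simps)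
  have 6: "crosses 2 (?z (-2) (-3) (-1)) (?z (-3) (-2) (-1))"
    unfolding crosses_def by (rule linepath_crossing[of _ 3 1 2 4, OF _ _ refl refl]; simp add: simps)
  show ?thesis
    by (rule two_routes_3[OF 1 2 3 4 5 6, where c = "\<lambda>_ _. \<i>"];
        unfold cell_def mem_Collect_eq forall_before; simp)
qed

text \<open>
  With the strands at different heights, the two exchanges can be made in any order.
\<close>

lemma \<sigma>_commute: "\<sigma> 1 \<otimes>\<^bsub>B4\<^esub> \<sigma> 3 = \<sigma> 3 \<otimes>\<^bsub>B4\<^esub> \<sigma> 1"
proof -
  let ?z = "\<lambda>a b c d. vector [a + 4 * \<i>, b + 3 * \<i>, c + 2 * \<i>, d + \<i>] :: complex ^ 4"
  note simps = sorted4_def lexpos_def transpose_def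
  have 1: "crosses 1 (?z (-1) (-2) (-3) (-4)) (?z (-2) (-1) (-3) (-4))"
    and 3: "crosses 3 (?z (-1) (-2) (-3) (-4)) (?z (-1) (-2) (-4) (-3))"
    unfolding crosses_def by (rule linepath_crossing[of _ 1 2 3 4, OF _ _ refl refl]; simp add: simps)+
  have 2: "crosses 3 (?z (-2) (-1) (-3) (-4)) (?z (-2) (-1) (-4) (-3))"
    unfolding crosses_def by (rule linepath_crossing[of _ 2 1 3 4, OF _ _ refl refl]; simp add: simps)
  have 4: "crosses 1 (?z (-1) (-2) (-4) (-3)) (?z (-2) (-1) (-4) (-3))"
    unfolding crosses_def by (rule linepath_crossing[of _ 1 2 4 3, OF _ _ refl refl]; simp add: simps)
  show ?thesis
    by (rule two_routes[OF 1 2 3 4, where c = "\<lambda>_ _. \<i>"];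
        unfold cell_def mem_Collect_eq forall_before; simp)
qed

text \<open>
  The strands \<open>1\<close> and \<open>2\<close> lie above and below the strands \<open>3\<close> and \<open>4\<close>, and \<open>3\<close> lies to
  the right of \<open>4\<close>: two conjugate points and two real points.
\<close>

definition gap_cell :: "4 \<Rightarrow> 4 \<Rightarrow> complex" where
  "gap_cell j k = (if j = 1 then \<i> else if j = 2 then - \<i> else 1)"

text \<open>
  In the model strand \<open>3\<close> first overtakes the strand \<open>2\<close> below it, which is a negative crossing, and then the
  strand \<open>1\<close> above it, which is a positive one.
\<close>

lemma braid_of_passing:
  assumes p: "conf_path p" and cell: "path_image p \<subseteq> cell gap_cell"
    and start: "sorted4 (pathstart p)"
    and finish: "sorted4 (vector [pathfinish p $ 3, pathfinish p $ 1, pathfinish p $ 2, pathfinish p $ 4])"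
  shows "braid_of p = inv\<^bsub>B4\<^esub> (\<sigma> 2) \<otimes>\<^bsub>B4\<^esub> \<sigma> 1"
proof -
  let ?z0 = "vector [-1 + \<i>, -2 - \<i>, -3, -4] :: complex ^ 4"
  let ?z1 = "vector [-1 + \<i>, -3 - \<i>, -2, -4] :: complex ^ 4"
  let ?z2 = "vector [-2 + \<i>, -3 - \<i>, -1, -4] :: complex ^ 4"
  note simps = sorted4_def lexpos_def transpose_def
  have 1: "crosses 2 ?z1 ?z0"
    unfolding crosses_def by (rule linepath_crossing[of _ 1 3 2 4, OF _ _ refl refl]; simp add: simps)
  have 2: "crosses 1 ?z1 ?z2"
    unfolding crosses_def by (rule linepath_crossing[of _ 1 3 2 4, OF _ _ refl refl]; simp add: simps)
  let ?q = "linepath ?z0 ?z1 +++ linepath ?z1 ?z2"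
  have inv: "conf_path (linepath ?z0 ?z1)" "braid_of (linepath ?z0 ?z1) = inv\<^bsub>B4\<^esub> (\<sigma> 2)"
    using braid_of_reverse[of "linepath ?z1 ?z0"] 1 unfolding crosses_def
    by (simp_all add: closed_segment_commute)
  note q = crosses_join[OF inv(1) pathfinish_linepath 2]
  have "?z0 \<in> cell gap_cell" "?z1 \<in> cell gap_cell" "?z2 \<in> cell gap_cell"
    unfolding cell_def mem_Collect_eq forall_before by (simp_all add: gap_cell_def)
  then have qc: "path_image ?q \<subseteq> cell gap_cell"
    by (intro subset_path_image_join linepath_cell)
  have fin: "same_order (pathfinish p) ?z2"
  proof (rule same_order_relabel[where \<pi> = "($) (vector [3,1,2,4] :: 4 ^ 4)"])
    show "bij (($) (vector [3,1,2,4] :: 4 ^ 4))" by (rule bij_vector_4) simp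
    show "same_order (relabel (($) (vector [3, 1, 2, 4] :: 4 ^ 4)) (pathfinish p))
           (relabel (($) (vector [3, 1, 2, 4] :: 4 ^ 4)) ?z2)"
      unfolding relabel_vector using finish by (intro sorted4_same_order) (simp_all add: simps)
  qed
  have "same_order (pathstart p) ?z0"
    using start by (intro sorted4_same_order) (simp_all add: simps)
  then have "braid_of p = braid_of ?q"
    using fin by (intro braid_of_cell[OF p q(1) cell qc]) auto
  also have "\<dots> = inv\<^bsub>B4\<^esub> (\<sigma> 2) \<otimes>\<^bsub>B4\<^esub> \<sigma> 1"
    unfolding q(2) inv(2) ..
  finally show ?thesis .
qed

section \<open>Rotating a triangle of strands\<close>

definition \<omega> :: complex where "\<omega> = cis (2 * pi / 3)"

lemma \<omega>_eq: "\<omega> = Complex (- 1 / 2) (sqrt 3 / 2)"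
  by (simp add: \<omega>_def complex_eq_iff cos_120 sin_120)

lemma \<omega>_power: "\<omega> ^ m = cis (2 * pi * real m / 3)"
proof -
  have "real m * (2 * pi / 3) = 2 * pi * real m / 3" by simp
  then show ?thesis by (simp only: \<omega>_def Complex.DeMoivre)
qed

text \<open>
  The strands \<open>i, i + 1, i + 2\<close> are the corners \<open>- \<omega>\<^sup>2, - \<omega>, - 1\<close>, at the angles
  60, -60 and 180 degrees, multiplied by \<open>c\<close>.  Only \<open>i = 1\<close> and \<open>i = 2\<close> are meant; the remaining strand is
  far to the left, respectively far to the right.
\<close>

definition triangle :: "4 \<Rightarrow> complex \<Rightarrow> complex ^ 4" where
  "triangle i c = (\<chi> k. if k = i then c * Complex (1 / 2) (sqrt 3 / 2)
     else if k = i + 1 then c * Complex (1 / 2) (- sqrt 3 / 2)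
     else if k = i + 2 then - c else if i = 1 then - 5 else 5)"

definition triangle_cycle :: "4 \<Rightarrow> 4 \<Rightarrow> 4" where
  "triangle_cycle i k = (if k = i then i + 2 else if k = i + 1 then i else if k = i + 2 then i + 1 else k)"

lemma bij_triangle_cycle: "i = 1 \<or> i = 2 \<Longrightarrow> bij (triangle_cycle i)"
proof -
  assume i: "i = 1 \<or> i = 2"
  have "inj (triangle_cycle i)"
    unfolding inj_def forall_4 using i by (elim disjE) (simp_all add: triangle_cycle_def)
  then show ?thesis by (simp add: bij_def finite_UNIV_inj_surj)
qed

lemma relabel_triangle:
  assumes "i = 1 \<or> i = 2"
  shows "relabel (triangle_cycle i) (triangle i c) = triangle i (c * \<omega>)"
  unfolding vec_eq_iff forall_4 using assms
  by (elim disjE) (simp_all add: triangle_def triangle_cycle_def \<omega>_eq complex_eq_iff field_simps)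

text \<open>
  Turning the triangle by 120 degrees, the corners \<open>i\<close> and \<open>i + 1\<close>, which start on a vertical line,
  exchange first, and then the corners \<open>i\<close> and \<open>i + 2\<close>.
\<close>

lemma triangle_step_1:
  assumes i: "i = 1 \<or> i = 2"
  shows "conf_path (linepath (triangle i 1) (triangle i \<omega>)) \<and>
    braid_of (linepath (triangle i 1) (triangle i \<omega>)) = \<sigma> i \<otimes>\<^bsub>B4\<^esub> \<sigma> (i + 1)"
proof -
  \<comment> \<open>A configuration after the first exchange and before the second one.\<close>
  define M :: "complex ^ 4" where
    "M = (\<chi> k. if k = i then \<i> else if k = i + 1 then 1 else if k = i + 2 then - 1 else if i = 1 then - 5 else 5)"
  \<comment> \<open>The middle directions of the three differences, at 150, 90 and 30 degrees.\<close>
  define c :: "4 \<Rightarrow> 4 \<Rightarrow> complex" where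
    "c j k = (if (j, k) = (i, i + 1) then Complex (- sqrt 3 / 2) (1 / 2)
      else if (j, k) = (i, i + 2) then \<i> else if (j, k) = (i + 1, i + 2) then Complex (sqrt 3 / 2) (1 / 2) else 1)" for j k
  note simps = sorted4_def lexpos_def transpose_def triangle_def M_def \<omega>_eq
  have r: "0 < sqrt 3 / 2 + (1 / 2 :: real)" by (intro add_pos_pos) simp_all
  have 1: "crosses i (triangle i 1) M"
    using i unfolding crosses_def
    by (elim disjE) (hypsubst, rule linepath_crossing[of _ 1 2 3 4, OF _ _ refl refl]; simp add: simps)+
  have 2: "crosses (i + 1) M (triangle i \<omega>)"
    using i
  proof
    assume "i = 1" then show ?thesis
      unfolding crosses_def by (intro linepath_crossing[of _ 2 1 3 4, OF _ _ refl refl]) (simp_all add: simps)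
  next
    assume "i = 2" then show ?thesis
      unfolding crosses_def by (intro linepath_crossing[of _ 1 3 2 4, OF _ _ refl refl]) (simp_all add: simps)
  qed
  have 3: "conf_path (linepath (triangle i 1) M)" "braid_of (linepath (triangle i 1) M) = \<sigma> i"
    using 1 unfolding crosses_def by blast+
  note q = crosses_join[OF 3(1) pathfinish_linepath 2]
  have cell1: "triangle i 1 \<in> cell c"
    unfolding cell_def mem_Collect_eq forall_before using i by (elim disjE; simp add: c_def simps)
  have cell2: "M \<in> cell c"
    unfolding cell_def mem_Collect_eq forall_before using i by (elim disjE; simp add: c_def simps r)
  have cell3: "triangle i \<omega> \<in> cell c"
    unfolding cell_def mem_Collect_eq forall_before using i by (elim disjE; simp add: c_def simps)
  note cell = cell1 cell2 cell3
  have "path_image (linepath (triangle i 1) M +++ linepath M (triangle i \<omega>)) \<subseteq> cell c"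
    by (intro subset_path_image_join linepath_cell cell)
  moreover have "conf_path (linepath (triangle i 1) (triangle i \<omega>))"
    using segment_cell[OF cell(1,3)] by simp
  moreover have "path_image (linepath (triangle i 1) (triangle i \<omega>)) \<subseteq> cell c"
    by (intro linepath_cell cell)
  ultimately show ?thesis
    using braid_of_cell[OF _ q(1), of "linepath (triangle i 1) (triangle i \<omega>)" c] unfolding q(2) 3(2) by simp
qed

lemma triangle_step:
  assumes i: "i = 1 \<or> i = 2"
  shows "conf_path (linepath (triangle i (\<omega> ^ m)) (triangle i (\<omega> ^ Suc m))) \<and>
    braid_of (linepath (triangle i (\<omega> ^ m)) (triangle i (\<omega> ^ Suc m))) = \<sigma> i \<otimes>\<^bsub>B4\<^esub> \<sigma> (i + 1)"
proof (induction m)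
  case 0
  show ?case using triangle_step_1[OF i] by simp
next
  case (Suc m)
  note b = bij_triangle_cycle[OF i]
  let ?l = "linepath (triangle i (\<omega> ^ m)) (triangle i (\<omega> ^ Suc m))"
  have eq: "linepath (triangle i (\<omega> ^ Suc m)) (triangle i (\<omega> ^ Suc (Suc m))) = relabel (triangle_cycle i) \<circ> ?l"
    by (simp add: relabel_linepath relabel_triangle[OF i] mult.commute)
  have c: "conf_path ?l" using Suc.IH by blast
  have "conf_path (relabel (triangle_cycle i) \<circ> ?l)"
    using c path_relabel path_image_relabel_conf[OF b] by blast
  moreover have "braid_of (relabel (triangle_cycle i) \<circ> ?l) = \<sigma> i \<otimes>\<^bsub>B4\<^esub> \<sigma> (i + 1)"
    using Suc.IH braid_of_relabel[OF c b] by simp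
  ultimately show ?case unfolding eq by blast
qed

text \<open>
  The rotation by \<open>2\<^sup>d\<close> steps of 120 degrees, with corners moving along chords.  Bracketing the steps
  as a binary tree gives all of them the same share of \<open>{0..1}\<close>, as in a uniform rotation.
\<close>

primrec polygon :: "4 \<Rightarrow> nat \<Rightarrow> nat \<Rightarrow> real \<Rightarrow> complex ^ 4" where
  "polygon i 0 m = linepath (triangle i (\<omega> ^ m)) (triangle i (\<omega> ^ Suc m))"
| "polygon i (Suc d) m = polygon i d m +++ polygon i d (m + 2 ^ d)"

lemma polygon_ends: "pathstart (polygon i d m) = triangle i (\<omega> ^ m)"
    "pathfinish (polygon i d m) = triangle i (\<omega> ^ (m + 2 ^ d))"
  by (induction d arbitrary: m) (simp_all add: add.assoc mult_2)

lemma braid_of_polygon: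
  assumes i: "i = 1 \<or> i = 2"
  shows "conf_path (polygon i d m) \<and>
    braid_of (polygon i d m) = (\<sigma> i \<otimes>\<^bsub>B4\<^esub> \<sigma> (i + 1)) [^]\<^bsub>B4\<^esub> ((2::nat) ^ d)"
proof (induction d arbitrary: m)
  case 0
  interpret group B4 by (rule group_B4)
  have "\<sigma> i \<otimes>\<^bsub>B4\<^esub> \<sigma> (i + 1) \<in> carrier B4"
    using i by (intro m_closed \<sigma>_in_carrier) auto
  then show ?case using triangle_step[OF i, of m] by simp
next
  case (Suc d)
  interpret group B4 by (rule group_B4)
  let ?g = "\<sigma> i \<otimes>\<^bsub>B4\<^esub> \<sigma> (i + 1)"
  have g: "?g \<in> carrier B4" using i by (intro m_closed \<sigma>_in_carrier) auto
  have 1: "conf_path (polygon i d m)" "braid_of (polygon i d m) = ?g [^]\<^bsub>B4\<^esub> ((2::nat) ^ d)"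
    using Suc.IH by blast+
  have 2: "conf_path (polygon i d (m + 2 ^ d))" "braid_of (polygon i d (m + 2 ^ d)) = ?g [^]\<^bsub>B4\<^esub> ((2::nat) ^ d)"
    using Suc.IH by blast+
  have e: "pathfinish (polygon i d m) = pathstart (polygon i d (m + 2 ^ d))"
    by (simp add: polygon_ends)
  have "braid_of (polygon i (Suc d) m) = ?g [^]\<^bsub>B4\<^esub> ((2::nat) ^ d) \<otimes>\<^bsub>B4\<^esub> ?g [^]\<^bsub>B4\<^esub> ((2::nat) ^ d)"
    using braid_of_join[OF 1(1) 2(1) e] 1(2) 2(2) by simp
  also have "\<dots> = ?g [^]\<^bsub>B4\<^esub> ((2::nat) ^ Suc d)"
    using g by (simp add: nat_pow_mult mult_2)
  finally show ?case using conf_path_join[OF 1(1) 2(1) e] by simp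
qed

text \<open>
  For \<open>t\<close> from \<open>0\<close> to \<open>1\<close> the direction stays within 60 degrees of the middle one, so its
  component there is at least \<open>3 * \<rho> / 2\<close>; the error contributes at most \<open>sqrt 3 * \<rho> / 2\<close>.
\<close>

lemma side_near_bisector:
  fixes e d :: complex
  assumes \<rho>: "\<rho> > 0" and t: "0 \<le> t" "t \<le> 1" and d: "norm d = sqrt 3"
    and near: "norm (e - \<rho> * cis (\<theta> + 2 * pi / 3 * t) * d) \<le> \<rho> / 2"
  shows "Re (e * cnj (cis (\<theta> + pi / 3) * d)) > 0"
proof -
  let ?c = "cis (\<theta> + pi / 3) * d"
  have dd: "d * cnj d = 3" using d by (simp add: complex_norm_square[symmetric])
  have "Re ((\<rho> * cis (\<theta> + 2 * pi / 3 * t) * d) * cnj ?c) = 3 * \<rho> * cos (2 * pi / 3 * t - pi / 3)"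
  proof -
    have "(\<rho> * cis (\<theta> + 2 * pi / 3 * t) * d) * cnj ?c
        = \<rho> * (cis (\<theta> + 2 * pi / 3 * t) * cis (- (\<theta> + pi / 3))) * (d * cnj d)"
      by (simp add: cis_cnj mult_ac)
    also have "\<dots> = 3 * \<rho> * cis (2 * pi / 3 * t - pi / 3)"
      unfolding dd cis_mult by simp
    finally have E: "(\<rho> * cis (\<theta> + 2 * pi / 3 * t) * d) * cnj ?c = 3 * \<rho> * cis (2 * pi / 3 * t - pi / 3)" .
    show ?thesis unfolding E by simp
  qed
  moreover have "cos (2 * pi / 3 * t - pi / 3) \<ge> cos (pi / 3)"
  proof -
    have "cos (2 * pi / 3 * t - pi / 3) = cos \<bar>2 * pi / 3 * t - pi / 3\<bar>" by simp
    also have "\<dots> \<ge> cos (pi / 3)"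
    proof (rule cos_monotone_0_pi_le)
      have "0 \<le> 2 * pi / 3 * t" "2 * pi / 3 * t \<le> 2 * pi / 3" using t by (auto intro: mult_left_le)
      then show "\<bar>2 * pi / 3 * t - pi / 3\<bar> \<le> pi / 3" by arith
    qed auto
    finally show ?thesis .
  qed
  then have "3 * \<rho> * cos (2 * pi / 3 * t - pi / 3) \<ge> 3 * \<rho> * (1 / 2)"
    using \<rho> by (intro mult_left_mono) (auto simp: cos_60)
  moreover have "\<bar>Re ((e - \<rho> * cis (\<theta> + 2 * pi / 3 * t) * d) * cnj ?c)\<bar> \<le> \<rho> / 2 * sqrt 3"
  proof -
    have "\<bar>Re ((e - \<rho> * cis (\<theta> + 2 * pi / 3 * t) * d) * cnj ?c)\<bar>
        \<le> norm ((e - \<rho> * cis (\<theta> + 2 * pi / 3 * t) * d) * cnj ?c)" by (rule abs_Re_le_cmod)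
    also have "\<dots> = norm (e - \<rho> * cis (\<theta> + 2 * pi / 3 * t) * d) * sqrt 3"
      by (simp add: norm_mult d)
    also have "\<dots> \<le> \<rho> / 2 * sqrt 3" using near by (intro mult_right_mono) auto
    finally show ?thesis .
  qed
  moreover have "\<rho> / 2 * sqrt 3 < 3 * \<rho> * (1 / 2)"
  proof -
    have "sqrt 3 < sqrt 9" by (simp only: real_sqrt_less_iff)
    then show ?thesis using \<rho> by simp
  qed
  moreover have "Re (e * cnj ?c) = Re ((\<rho> * cis (\<theta> + 2 * pi / 3 * t) * d) * cnj ?c)
     + Re ((e - \<rho> * cis (\<theta> + 2 * pi / 3 * t) * d) * cnj ?c)"
    by (simp add: algebra_simps)
  ultimately show ?thesis by linarith
qed

lemma chord_near_bisector:
  fixes d :: complex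
  assumes d: "norm d = sqrt 3"
  shows "Re (((1 - t) *\<^sub>R (cis \<theta> * d) + t *\<^sub>R (cis (\<theta> + 2 * pi / 3) * d)) * cnj (cis (\<theta> + pi / 3) * d)) > 0"
proof -
  have dd: "d * cnj d = 3" using d by (simp add: complex_norm_square[symmetric])
  have "((1 - t) *\<^sub>R (cis \<theta> * d) + t *\<^sub>R (cis (\<theta> + 2 * pi / 3) * d)) * cnj (cis (\<theta> + pi / 3) * d)
    = ((1 - t) *\<^sub>R (cis \<theta> * cis (- (\<theta> + pi / 3))) + t *\<^sub>R (cis (\<theta> + 2 * pi / 3) * cis (- (\<theta> + pi / 3)))) * (d * cnj d)"
    by (simp add: cis_cnj algebra_simps)
  also have "\<dots> = ((1 - t) *\<^sub>R cis (- (pi / 3)) + t *\<^sub>R cis (pi / 3)) * 3"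
    unfolding dd cis_mult by (simp add: field_simps)
  finally have E: "((1 - t) *\<^sub>R (cis \<theta> * d) + t *\<^sub>R (cis (\<theta> + 2 * pi / 3) * d)) * cnj (cis (\<theta> + pi / 3) * d)
    = ((1 - t) *\<^sub>R cis (- (pi / 3)) + t *\<^sub>R cis (pi / 3)) * 3" .
  show ?thesis unfolding E by (simp add: cos_60 field_simps)
qed

text \<open>
  The strand outside the cluster \<open>i, i + 1, i + 2\<close> lies to the left of it for \<open>i = 1\<close> and to the
  right of it for \<open>i = 2\<close>.
\<close>

definition far :: "4 \<Rightarrow> complex ^ 4 \<Rightarrow> bool" where
  "far i z \<longleftrightarrow> (\<forall>k. (i = 1 \<and> k \<noteq> 4 \<longrightarrow> Re (z $ k) > Re (z $ 4)) \<and> (i = 2 \<and> k \<noteq> 1 \<longrightarrow> Re (z $ k) < Re (z $ 1)))"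

text \<open>
  Up to a positive factor, the strands \<open>i, i + 1, i + 2\<close> have the differences of a triangle
  turned by \<open>\<theta>\<close>, with a relative error that is small enough for \<open>side_near_bisector\<close>.
\<close>

definition near_triangle :: "4 \<Rightarrow> real \<Rightarrow> complex ^ 4 \<Rightarrow> bool" where
  "near_triangle i \<theta> z \<longleftrightarrow>
     (\<exists>\<rho>>0. \<forall>j\<in>{i, i + 1, i + 2}. \<forall>k\<in>{i, i + 1, i + 2}.
        norm (z $ j - z $ k - complex_of_real \<rho> * cis \<theta> * (triangle i 1 $ j - triangle i 1 $ k)) \<le> \<rho> / 2) \<and>
     far i z"

lemma near_triangleE:
  assumes "near_triangle i \<theta> z"
  obtains \<rho> where "\<rho> > 0"
    "\<And>j k. j \<in> {i, i + 1, i + 2} \<Longrightarrow> k \<in> {i, i + 1, i + 2} \<Longrightarrow>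
       norm (z $ j - z $ k - complex_of_real \<rho> * cis \<theta> * (triangle i 1 $ j - triangle i 1 $ k)) \<le> \<rho> / 2"
    "\<And>k. i = 1 \<Longrightarrow> k \<noteq> 4 \<Longrightarrow> Re (z $ k) > Re (z $ 4)"
    "\<And>k. i = 2 \<Longrightarrow> k \<noteq> 1 \<Longrightarrow> Re (z $ k) < Re (z $ 1)"
  using assms unfolding near_triangle_def far_def by blast

text \<open>
  A rotation by \<open>n\<close> steps of 120 degrees that starts after \<open>m\<close> such steps.
\<close>

definition rotates :: "4 \<Rightarrow> real \<Rightarrow> real \<Rightarrow> (real \<Rightarrow> complex ^ 4) \<Rightarrow> bool" where
  "rotates i n m p \<longleftrightarrow> (\<forall>t\<in>{0..1}. near_triangle i (2 * pi * m / 3 + 2 * pi / 3 * (n * t)) (p t))"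

lemma norm_triangle_diff:
  assumes i: "i = 1 \<or> i = 2" and jk: "j \<in> {i, i + 1, i + 2}" "k \<in> {i, i + 1, i + 2}" "j \<noteq> k"
  shows "norm (triangle i 1 $ j - triangle i 1 $ k) = sqrt 3"
  using assms by (elim disjE insertE) (auto simp: triangle_def cmod_def power2_eq_square field_simps)

lemma triangle_scale:
  assumes i: "i = 1 \<or> i = 2" and jk: "j \<in> {i, i + 1, i + 2}" "k \<in> {i, i + 1, i + 2}"
  shows "triangle i c $ j - triangle i c $ k = c * (triangle i 1 $ j - triangle i 1 $ k)"
  using assms by (elim disjE insertE) (auto simp: triangle_def algebra_simps)

lemma triangle_far:
  assumes "norm c = 1"
  shows "k \<noteq> 4 \<Longrightarrow> Re (triangle 1 c $ 4) < Re (triangle 1 c $ k)"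
    "k \<noteq> 1 \<Longrightarrow> Re (triangle 2 c $ k) < Re (triangle 2 c $ 1)"
proof -
  define A B where "A = c * Complex (1 / 2) (sqrt 3 / 2)" and "B = c * Complex (1 / 2) (- sqrt 3 / 2)"
  have "norm (Complex (1 / 2) (sqrt 3 / 2)) = 1" "norm (Complex (1 / 2) (- sqrt 3 / 2)) = 1"
    by (simp_all add: cmod_def power2_eq_square)
  then have "norm A = 1" "norm B = 1"
    by (simp_all only: A_def B_def norm_mult assms mult_1)
  then have b: "\<bar>Re A\<bar> \<le> 1" "\<bar>Re B\<bar> \<le> 1" "\<bar>Re c\<bar> \<le> 1"
    using assms abs_Re_le_cmod[of A] abs_Re_le_cmod[of B] abs_Re_le_cmod[of c] by simp_all
  have "triangle 1 c $ 1 = A" "triangle 1 c $ 2 = B" "triangle 1 c $ 3 = - c" "triangle 1 c $ 4 = - 5"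
    "triangle 2 c $ 2 = A" "triangle 2 c $ 3 = B" "triangle 2 c $ 4 = - c" "triangle 2 c $ 1 = 5"
    by (simp_all add: triangle_def A_def B_def)
  then show "k \<noteq> 4 \<Longrightarrow> Re (triangle 1 c $ 4) < Re (triangle 1 c $ k)"
    and "k \<noteq> 1 \<Longrightarrow> Re (triangle 2 c $ k) < Re (triangle 2 c $ 1)"
    using exhaust_4[of k] b by (elim disjE; simp)+
qed

text \<open>
  Halving the time interval, as joins of paths do, reduces the claim to a single step of 120
  degrees.  There each difference of corners and its model stay in one half-plane.
\<close>

lemma rotates_segment:
  assumes i: "i = 1 \<or> i = 2"
  shows "rotates i (2 ^ d) (real m) p \<Longrightarrow> t \<in> {0..1} \<Longrightarrow> closed_segment (p t) (polygon i d m t) \<subseteq> conf"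
proof (induction d arbitrary: m p t)
  case 0
  have "near_triangle i (2 * pi * real m / 3 + 2 * pi / 3 * t) (p t)"
    using 0 unfolding rotates_def by simp
  then obtain \<rho> where \<rho>: "\<rho> > 0" and near: "\<And>j k. j \<in> {i, i + 1, i + 2} \<Longrightarrow> k \<in> {i, i + 1, i + 2} \<Longrightarrow>
        norm (p t $ j - p t $ k - complex_of_real \<rho> * cis (2 * pi * m / 3 + 2 * pi / 3 * t) *
           (triangle i 1 $ j - triangle i 1 $ k)) \<le> \<rho> / 2"
    and far: "\<And>k. i = 1 \<Longrightarrow> k \<noteq> 4 \<Longrightarrow> Re (p t $ k) > Re (p t $ 4)"
      "\<And>k. i = 2 \<Longrightarrow> k \<noteq> 1 \<Longrightarrow> Re (p t $ k) < Re (p t $ 1)"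
    by (elim near_triangleE) blast
  let ?q = "linepath (triangle i (\<omega> ^ m)) (triangle i (\<omega> ^ Suc m)) t"
  show ?case
  proof (rule segment_confI)
    fix j k assume jk: "before j k"
    show "0 \<notin> closed_segment (p t $ j - p t $ k) (polygon i 0 m t $ j - polygon i 0 m t $ k)"
    proof (cases "j \<in> {i, i + 1, i + 2} \<and> k \<in> {i, i + 1, i + 2}")
      case True
      let ?d = "triangle i 1 $ j - triangle i 1 $ k"
      have "j \<noteq> k" using jk by auto
      then have d: "norm ?d = sqrt 3" using True i by (intro norm_triangle_diff) auto
      have q: "?q $ j - ?q $ k = (1 - t) *\<^sub>R (cis (2 * pi * m / 3) * ?d)
          + t *\<^sub>R (cis (2 * pi * m / 3 + 2 * pi / 3) * ?d)"
        unfolding linepath_diff using True i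
        by (subst (1 2) triangle_scale) (auto simp: \<omega>_power field_simps simp del: power_Suc)
      show ?thesis
        unfolding polygon.simps q
        using 0(2) True d
        by (intro halfplane_segment[where c = "cis (2 * pi * m / 3 + pi / 3) * ?d"] 
             side_near_bisector[OF \<rho>, of t] chord_near_bisector near) auto
    next
      case False
      have n: "norm (\<omega> ^ a) = 1" for a by (simp add: \<omega>_power)
      have "i = 1 \<and> k = 4 \<and> j \<noteq> 4 \<or> i = 2 \<and> j = 1 \<and> k \<noteq> 1"
        using False jk i exhaust_4[of j] exhaust_4[of k] by (elim disjE) simp_all
      then have "lexpos (p t $ j - p t $ k)" "lexpos (triangle i (\<omega> ^ m) $ j - triangle i (\<omega> ^ m) $ k)"
        "lexpos (triangle i (\<omega> ^ Suc m) $ j - triangle i (\<omega> ^ Suc m) $ k)"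
        using far triangle_far[OF n[of m]] triangle_far[OF n[of "Suc m"]] unfolding lexpos_def minus_complex.sel
        by (elim disjE conjE; simp)+
      then show ?thesis
        unfolding polygon.simps linepath_diff using 0(2) by (intro lexpos_segment lexpos_convex) auto
    qed
  qed
next
  case (Suc d)
  have 1: "rotates i (2 ^ d) m (\<lambda>s. p (s / 2))"
    unfolding rotates_def
  proof
    fix s :: real assume "s \<in> {0..1}"
    then have "s / 2 \<in> {0..1}" by auto
    moreover have "2 ^ Suc d * (s / 2) = 2 ^ d * s" by simp
    ultimately show "near_triangle i (2 * pi * real m / 3 + 2 * pi / 3 * (2 ^ d * s)) (p (s / 2))"
      using Suc.prems(1) unfolding rotates_def by metis
  qed
  have 2: "rotates i (2 ^ d) (real (m + 2 ^ d)) (\<lambda>s. p ((s + 1) / 2))"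
    unfolding rotates_def
  proof
    fix s :: real assume "s \<in> {0..1}"
    then have "(s + 1) / 2 \<in> {0..1}" by auto
    moreover have "2 * pi * real m / 3 + 2 * pi / 3 * (2 ^ Suc d * ((s + 1) / 2))
       = 2 * pi * real (m + 2 ^ d) / 3 + 2 * pi / 3 * (2 ^ d * s)"
      by (simp add: field_simps)
    ultimately show "near_triangle i (2 * pi * real (m + 2 ^ d) / 3 + 2 * pi / 3 * (2 ^ d * s)) (p ((s + 1) / 2))"
      using Suc.prems(1) unfolding rotates_def by metis
  qed
  show ?case
  proof (cases "t \<le> 1 / 2")
    case True
    then show ?thesis using Suc.IH[OF 1, of "2 * t"] Suc.prems(2) by (simp add: joinpaths_def)
  next
    case False
    then show ?thesis using Suc.IH[OF 2, of "2 * t - 1"] Suc.prems(2) by (simp add: joinpaths_def)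
  qed
qed

lemma braid_of_rotates:
  assumes i: "i = 1 \<or> i = 2" and p: "path p" and rot: "rotates i (2 ^ d) 0 p"
    and start: "same_order (p 0) (triangle i 1)"
    and finish: "same_order (p 1) (triangle i (\<omega> ^ (2 ^ d)))"
  shows "conf_path p" "braid_of p = (\<sigma> i \<otimes>\<^bsub>B4\<^esub> \<sigma> (i + 1)) [^]\<^bsub>B4\<^esub> ((2::nat) ^ d)"
proof -
  have rot: "rotates i (2 ^ d) (real 0) p" using rot by simp
  note seg = rotates_segment[OF i rot]
  have "p t \<in> conf" if "t \<in> {0..1}" for t using seg[OF that] ends_in_segment(1) by blast
  then show c: "conf_path p" using p by (auto simp: path_image_def)
  have "braid_of p = braid_of (polygon i d 0)"
    using braid_of_polygon[OF i, of d 0] start finish seg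
    by (intro braid_of_linear c) (auto simp: polygon_ends, auto simp: pathstart_def pathfinish_def)
  then show "braid_of p = (\<sigma> i \<otimes>\<^bsub>B4\<^esub> \<sigma> (i + 1)) [^]\<^bsub>B4\<^esub> ((2::nat) ^ d)"
    using braid_of_polygon[OF i] by simp
qed

section \<open>Monodromy\<close>

definition roots :: "complex \<Rightarrow> complex set" where
  "roots x = {w. h x w = 0}"

lemma roots_C_aff: "{w. (x, w) \<in> C_aff} = roots x"
  by (simp add: C_aff_def roots_def)

definition lifts :: "(real \<Rightarrow> complex) \<Rightarrow> (real \<Rightarrow> complex ^ 4) \<Rightarrow> bool" where
  "lifts \<gamma> b \<longleftrightarrow> conf_path b \<and> (\<forall>t\<in>{0..1}. range (($) (b t)) = roots (\<gamma> t))"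

text \<open>
  The braid of the roots along any path in the base, not only along a loop.  The labelling of the
  roots is irrelevant for \<open>braid_of\<close>, so any lift may be used.
\<close>

definition has_monodromy :: "(real \<Rightarrow> complex) \<Rightarrow> (real \<Rightarrow> complex ^ 4) set \<Rightarrow> bool" where
  "has_monodromy \<gamma> g \<longleftrightarrow> (\<exists>b. lifts \<gamma> b \<and> g = braid_of b)"

lemma has_monodromyI: "lifts \<gamma> b \<Longrightarrow> braid_of b = g \<Longrightarrow> has_monodromy \<gamma> g"
  by (auto simp: has_monodromy_def)

lemma lifts_relabel: "lifts \<gamma> b \<Longrightarrow> bij \<pi> \<Longrightarrow> lifts \<gamma> (relabel \<pi> \<circ> b)"
  unfolding lifts_def by (auto simp only: path_relabel path_image_relabel_conf range_relabel comp_apply)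

lemma lifts_start: "lifts \<gamma> b \<Longrightarrow> pathstart b \<in> conf \<and> range (($) (pathstart b)) = roots (pathstart \<gamma>)"
  and lifts_finish: "lifts \<gamma> b \<Longrightarrow> pathfinish b \<in> conf \<and> range (($) (pathfinish b)) = roots (pathfinish \<gamma>)"
  unfolding lifts_def
  by (simp add: pathstart_in_conf, simp add: pathstart_def)
     (simp add: pathfinish_in_conf, simp add: pathfinish_def)

lemma has_monodromy_join:
  assumes g: "has_monodromy \<gamma> g" and g': "has_monodromy \<gamma>' g'" and ends: "pathfinish \<gamma> = pathstart \<gamma>'"
  shows "has_monodromy (\<gamma> +++ \<gamma>') (g \<otimes>\<^bsub>B4\<^esub> g')"
proof -
  obtain b where b: "lifts \<gamma> b" "g = braid_of b" using g by (auto simp: has_monodromy_def)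
  obtain b' where b': "lifts \<gamma>' b'" "g' = braid_of b'" using g' by (auto simp: has_monodromy_def)
  obtain \<pi> where \<pi>: "bij \<pi>" "pathfinish b = relabel \<pi> (pathstart b')"
    using relabel_if_same_range[of "pathstart b'" "pathfinish b"] lifts_start[OF b'(1)] lifts_finish[OF b(1)] ends
    by metis
  define c where "c = relabel \<pi> \<circ> b'"
  have c: "lifts \<gamma>' c" unfolding c_def by (rule lifts_relabel[OF b'(1) \<pi>(1)])
  have bc: "braid_of c = g'"
    unfolding c_def b'(2) using b'(1) by (intro braid_of_relabel \<pi>(1)) (simp add: lifts_def)
  have e: "pathfinish b = pathstart c" by (simp add: c_def pathstart_compose \<pi>(2))
  have cb: "conf_path b" and cc: "conf_path c" using b(1) c unfolding lifts_def by blast+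
  have "lifts (\<gamma> +++ \<gamma>') (b +++ c)"
    unfolding lifts_def
  proof (intro conjI ballI)
    show "path (b +++ c)" "path_image (b +++ c) \<subseteq> conf" using conf_path_join[OF cb cc e] by blast+
    fix t :: real assume "t \<in> {0..1}"
    then show "range (($) ((b +++ c) t)) = roots ((\<gamma> +++ \<gamma>') t)"
      using b(1) c unfolding lifts_def by (simp add: joinpaths_def)
  qed
  then show ?thesis
    using braid_of_join[OF cb cc e] unfolding bc b(2) by (rule has_monodromyI)
qed

lemma has_monodromy_reverse:
  assumes "has_monodromy \<gamma> g" shows "has_monodromy (reversepath \<gamma>) (inv\<^bsub>B4\<^esub> g)"
proof -
  obtain b where b: "lifts \<gamma> b" "g = braid_of b" using assms by (auto simp: has_monodromy_def)
  have cb: "conf_path b" using b(1) by (simp add: lifts_def)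
  have "lifts (reversepath \<gamma>) (reversepath b)"
    using b(1) unfolding lifts_def by (simp add: reversepath_def[of \<gamma>]) (simp add: reversepath_def)
  then show ?thesis
    using braid_of_reverse[OF cb] unfolding b(2) by (rule has_monodromyI)
qed

lemma roots_uminus: "roots (- x) = roots x"
  by (simp add: roots_def h_def)

text \<open>
  \<open>h\<close> is even in its first argument.
\<close>

lemma has_monodromy_uminus: "has_monodromy \<gamma> g \<Longrightarrow> has_monodromy (\<lambda>t. - \<gamma> t) g"
  unfolding has_monodromy_def lifts_def by (simp add: roots_uminus)

lemma has_monodromy_cong:
  "has_monodromy \<gamma> g \<Longrightarrow> (\<And>t. t \<in> {0..1} \<Longrightarrow> \<gamma>' t = \<gamma> t) \<Longrightarrow> has_monodromy \<gamma>' g"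
  unfolding has_monodromy_def lifts_def by auto

text \<open>
  The times at which two lifts agree form a closed set.  So do the times at which some strand of one
  is at a different strand of the other, and at each time exactly one of the two happens.
\<close>

lemma lift_unique:
  fixes b c :: "real \<Rightarrow> complex ^ 'n"
  assumes b: "conf_path b" and c: "conf_path c"
    and rng: "\<And>t. t \<in> {0..1} \<Longrightarrow> range (($) (b t)) = range (($) (c t))"
    and start: "b 0 = c 0" and t: "t \<in> {0..1}"
  shows "b t = c t"
proof -
  define A where "A = {t \<in> {0..1}. b t = c t}"
  \<comment> \<open>The times at which strand \<open>j\<close> of \<open>b\<close> is at the position of strand \<open>k\<close> of \<open>c\<close>.\<close>
  define D where "D j k = {t \<in> {0..1}. b t $ j = c t $ k}" for j k
  define B where "B = (\<Union>j. \<Union>k\<in>UNIV - {j}. D j k)"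
  have cont: "continuous_on {0..1} b" "continuous_on {0..1} c" using b c by (simp_all add: path_def)
  have "closed A" unfolding A_def
    using continuous_closed_preimage_constant[of "{0..1}" "\<lambda>t. b t - c t" 0] cont
    by (simp add: continuous_on_diff)
  moreover have "closed (D j k)" for j k unfolding D_def
    using continuous_closed_preimage_constant[of "{0..1}" "\<lambda>t. b t $ j - c t $ k" 0] cont
    by (simp add: continuous_on_diff continuous_on_component)
  then have "closed B" unfolding B_def by (intro closed_UN) auto
  moreover have "A \<inter> B \<inter> {0..1} = {}"
  proof -
    have "c t \<in> conf" if "t \<in> {0..1}" for t using c that by (auto simp: path_image_def)
    then show ?thesis unfolding A_def B_def D_def by (auto simp: conf_iff)
  qed
  moreover have "{0..1} \<subseteq> A \<union> B"
  proof
    fix t :: real assume t: "t \<in> {0..1}"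
    show "t \<in> A \<union> B"
    proof (cases "b t = c t")
      case False
      then obtain j where j: "b t $ j \<noteq> c t $ j" by (auto simp: vec_eq_iff)
      obtain k where "b t $ j = c t $ k" using rng[OF t] by (metis rangeE rangeI)
      then have "t \<in> D j k" "k \<noteq> j" using j t by (auto simp: D_def)
      then show ?thesis unfolding B_def by blast
    qed (use t in \<open>auto simp: A_def\<close>)
  qed
  moreover have "connected {0..1::real}" by simp
  ultimately have "A \<inter> {0..1} = {} \<or> B \<inter> {0..1} = {}"
    unfolding connected_closed by blast
  moreover have "0 \<in> A \<inter> {0..1}" using start by (simp add: A_def)
  ultimately have "t \<in> A" using \<open>{0..1} \<subseteq> A \<union> B\<close> t by blast
  then show ?thesis by (simp add: A_def)
qed

lemma root_tuple:
  fixes z :: "complex ^ 4"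
  assumes z: "z \<in> conf" "range (($) z) = roots x"
  shows "root_tuple x \<in> conf" "sorted4 (root_tuple x)" "range (($) (root_tuple x)) = roots x"
proof -
  let ?P = "\<lambda>y. range (($) y) = {w. (x, w) \<in> C_aff} \<and>
     sorted_wrt (\<lambda>u v. Re v < Re u \<or> Re v = Re u \<and> Im v < Im u) [y $ 1, y $ 2, y $ 3, y $ 4]"
  have P: "?P y \<longleftrightarrow> range (($) y) = roots x \<and> sorted4 y" for y
  proof -
    have lex: "(\<lambda>u v. Re v < Re u \<or> Re v = Re u \<and> Im v < Im u) = (\<lambda>u v. lexpos (u - v))"
      by (auto simp: lexpos_def fun_eq_iff)
    have "sorted_wrt (\<lambda>u v. lexpos (u - v)) [y $ 1, y $ 2, y $ 3, y $ 4] \<longleftrightarrow> sorted4 y"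
    proof
      assume "sorted4 y" then show "sorted_wrt (\<lambda>u v. lexpos (u - v)) [y $ 1, y $ 2, y $ 3, y $ 4]"
        using sorted4_lexpos[of y] by simp
    qed (simp add: sorted4_def)
    then show ?thesis unfolding roots_C_aff lex by simp
  qed
  have conf: "y \<in> conf" if "sorted4 y" for y
    using sorted4_lexpos[OF that] unfolding conf_4 by (metis diff_self lexpos_0)
  obtain \<pi> where \<pi>: "bij \<pi>" "relabel \<pi> (std_at z) = std_base" using sorting[OF z(1)] .
  have zc: "relabel \<pi> z \<in> conf" using z(1) relabel_conf[OF \<pi>(1)] by blast
  have "sorted4 (relabel \<pi> z)"
    unfolding sorted4_iff[OF zc] using \<pi> by (simp add: std_at_relabel)
  moreover have "range (($) (relabel \<pi> z)) = roots x" unfolding range_relabel[OF \<pi>(1)] by (rule z(2))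
  ultimately have ex: "?P (relabel \<pi> z)" unfolding P by blast
  have "y = relabel \<pi> z" if "?P y" for y
  proof -
    have y: "range (($) y) = roots x" "sorted4 y" using that unfolding P by blast+
    have s: "range (($) (relabel \<pi> z)) = roots x" "sorted4 (relabel \<pi> z)" using ex unfolding P by blast+
    obtain \<rho> where \<rho>: "bij \<rho>" "relabel \<pi> z = relabel \<rho> y"
      using relabel_if_same_range[OF conf[OF y(2)] zc] y s by metis
    have "std_base = relabel \<rho> std_base"
      using arg_cong[OF \<rho>(2), of std_at] std_at_sorted4[OF s(2)] std_at_sorted4[OF y(2)]
      unfolding std_at_relabel[OF \<rho>(1)] by simp
    then have "\<rho> = id" using relabel_inject[of std_base \<rho> id] by simp
    then show ?thesis using \<rho>(2) by simp
  qed
  then have "root_tuple x = relabel \<pi> z"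
    unfolding root_tuple_def using ex by (intro the_equality) auto
  then show "root_tuple x \<in> conf" "sorted4 (root_tuple x)" "range (($) (root_tuple x)) = roots x"
    using ex zc unfolding P by auto
qed

text \<open>
  For a loop, the lift that starts at the ordered tuple of roots is the only one to consider, and
  closing it up is exactly the passage to the standard points.
\<close>

lemma braid_monodromy_eq:
  assumes mon: "has_monodromy \<gamma> g" and loop: "pathfinish \<gamma> = pathstart \<gamma>"
  shows "braid_monodromy \<gamma> = g"
proof -
  obtain b0 where b0: "lifts \<gamma> b0" "g = braid_of b0" using mon by (auto simp: has_monodromy_def)
  let ?y = "root_tuple (pathstart \<gamma>)"
  note s0 = lifts_start[OF b0(1)]
  note y = root_tuple[OF conjunct1[OF s0] conjunct2[OF s0]]
  obtain \<rho> where \<rho>: "bij \<rho>" "?y = relabel \<rho> (pathstart b0)"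
    using relabel_if_same_range[of "pathstart b0" ?y] s0 y by metis
  define b where "b = relabel \<rho> \<circ> b0"
  have b: "lifts \<gamma> b" unfolding b_def by (rule lifts_relabel[OF b0(1) \<rho>(1)])
  then have cb: "conf_path b" by (simp add: lifts_def)
  have g: "g = braid_of b"
    unfolding b_def b0(2) using b0(1) by (intro braid_of_relabel[symmetric] \<rho>(1)) (simp add: lifts_def)
  have start: "pathstart b = ?y" by (simp add: b_def pathstart_compose \<rho>(2))
  have follows: "follows_roots \<gamma> c \<longleftrightarrow> lifts \<gamma> c \<and> pathstart c = ?y" for c
    unfolding follows_roots_def lifts_def roots_C_aff by blast
  have same: "homotopic_paths conf b c" if "follows_roots \<gamma> c" for c
  proof (rule homotopic_paths_eq)
    show "path b" "path_image b \<subseteq> conf" using cb by blast+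
    have c: "lifts \<gamma> c" "pathstart c = ?y" using that unfolding follows by blast+
    show "b t = c t" if "t \<in> {0..1}" for t
      using b c start that unfolding lifts_def
      by (intro lift_unique[of b c t]) (auto simp: pathstart_def)
  qed
  have "nabla \<gamma> = braid_class b"
    unfolding nabla_def using same b start follows braid_class_eqI by blast
  have std_y: "std_at ?y = std_base" by (rule std_at_sorted4[OF y(2)])
  obtain \<pi> where \<pi>: "bij \<pi>" "pathfinish b = relabel \<pi> ?y"
    using relabel_if_same_range[OF y(1)] lifts_finish[OF b] y(3) loop by metis
  have std_f: "std_at (pathfinish b) = relabel \<pi> std_base"
    unfolding \<pi>(2) std_at_relabel[OF \<pi>(1)] std_y ..
  let ?A = "linepath std_base ?y" and ?C = "linepath (pathfinish b) (relabel \<pi> std_base)"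
  have A: "conf_path ?A" using std_segment_conf(1)[OF y(1)] unfolding std_y by simp
  have C: "conf_path ?C" using std_segment_conf(2)[of "pathfinish b"] lifts_finish[OF b] unfolding std_f by simp
  have rid: "relabel (id :: 4 \<Rightarrow> 4) \<circ> c = c" for c :: "real \<Rightarrow> complex ^ 4" by (simp add: fun_eq_iff)
  have each: "braid_class (strand_join (strand_join ?A c) (linepath ?y std_base)) = g" if c: "c \<in> braid_class b" for c
  proof -
    have hom: "homotopic_paths conf b c" using c by (simp add: mem_braid_class)
    have ends: "pathstart c = ?y" "pathfinish c = pathfinish b"
      using homotopic_paths_imp_pathstart[OF hom] homotopic_paths_imp_pathfinish[OF hom] start by simp_all
    have "strand_join ?A c = ?A +++ c"
      using strand_join_relabel[of c ?A id] y(1) unfolding rid by (simp add: ends)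
    moreover have "strand_join (?A +++ c) (linepath ?y std_base) = (?A +++ c) +++ ?C"
      using strand_join_relabel[of "linepath ?y std_base" "?A +++ c" \<pi>] y(1)
      unfolding relabel_linepath by (simp add: ends \<pi>(2))
    moreover have "homotopic_paths conf (closing b) ((?A +++ c) +++ ?C)"
    proof -
      have eq: "closing b = ?A +++ (b +++ ?C)" by (simp add: closing_def start std_y std_f)
      have "homotopic_paths conf (?A +++ (b +++ ?C)) ((?A +++ b) +++ ?C)"
        using A C cb start by (intro homotopic_paths_assoc) simp_all
      also have "homotopic_paths conf \<dots> ((?A +++ c) +++ ?C)"
        using A C hom start by (intro homotopic_paths_join) simp_all
      finally show ?thesis unfolding eq .
    qed
    moreover have "g = braid_class (relabel id \<circ> closing b)"
      unfolding g by (rule braid_of_eqI[OF cb]) (simp_all add: start std_y)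
    ultimately show ?thesis unfolding rid by (metis braid_class_eqI)
  qed
  have "b \<in> braid_class b" using cb by (simp add: mem_braid_class)
  then show ?thesis
    unfolding braid_monodromy_def to_B4_def \<open>nabla \<gamma> = braid_class b\<close> using each by blast
qed

section \<open>The quartic\<close>

abbreviation q3 :: complex where "q3 \<equiv> complex_of_real (sqrt 3)"

lemma q3_sq: "q3 * q3 = 3" "q3\<^sup>2 = 3"
  by (simp_all flip: of_real_mult of_real_power)

text \<open>
  The distinguished values of \<open>s = y / u\<close>: for \<open>u\<close> close to \<open>0\<close> three solutions are close to
  \<open>s_zero\<close>; for \<open>u = - 1 / 4\<close> there is the triple solution \<open>s_crit\<close> and the simple solution \<open>s_free\<close>.
\<close>

definition s_zero :: real where "s_zero = (2 + sqrt 3) / 4"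
definition s_crit :: real where "s_crit = (1 + sqrt 3) / 2"
definition s_free :: real where "s_free = (9 + 5 * sqrt 3) / 18"

text \<open>
  \<open>h x\<close> as a function of \<open>u = (x\<^sup>2 - 1) / 4\<close> and \<open>y\<close>.
\<close>

definition quartic :: "complex \<Rightarrow> complex \<Rightarrow> complex" where
  "quartic u y = y\<^sup>2 * (y - u)\<^sup>2 + 4 / 9 * q3 * (y - of_real s_zero * u) ^ 3"

lemma h_quartic: "h x y = quartic ((x\<^sup>2 - 1) / 4) y"
proof -
  have "2 * q3 / 3 * y - (2 * q3 + 3) / 24 * (x\<^sup>2 - 1) = 2 / 3 * q3 * (y - of_real s_zero * ((x\<^sup>2 - 1) / 4))"
    using q3_sq(1) by (simp add: s_zero_def field_simps) (simp flip: mult.assoc)?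
  moreover have "(2 / 3 * q3) ^ 3 = 8 / 9 * q3"
    using q3_sq by (simp add: power3_eq_cube)
  ultimately have "(2 * q3 / 3 * y - (2 * q3 + 3) / 24 * (x\<^sup>2 - 1)) ^ 3
      = 8 / 9 * q3 * (y - of_real s_zero * ((x\<^sup>2 - 1) / 4)) ^ 3"
    by (simp only: power_mult_distrib)
  then show ?thesis
    unfolding h_def Let_def quartic_def by simp
qed

lemma quartic_scale: "quartic u (u * s) = u ^ 3 * (u * s\<^sup>2 * (s - 1)\<^sup>2 + 4 / 9 * q3 * (s - of_real s_zero) ^ 3)"
  by (simp add: quartic_def power2_eq_square power3_eq_cube algebra_simps)

text \<open>
  The value \<open>- 1 / 4\<close> of \<open>u\<close> is special because of this identity, which holds thanks to the
  coefficients \<open>sqrt 3\<close> in \<open>h\<close>.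
\<close>

lemma quartic_scale_crit:
  "quartic u (u * s) = u ^ 3 * ((u + 1 / 4) * s\<^sup>2 * (s - 1)\<^sup>2 - (s - of_real s_crit) ^ 3 * (s - of_real s_free) / 4)"
proof -
  have q: "q3 * (q3 * z) = 3 * z" for z
    using q3_sq(1) by (simp flip: mult.assoc)
  have "16 * q3 * (s - of_real s_zero) ^ 3
      = 9 * s\<^sup>2 * (s - 1)\<^sup>2 - 9 * (s - of_real s_crit) ^ 3 * (s - of_real s_free)"
    by (simp add: s_zero_def s_crit_def s_free_def field_simps power2_eq_square power3_eq_cube q q3_sq(1))
  moreover have "4 / 9 * q3 * (s - of_real s_zero) ^ 3 = (16 * q3 * (s - of_real s_zero) ^ 3) / 36"
    by simp
  ultimately have eq: "4 / 9 * q3 * (s - of_real s_zero) ^ 3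
      = (9 * s\<^sup>2 * (s - 1)\<^sup>2 - 9 * (s - of_real s_crit) ^ 3 * (s - of_real s_free)) / 36"
    by simp
  show ?thesis
    unfolding quartic_scale eq by (simp add: field_simps)
qed

lemma quadratic_zeros:
  fixes A B C :: complex
  assumes "A * x\<^sup>2 + B * x + C = 0" "A * y\<^sup>2 + B * y + C = 0" "A * z\<^sup>2 + B * z + C = 0"
    and "x \<noteq> y" "x \<noteq> z" "y \<noteq> z"
  shows "A = 0" "B = 0" "C = 0"
proof -
  have "(x - y) * (A * (x + y) + B) = 0" "(x - z) * (A * (x + z) + B) = 0"
    using assms(1-3) by algebra+
  then have 1: "A * (x + y) + B = 0" "A * (x + z) + B = 0" using assms(4,5) by simp_all
  then have "A * (y - z) = 0" by algebra
  then show "A = 0" using assms(6) by simp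
  then show "B = 0" using 1 by simp
  then show "C = 0" using \<open>A = 0\<close> assms(1) by simp
qed

text \<open>
  Three distinct roots determine the fourth one through the sum of the roots.  The remaining
  difference of the two sides is a quadratic polynomial with three zeros.
\<close>

lemma quartic_vieta:
  assumes roots: "quartic u x = 0" "quartic u y = 0" "quartic u z = 0"
    and dist: "x \<noteq> y" "x \<noteq> z" "y \<noteq> z"
    and w: "w = 2 * u - 4 / 9 * q3 - (x + y + z)"
  shows "quartic u t = (t - x) * (t - y) * (t - z) * (t - w)"
proof -
  define k where "k = 4 / 9 * q3"
  define r where "r = complex_of_real s_zero"
  define A where "A = u\<^sup>2 - 3 * k * r * u - (x*y + x*z + x*w + y*z + y*w + z*w)"
  \<comment> \<open>With the choice of \<open>w\<close> the coefficients of \<open>t\<^sup>3\<close> agree as well.\<close>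
  define B where "B = 3 * k * r\<^sup>2 * u\<^sup>2 + (x*y*z + x*y*w + x*z*w + y*z*w)"
  define C where "C = - k * r ^ 3 * u ^ 3 - x*y*z*w"
  have eq: "quartic u t = (t - x) * (t - y) * (t - z) * (t - w) + (A * t\<^sup>2 + B * t + C)" for t
    unfolding quartic_def k_def[symmetric] r_def[symmetric] A_def B_def C_def w
    by algebra
  have "A = 0" "B = 0" "C = 0"
    using quadratic_zeros[of A x B C y z] roots dist unfolding eq by simp_all
  then show ?thesis unfolding eq by simp
qed

section \<open>Cube roots of the local equation\<close>

text \<open>
  Near \<open>s0\<close> the function \<open>Q\<close> has a holomorphic cube root \<open>E\<close> which is positive at \<open>s0\<close>.
  So the equation says that \<open>(s - s0) * E s\<close> is \<open>v\<close> up to a cube root of unity, and \<open>G\<close> is the local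
  inverse of this function.  Its derivative is continuous, which gives the last estimate.
\<close>

lemma local_cube_root:
  fixes Q :: "complex \<Rightarrow> complex" and s0 \<eta> R :: real
  assumes R: "R > 0" and holQ: "Q holomorphic_on ball (of_real s0) R"
    and sym: "\<And>s. Q (cnj s) = cnj (Q s)"
    and pos: "Re (Q (of_real s0)) > 0" and \<eta>: "\<eta> > 0"
  obtains G c \<delta> where "c > 0" "\<delta> > 0" "continuous_on (ball 0 \<delta>) G"
    "\<And>v. v \<in> ball 0 \<delta> \<Longrightarrow> norm (G v - of_real s0) < \<eta>"
    "\<And>v. v \<in> ball 0 \<delta> \<Longrightarrow> (G v - of_real s0) ^ 3 * Q (G v) = v ^ 3"
    "\<And>v. v \<in> ball 0 \<delta> \<Longrightarrow> G (cnj v) = cnj (G v)"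
    "\<And>v w. v \<in> ball 0 \<delta> \<Longrightarrow> w \<in> ball 0 \<delta> \<Longrightarrow>
       norm (G v - G w - of_real c * (v - w)) \<le> \<eta> * c * norm (v - w)"
proof -
  let ?s = "complex_of_real s0"
  define U where "U = {s \<in> ball ?s R. Re (Q s) > 0}"
  have "U = ball ?s R \<inter> Q -` {z. Re z > 0}" by (auto simp: U_def)
  then have "open U"
    using continuous_open_preimage[OF holomorphic_on_imp_continuous_on[OF holQ], of "{z. Re z > 0}"]
    by (simp add: open_halfspace_Re_gt)
  moreover have sU: "?s \<in> U" using R pos by (simp add: U_def)
  ultimately obtain R1 where R1: "R1 > 0" "ball ?s R1 \<subseteq> U" using open_contains_ball by blast
  define R2 where "R2 = min R1 \<eta>"
  have R2: "R2 > 0" "ball ?s R2 \<subseteq> U" "ball ?s R2 \<subseteq> ball ?s R" "R2 \<le> \<eta>"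
    using R1 \<eta> by (auto simp: R2_def U_def)
  define E where "E s = exp (Ln (Q s) / 3)" for s
  define F where "F s = (s - ?s) * E s" for s
  have nonpos: "Q s \<notin> \<real>\<^sub>\<le>\<^sub>0" if "s \<in> ball ?s R2" for s
    using that R2(2) by (auto simp: U_def complex_nonpos_Reals_iff)
  have holE: "E holomorphic_on ball ?s R2"
    unfolding E_def using nonpos holomorphic_on_subset[OF holQ R2(3)]
    by (intro holomorphic_intros) auto
  have holF: "F holomorphic_on ball ?s R2"
    unfolding F_def by (intro holomorphic_intros holE)
  have E3: "E s ^ 3 = Q s" if "s \<in> ball ?s R2" for s
  proof -
    have "Q s \<noteq> 0" using nonpos[OF that] by auto
    then show ?thesis by (simp add: E_def flip: exp_of_nat_mult)
  qed
  have symE: "E (cnj s) = cnj (E s)" if "s \<in> ball ?s R2" for s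
    using cnj_Ln[OF nonpos[OF that]] by (simp add: E_def sym exp_cnj)
  have "Q ?s = of_real (Re (Q ?s))" using sym[of ?s] by (simp add: complex_eq_iff)
  then have Ln_Q: "Ln (Q ?s) = of_real (ln (Re (Q ?s)))"
    using pos Ln_of_real[of "Re (Q ?s)"] by simp
  define k where "k = exp (ln (Re (Q ?s)) / 3)"
  have k: "k > 0" "E ?s = of_real k"
    unfolding E_def Ln_Q k_def by (simp_all add: exp_of_real[symmetric])
  have derivE: "(E has_field_derivative deriv E s) (at s)" if "s \<in> ball ?s R2" for s
    by (rule holomorphic_derivI[OF holE _ that]) simp
  have "(F has_field_derivative of_real k) (at ?s)"
  proof -
    have "((\<lambda>s. s - ?s) has_field_derivative 1) (at ?s)"
      by (auto intro!: derivative_eq_intros)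
    moreover have "?s \<in> ball ?s R2" using R2(1) by simp
    ultimately have "(F has_field_derivative (1 * E ?s + deriv E ?s * (?s - ?s))) (at ?s)"
      unfolding F_def by (intro DERIV_mult derivE)
    then show ?thesis using k by simp
  qed
  then have derivF: "deriv F ?s = of_real k" by (rule DERIV_imp_deriv)
  obtain R3 where R3: "R3 > 0" "ball ?s R3 \<subseteq> ball ?s R2" "open (F ` ball ?s R3)" "inj_on F (ball ?s R3)"
    using has_complex_derivative_locally_invertible[OF holF _ _ , of ?s] derivF k(1) R2(1) by auto
  have holF3: "F holomorphic_on ball ?s R3" using holF R3(2) holomorphic_on_subset by blast
  obtain G where G: "G holomorphic_on (F ` ball ?s R3)"
    "\<And>z. z \<in> ball ?s R3 \<Longrightarrow> deriv F z * deriv G (F z) = 1"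
    "\<And>z. z \<in> ball ?s R3 \<Longrightarrow> G (F z) = z"
    using holomorphic_has_inverse[OF holF3 _ R3(4)] by auto
  have F0: "F ?s = 0" by (simp add: F_def)
  define c where "c = inverse k"
  have c: "c > 0" using k by (simp add: c_def)
  have derivG0: "deriv G 0 = of_real c"
    using G(2)[of ?s] R3(1) k(1) derivF F0 by (simp add: c_def field_simps of_real_inverse)
  have "0 \<in> F ` ball ?s R3" using F0 R3(1) by (metis centre_in_ball imageI)
  then obtain d1 where d1: "d1 > 0" "ball 0 d1 \<subseteq> F ` ball ?s R3"
    using R3(3) open_contains_ball by blast
  have "deriv G holomorphic_on F ` ball ?s R3" using G(1) R3(3) by (rule holomorphic_deriv)
  then have "isCont (deriv G) 0"
    using R3(3) \<open>0 \<in> F ` ball ?s R3\<close> holomorphic_on_imp_continuous_on continuous_on_eq_continuous_at by blast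
  then obtain d2 where d2: "d2 > 0" "\<And>v. dist v 0 < d2 \<Longrightarrow> dist (deriv G v) (deriv G 0) < \<eta> * c"
    unfolding continuous_at_eps_delta using mult_pos_pos[OF \<eta> c] by metis
  define \<delta> where "\<delta> = min d1 d2"
  have \<delta>: "\<delta> > 0" "ball 0 \<delta> \<subseteq> F ` ball ?s R3" using d1 d2 by (auto simp: \<delta>_def)
  have in_ball: "G v \<in> ball ?s R3" "F (G v) = v" if v: "v \<in> ball 0 \<delta>" for v :: complex
  proof -
    obtain z where "z \<in> ball ?s R3" "v = F z" using v \<delta>(2) by blast
    then show "G v \<in> ball ?s R3" "F (G v) = v" using G(3) by simp_all
  qed
  show thesis
  proof
    show "c > 0" "\<delta> > 0" by fact+
    show "continuous_on (ball 0 \<delta>) G"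
      using G(1) \<delta>(2) holomorphic_on_imp_continuous_on continuous_on_subset by blast
    fix v :: complex assume v: "v \<in> ball 0 \<delta>"
    have GR2: "G v \<in> ball ?s R2" using in_ball[OF v] R3(2) by blast
    then show "norm (G v - ?s) < \<eta>" using R2(4) by (simp add: dist_norm norm_minus_commute)
    have "(G v - ?s) ^ 3 * Q (G v) = F (G v) ^ 3"
      by (simp add: F_def power_mult_distrib E3[OF GR2])
    then show "(G v - ?s) ^ 3 * Q (G v) = v ^ 3" using in_ball[OF v] by simp
    have "F (cnj (G v)) = cnj (F (G v))" by (simp add: F_def symE[OF GR2])
    then have "F (cnj (G v)) = cnj v" using in_ball(2)[OF v] by simp
    moreover have "cnj (G v) \<in> ball ?s R3"
    proof -
      have "dist ?s (cnj (G v)) = norm (cnj (?s - G v))" by (simp add: dist_norm)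
      also have "\<dots> = dist ?s (G v)" unfolding complex_mod_cnj by (simp add: dist_norm)
      finally show ?thesis using in_ball(1)[OF v] by simp
    qed
    ultimately show "G (cnj v) = cnj (G v)" using G(3) by metis
    fix w :: complex assume w: "w \<in> ball 0 \<delta>"
    have "norm ((G v - of_real c * v) - (G w - of_real c * w)) \<le> \<eta> * c * norm (v - w)"
    proof (rule field_differentiable_bound[of "ball 0 \<delta>" "\<lambda>v. G v - of_real c * v" "\<lambda>v. deriv G v - of_real c"])
      fix z :: complex assume z: "z \<in> ball 0 \<delta>"
      have "(G has_field_derivative deriv G z) (at z)"
        using G(1) R3(3) z \<delta>(2) holomorphic_derivI by blast
      then show "((\<lambda>v. G v - of_real c * v) has_field_derivative deriv G z - of_real c) (at z within ball 0 \<delta>)"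
        by (auto intro!: derivative_eq_intros intro: has_field_derivative_at_within)
      have "dist z 0 < d2" using z by (simp add: \<delta>_def dist_norm)
      then show "norm (deriv G z - of_real c) \<le> \<eta> * c" using d2(2)[of z] by (simp add: derivG0 dist_norm)
    qed (use v w in auto)
    then show "norm (G v - G w - of_real c * (v - w)) \<le> \<eta> * c * norm (v - w)"
      by (simp add: algebra_simps)
  qed
qed

section \<open>Clusters of three roots\<close>

lemma near_triangle_conf:
  assumes i: "i = 1 \<or> i = 2" and near: "near_triangle i \<theta> z"
  shows "z \<in> conf"
proof -
  obtain \<rho> where \<rho>: "\<rho> > 0" and est: "\<And>j k. j \<in> {i, i + 1, i + 2} \<Longrightarrow> k \<in> {i, i + 1, i + 2} \<Longrightarrow>
        norm (z $ j - z $ k - complex_of_real \<rho> * cis \<theta> * (triangle i 1 $ j - triangle i 1 $ k)) \<le> \<rho> / 2"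
    and far: "\<And>k. i = 1 \<Longrightarrow> k \<noteq> 4 \<Longrightarrow> Re (z $ k) > Re (z $ 4)" "\<And>k. i = 2 \<Longrightarrow> k \<noteq> 1 \<Longrightarrow> Re (z $ k) < Re (z $ 1)"
    using near by (elim near_triangleE) blast
  have ne: "z $ j \<noteq> z $ k" if "j \<in> {i, i + 1, i + 2}" "k \<in> {i, i + 1, i + 2}" "j \<noteq> k" for j k
  proof
    assume "z $ j = z $ k"
    then have "\<rho> * norm (triangle i 1 $ j - triangle i 1 $ k) \<le> \<rho> / 2"
      using est[OF that(1,2)] \<rho> by (simp add: norm_mult)
    then have "sqrt 3 \<le> 1 / 2" using norm_triangle_diff[OF i that] \<rho> by simp
    moreover have "1 < sqrt (3::real)" by simp
    ultimately show False by linarith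
  qed
  show ?thesis
    using i
  proof
    assume "i = 1"
    then show ?thesis using ne[of 1 2] ne[of 1 3] ne[of 2 3] far(1)[of 1] far(1)[of 2] far(1)[of 3]
      unfolding conf_4 by auto
  next
    assume "i = 2"
    then show ?thesis using ne[of 2 3] ne[of 2 4] ne[of 3 4] far(2)[of 2] far(2)[of 3] far(2)[of 4]
      unfolding conf_4 by auto
  qed
qed

text \<open>
  A small relative error does not disturb the order, except that a vertical difference must be
  exactly vertical.
\<close>

lemma lexpos_near:
  assumes "\<rho> > 0" "norm (e - of_real \<rho> * d) \<le> \<rho> / 2"
    and "\<bar>Re d\<bar> > 1 / 2 \<or> Re d = 0 \<and> Re e = 0 \<and> \<bar>Im d\<bar> > 1 / 2"
  shows "lexpos e \<longleftrightarrow> lexpos d"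
proof -
  have key: "(a > 0 \<longleftrightarrow> b > 0) \<and> a \<noteq> 0" if "\<bar>a - \<rho> * b\<bar> \<le> \<rho> / 2" "\<bar>b\<bar> > 1 / 2" for a b :: real
  proof (cases "b > 0")
    case True
    then have "\<rho> * b > \<rho> * (1 / 2)" using that(2) assms(1) by (intro mult_strict_left_mono) auto
    then have "a > 0" using that(1) unfolding abs_le_iff by linarith
    then show ?thesis using True by simp
  next
    case False
    then have "\<rho> * b < \<rho> * (- 1 / 2)" using that(2) assms(1) by (intro mult_strict_left_mono) auto
    then have "a < 0" using that(1) unfolding abs_le_iff by linarith
    then show ?thesis using False by simp
  qed
  have "\<bar>Re e - \<rho> * Re d\<bar> \<le> \<rho> / 2" "\<bar>Im e - \<rho> * Im d\<bar> \<le> \<rho> / 2"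
    using abs_Re_le_cmod[of "e - of_real \<rho> * d"] abs_Im_le_cmod[of "e - of_real \<rho> * d"] assms(2) by simp_all
  then show ?thesis
    using assms(3) key[of "Re e" "Re d"] key[of "Im e" "Im d"] unfolding lexpos_def by auto
qed

lemma \<omega>_cube: "\<omega> ^ 3 = 1"
  by (simp add: \<omega>_power)

lemma norm_cube_root_of_unity: "norm \<zeta> = 1" if "\<zeta> ^ 3 = 1" for \<zeta> :: complex
proof -
  have "norm \<zeta> ^ 3 = 1 ^ 3" using that by (metis norm_one norm_power power_one)
  then show ?thesis by (rule power_eq_imp_eq_base) auto
qed

lemma \<omega>_power_cases: "\<omega> ^ n = 1 \<or> \<omega> ^ n = \<omega> \<or> \<omega> ^ n = \<omega> ^ 2"
proof -
  have "\<omega> ^ n = \<omega> ^ (3 * (n div 3) + n mod 3)" by simp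
  also have "\<dots> = \<omega> ^ (n mod 3)" by (simp only: power_add power_mult \<omega>_cube) simp
  finally have "\<omega> ^ n = \<omega> ^ (n mod 3)" .
  moreover have "n mod 3 = 0 \<or> n mod 3 = 1 \<or> n mod 3 = 2" by presburger
  ultimately show ?thesis by auto
qed

lemma \<omega>_sq: "\<omega>\<^sup>2 = Complex (- 1 / 2) (- sqrt 3 / 2)"
  by (simp add: \<omega>_eq complex_eq_iff power2_eq_square)

lemma \<omega>_Re_Im: "Re \<omega> = - 1 / 2" "Im \<omega> = sqrt 3 / 2"
  by (simp_all add: \<omega>_eq)

lemma triangle_diff_directions:
  assumes i: "i = 1 \<or> i = 2" and jk: "j \<in> {i, i + 1, i + 2}" "k \<in> {i, i + 1, i + 2}" "j \<noteq> k"
    and c: "c = 1 \<or> c = \<omega> \<or> c = \<omega>\<^sup>2"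
  shows "\<bar>Re (triangle i c $ j - triangle i c $ k)\<bar> > 1 / 2 \<or>
     Re (triangle i c $ j - triangle i c $ k) = 0 \<and> \<bar>Im (triangle i c $ j - triangle i c $ k)\<bar> > 1 / 2"
proof -
  have r: "1 / 2 < sqrt 3" using real_less_rsqrt[of "1/2" 3] by (simp add: power2_eq_square)
  define T where "T = (\<lambda>c. [c * Complex (1 / 2) (sqrt 3 / 2), c * Complex (1 / 2) (- sqrt 3 / 2), - c])"
  have "triangle i c $ i = T c ! 0" "triangle i c $ (i + 1) = T c ! 1" "triangle i c $ (i + 2) = T c ! 2"
    using i by (auto simp: triangle_def T_def)
  then obtain a b where ab: "triangle i c $ j = T c ! a" "triangle i c $ k = T c ! b"
      "a \<in> {0, 1, 2}" "b \<in> {0, 1, 2}" "a \<noteq> b"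
    using jk by (elim insertE; simp)
  have "\<forall>a\<in>{0, 1, 2}. \<forall>b\<in>{0, 1, 2}. a \<noteq> b \<longrightarrow> \<bar>Re (T c ! a - T c ! b)\<bar> > 1 / 2 \<or>
     Re (T c ! a - T c ! b) = 0 \<and> \<bar>Im (T c ! a - T c ! b)\<bar> > 1 / 2"
    using c r by (elim disjE; hypsubst; simp add: T_def \<omega>_sq \<omega>_Re_Im)
  then show ?thesis using ab by metis
qed

text \<open>
  In a triangle turned by a multiple of 120 degrees the differences are vertical or at 30 degrees
  from the horizontal.  Only the vertical ones are affected by a small error.
\<close>

lemma same_order_near_triangle:
  assumes i: "i = 1 \<or> i = 2" and near: "near_triangle i \<theta> z" and \<theta>: "cis \<theta> = \<omega> ^ n"
    and vert: "\<And>j k. j \<in> {i, i + 1, i + 2} \<Longrightarrow> k \<in> {i, i + 1, i + 2} \<Longrightarrow>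
      Re (triangle i (\<omega> ^ n) $ j) = Re (triangle i (\<omega> ^ n) $ k) \<Longrightarrow> Re (z $ j) = Re (z $ k)"
  shows "same_order z (triangle i (\<omega> ^ n))"
  unfolding same_order_def
proof (intro allI)
  fix j k
  obtain \<rho> where \<rho>: "\<rho> > 0" and est: "\<And>j k. j \<in> {i, i + 1, i + 2} \<Longrightarrow> k \<in> {i, i + 1, i + 2} \<Longrightarrow>
        norm (z $ j - z $ k - complex_of_real \<rho> * cis \<theta> * (triangle i 1 $ j - triangle i 1 $ k)) \<le> \<rho> / 2"
    and far: "\<And>k. i = 1 \<Longrightarrow> k \<noteq> 4 \<Longrightarrow> Re (z $ k) > Re (z $ 4)" "\<And>k. i = 2 \<Longrightarrow> k \<noteq> 1 \<Longrightarrow> Re (z $ k) < Re (z $ 1)"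
    using near by (elim near_triangleE) blast
  let ?T = "triangle i (\<omega> ^ n)"
  have norm: "norm (\<omega> ^ n) = 1" by (simp add: \<omega>_power)
  consider "j = k" | "j \<noteq> k" "j \<in> {i, i + 1, i + 2}" "k \<in> {i, i + 1, i + 2}"
    | "j \<noteq> k" "i = 1" "j = 4 \<or> k = 4" | "j \<noteq> k" "i = 2" "j = 1 \<or> k = 1"
    using i exhaust_4[of j] exhaust_4[of k] by (elim disjE) simp_all
  then show "lexpos (z $ j - z $ k) \<longleftrightarrow> lexpos (?T $ j - ?T $ k)"
  proof cases
    case 1 then show ?thesis by simp
  next
    case 2
    let ?d = "?T $ j - ?T $ k"
    have "norm (z $ j - z $ k - of_real \<rho> * ?d) \<le> \<rho> / 2"
      using est[OF 2(2,3)] unfolding triangle_scale[OF i 2(2,3), of "\<omega> ^ n"] \<theta> by (simp add: mult.assoc)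
    then show ?thesis
      using triangle_diff_directions[OF i 2(2,3,1) \<omega>_power_cases] vert[OF 2(2,3)] \<rho>
      by (intro lexpos_near) auto
  next
    case 3
    then show ?thesis using far(1)[of j] far(1)[of k] triangle_far(1)[OF norm, of j] triangle_far(1)[OF norm, of k]
      by (auto simp: lexpos_def)
  next
    case 4
    then show ?thesis using far(2)[of j] far(2)[of k] triangle_far(2)[OF norm, of j] triangle_far(2)[OF norm, of k]
      by (auto simp: lexpos_def)
  qed
qed

text \<open>
  The outcome of \<open>local_cube_root\<close> with \<open>\<eta> = 1 / 100\<close>, for either of the two triple values.
\<close>

locale branch =
  fixes G :: "complex \<Rightarrow> complex" and c \<delta> s0 :: real
  assumes c: "c > 0" and \<delta>: "\<delta> > 0" and cont: "continuous_on (ball 0 \<delta>) G"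
    and near: "\<And>v. v \<in> ball 0 \<delta> \<Longrightarrow> norm (G v - of_real s0) < 1 / 100"
    and sym: "\<And>v. v \<in> ball 0 \<delta> \<Longrightarrow> G (cnj v) = cnj (G v)"
    and diff: "\<And>v w. v \<in> ball 0 \<delta> \<Longrightarrow> w \<in> ball 0 \<delta> \<Longrightarrow>
       norm (G v - G w - of_real c * (v - w)) \<le> 1 / 100 * c * norm (v - w)"
begin

text \<open>
  The roots over \<open>u\<close>, where \<open>w\<close> is the coordinate of \<open>local_cube_root\<close>: three of them differ by
  cube roots of unity in front of \<open>w\<close>, the last one is given by \<open>quartic_vieta\<close>.
\<close>

definition tuple :: "4 \<Rightarrow> complex \<Rightarrow> complex \<Rightarrow> complex ^ 4" where
  "tuple i u w = (\<chi> k. if k = i then u * G (\<omega>\<^sup>2 * w) else if k = i + 1 then u * G (\<omega> * w)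
     else if k = i + 2 then u * G w
     else 2 * u - 4 / 9 * q3 - (u * G (\<omega>\<^sup>2 * w) + u * G (\<omega> * w) + u * G w))"

lemma tuple_cluster:
  assumes i: "i = 1 \<or> i = 2" and k: "k \<in> {i, i + 1, i + 2}"
  shows "tuple i u w $ k = u * G (- (triangle i 1 $ k) * w)"
proof -
  have "- Complex (1 / 2) (sqrt 3 / 2) = \<omega>\<^sup>2" "- Complex (1 / 2) (- sqrt 3 / 2) = \<omega>"
    by (simp add: \<omega>_sq complex_eq_iff) (simp add: \<omega>_eq complex_eq_iff)
  then show ?thesis using i k by (elim disjE insertE) (auto simp: tuple_def triangle_def)
qed

lemma norm_corner:
  assumes "i = 1 \<or> i = 2" "k \<in> {i, i + 1, i + 2}" shows "norm (triangle i d $ k) = norm d"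
  using assms by (elim disjE insertE) (auto simp: triangle_def norm_mult, auto simp: cmod_def power2_eq_square)

text \<open>
  The difference of two roots of the cluster is about \<open>c * u * w\<close> times the difference of two
  cube roots of unity.  As the corners of \<open>triangle i 1\<close> are their negatives, the direction that
  matters is that of \<open>- (u * w)\<close>.
\<close>

lemma tuple_near_triangle:
  assumes i: "i = 1 \<or> i = 2" and w: "w \<in> ball 0 \<delta>" and nz: "u \<noteq> 0" "w \<noteq> 0"
    and dir: "norm (- (u * w) - of_real (norm (u * w)) * cis \<theta>) \<le> norm (u * w) / 10"
    and far: "far i (tuple i u w)"
  shows "near_triangle i \<theta> (tuple i u w)"
proof -
  define \<rho> where "\<rho> = c * norm (u * w)"
  have \<rho>: "\<rho> > 0" using c nz by (simp add: \<rho>_def)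
  have "norm (tuple i u w $ j - tuple i u w $ k - of_real \<rho> * cis \<theta> * (triangle i 1 $ j - triangle i 1 $ k)) \<le> \<rho> / 2"
    if jk: "j \<in> {i, i + 1, i + 2}" "k \<in> {i, i + 1, i + 2}" for j k
  proof -
    let ?a = "- (triangle i 1 $ j)" and ?b = "- (triangle i 1 $ k)"
    have ab: "norm ?a = 1" "norm ?b = 1" using norm_corner[OF i jk(1)] norm_corner[OF i jk(2)] by simp_all
    have d2: "norm (?a - ?b) \<le> 2" using norm_triangle_ineq4[of ?a ?b] ab by simp
    have ball: "?a * w \<in> ball 0 \<delta>" "?b * w \<in> ball 0 \<delta>" using w ab by (simp_all add: norm_mult)
    have "tuple i u w $ j - tuple i u w $ k - of_real \<rho> * cis \<theta> * (triangle i 1 $ j - triangle i 1 $ k)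
      = u * (G (?a * w) - G (?b * w) - of_real c * (?a * w - ?b * w))
        - of_real c * (- (u * w) - of_real (norm (u * w)) * cis \<theta>) * (?a - ?b)"
      unfolding tuple_cluster[OF i jk(1)] tuple_cluster[OF i jk(2)] \<rho>_def by (simp add: algebra_simps)
    also have "norm \<dots> \<le> norm (u * (G (?a * w) - G (?b * w) - of_real c * (?a * w - ?b * w)))
        + norm (of_real c * (- (u * w) - of_real (norm (u * w)) * cis \<theta>) * (?a - ?b))"
      by (rule norm_triangle_ineq4)
    also have "\<dots> \<le> \<rho> / 50 + \<rho> / 5"
    proof (rule add_mono)
      have "norm (u * (G (?a * w) - G (?b * w) - of_real c * (?a * w - ?b * w)))
          \<le> norm u * (1 / 100 * c * norm (?a * w - ?b * w))"
        unfolding norm_mult by (intro mult_left_mono diff ball) auto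
      also have "?a * w - ?b * w = (?a - ?b) * w" by (simp add: algebra_simps)
      also have "norm u * (1 / 100 * c * norm ((?a - ?b) * w)) = \<rho> / 100 * norm (?a - ?b)"
        by (simp add: \<rho>_def norm_mult)
      also have "\<dots> \<le> \<rho> / 100 * 2" using d2 \<rho> by (intro mult_left_mono) auto
      finally show "norm (u * (G (?a * w) - G (?b * w) - of_real c * (?a * w - ?b * w))) \<le> \<rho> / 50"
        by (simp add: left_diff_distrib)
      have "norm (of_real c * (- (u * w) - of_real (norm (u * w)) * cis \<theta>) * (?a - ?b))
          = c * norm (- (u * w) - of_real (norm (u * w)) * cis \<theta>) * norm (?a - ?b)"
        using c by (simp only: norm_mult norm_of_real abs_of_pos)
      also have "\<dots> \<le> c * (norm (u * w) / 10) * 2"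
        using c dir d2 by (intro mult_mono) auto
      finally show "norm (of_real c * (- (u * w) - of_real (norm (u * w)) * cis \<theta>) * (?a - ?b)) \<le> \<rho> / 5"
        by (simp add: \<rho>_def)
    qed
    also have "\<dots> \<le> \<rho> / 2" using \<rho> by simp
    finally show ?thesis .
  qed
  then show ?thesis
    unfolding near_triangle_def using \<rho> far by blast
qed

text \<open>
  When \<open>u\<close> is real and some \<open>\<omega>\<^sup>m * w\<close> is real, the two roots on the vertical side are conjugate,
  because \<open>G\<close> commutes with conjugation.
\<close>

lemma tuple_same_order:
  assumes i: "i = 1 \<or> i = 2" and w: "w \<in> ball 0 \<delta>" and near: "near_triangle i \<theta> (tuple i u w)"
    and \<theta>: "cis \<theta> = \<omega> ^ n" and real: "u \<in> \<real>" "\<omega> ^ (2 * n) * w \<in> \<real>"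
  shows "same_order (tuple i u w) (triangle i (\<omega> ^ n))"
proof (rule same_order_near_triangle[OF i near \<theta>])
  fix j k assume jk: "j \<in> {i, i + 1, i + 2}" "k \<in> {i, i + 1, i + 2}"
    and Re: "Re (triangle i (\<omega> ^ n) $ j) = Re (triangle i (\<omega> ^ n) $ k)"
  let ?x = "\<omega> ^ (2 * n) * w"
  let ?a = "triangle i (\<omega> ^ n) $ j" and ?b = "triangle i (\<omega> ^ n) $ k"
  have "\<omega> ^ n * \<omega> ^ (2 * n) = (\<omega> ^ 3) ^ n" by (simp only: power_mult[symmetric] power_add[symmetric]) simp
  then have \<omega>n: "\<omega> ^ n * \<omega> ^ (2 * n) = 1" by (simp add: \<omega>_cube)
  have scale: "triangle i (\<omega> ^ n) $ l = \<omega> ^ n * triangle i 1 $ l" if "l \<in> {i, i + 1, i + 2}" for l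
    using i that by (elim disjE insertE) (auto simp: triangle_def)
  have eq: "tuple i u w $ l = u * G (- (triangle i (\<omega> ^ n) $ l) * ?x)" if "l \<in> {i, i + 1, i + 2}" for l
  proof -
    have "triangle i (\<omega> ^ n) $ l * ?x = (\<omega> ^ n * \<omega> ^ (2 * n)) * (triangle i 1 $ l * w)"
      unfolding scale[OF that] by (simp only: mult_ac)
    then have "triangle i (\<omega> ^ n) $ l * ?x = triangle i 1 $ l * w" unfolding \<omega>n by simp
    then show ?thesis unfolding tuple_cluster[OF i that] by (simp only: mult_minus_left)
  qed
  have ab: "norm ?a = 1" "norm ?b = 1" using norm_corner[OF i jk(1)] norm_corner[OF i jk(2)] by (simp_all add: \<omega>_power)
  then have "(Re ?a)\<^sup>2 + (Im ?a)\<^sup>2 = 1" "(Re ?b)\<^sup>2 + (Im ?b)\<^sup>2 = 1"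
    by (simp_all add: cmod_def)
  then have "(Im ?a)\<^sup>2 = (Im ?b)\<^sup>2" using Re by simp
  then have "Im ?a = Im ?b \<or> Im ?a = - Im ?b" by (simp add: power2_eq_iff)
  then have "?b = ?a \<or> ?b = cnj ?a" using Re by (auto simp: complex_eq_iff)
  then show "Re (tuple i u w $ j) = Re (tuple i u w $ k)"
  proof
    assume "?b = cnj ?a"
    then have "- ?b * ?x = cnj (- ?a * ?x)" using real(2) by (simp add: Reals_cnj_iff)
    moreover have "- ?a * ?x \<in> ball 0 \<delta>" using w ab by (simp add: norm_mult \<omega>_power)
    ultimately have "G (- ?b * ?x) = cnj (G (- ?a * ?x))" using sym by metis
    then have "tuple i u w $ k = cnj (tuple i u w $ j)"
      unfolding eq[OF jk(1)] eq[OF jk(2)] using real(1) by (simp add: Reals_cnj_iff)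
    then show ?thesis by simp
  qed (use eq[OF jk(1)] eq[OF jk(2)] in simp)
qed

lemma range_tuple:
  assumes i: "i = 1 \<or> i = 2" and near: "near_triangle i \<theta> (tuple i u w)"
    and roots: "\<And>\<zeta>. \<zeta> ^ 3 = 1 \<Longrightarrow> quartic u (u * G (\<zeta> * w)) = 0"
  shows "range (($) (tuple i u w)) = {y. quartic u y = 0}"
proof -
  let ?x = "u * G (\<omega>\<^sup>2 * w)" and ?y = "u * G (\<omega> * w)" and ?z = "u * G w"
  let ?v = "2 * u - 4 / 9 * q3 - (?x + ?y + ?z)"
  have "(\<omega>\<^sup>2) ^ 3 = 1" by (metis \<omega>_cube power_mult power_mult_distrib mult.commute power_one)
  then have r: "quartic u ?x = 0" "quartic u ?y = 0" "quartic u ?z = 0"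
    using roots[of "\<omega>\<^sup>2"] roots[of \<omega>] roots[of 1] \<omega>_cube by simp_all
  have rng: "range (($) (tuple i u w)) = {?x, ?y, ?z, ?v}"
    unfolding range_4 using i by (elim disjE) (auto simp: tuple_def)
  have "?x \<noteq> ?y" "?x \<noteq> ?z" "?y \<noteq> ?z"
    using near_triangle_conf[OF i near] i unfolding conf_4 by (elim disjE; simp add: tuple_def)+
  then show ?thesis
    unfolding rng using quartic_vieta[OF r _ _ _ refl] by auto
qed

lemma continuous_tuple:
  assumes "continuous_on S u" "continuous_on S w" "\<And>t. t \<in> S \<Longrightarrow> w t \<in> ball 0 \<delta>"
  shows "continuous_on S (\<lambda>t. tuple i (u t) (w t))"
proof -
  have G: "continuous_on S (\<lambda>t. G (\<zeta> * w t))" if "norm \<zeta> = 1" for \<zeta>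
    using assms that
    by (intro continuous_on_compose2[OF cont] continuous_intros) (auto simp: norm_mult)
  have n: "norm (\<omega>\<^sup>2) = 1" "norm \<omega> = 1" "norm (1::complex) = 1"
    by (simp_all only: \<omega>_power norm_cis norm_one) (simp add: \<omega>_def)
  have "continuous_on S (\<lambda>t. tuple i (u t) (w t) $ k)" for k
    unfolding tuple_def vec_lambda_beta using G[OF n(1)] G[OF n(2)] G[OF n(3)]
    by (cases "k = i"; cases "k = i + 1"; cases "k = i + 2") (simp_all add: continuous_intros assms(1))
  then show ?thesis
    using continuous_on_vec_lambda[of S "\<lambda>k t. tuple i (u t) (w t) $ k"] by simp
qed

text \<open>
  The cluster turns by \<open>2\<^sup>d\<close> steps of 120 degrees between two positions with real \<open>u\<close>.
\<close>

lemma has_monodromy_arc: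
  fixes u w :: "real \<Rightarrow> complex"
  assumes i: "i = 1 \<or> i = 2"
    and cont: "continuous_on {0..1} u" "continuous_on {0..1} w"
    and ball: "\<And>t. t \<in> {0..1} \<Longrightarrow> w t \<in> ball 0 \<delta>"
    and nz: "\<And>t. t \<in> {0..1} \<Longrightarrow> u t \<noteq> 0" "\<And>t. t \<in> {0..1} \<Longrightarrow> w t \<noteq> 0"
    and dir: "\<And>t. t \<in> {0..1} \<Longrightarrow> norm (- (u t * w t) - of_real (norm (u t * w t)) * cis (2 * pi / 3 * (2 ^ d * t)))
        \<le> norm (u t * w t) / 10"
    and far: "\<And>t. t \<in> {0..1} \<Longrightarrow> far i (tuple i (u t) (w t))"
    and roots: "\<And>t \<zeta>. t \<in> {0..1} \<Longrightarrow> \<zeta> ^ 3 = 1 \<Longrightarrow> quartic (u t) (u t * G (\<zeta> * w t)) = 0"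
    and real: "u 0 \<in> \<real>" "w 0 \<in> \<real>" "u 1 \<in> \<real>" "\<omega> ^ (2 * 2 ^ d) * w 1 \<in> \<real>"
    and u: "\<And>t. t \<in> {0..1} \<Longrightarrow> ((\<gamma> t)\<^sup>2 - 1) / 4 = u t"
  shows "has_monodromy \<gamma> ((\<sigma> i \<otimes>\<^bsub>B4\<^esub> \<sigma> (i + 1)) [^]\<^bsub>B4\<^esub> ((2::nat) ^ d))"
proof -
  let ?b = "\<lambda>t. tuple i (u t) (w t)"
  have near: "near_triangle i (2 * pi / 3 * (2 ^ d * t)) (?b t)" if "t \<in> {0..1}" for t
    using that by (intro tuple_near_triangle i ball nz dir far)
  have p: "path ?b" unfolding path_def by (rule continuous_tuple[OF cont ball])
  have rot: "rotates i (2 ^ d) 0 ?b" unfolding rotates_def using near by simp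
  have start: "same_order (?b 0) (triangle i 1)"
    using tuple_same_order[OF i ball near, of 0 0] real by simp
  have "cis (2 * pi / 3 * (2 ^ d * 1)) = \<omega> ^ (2 ^ d)" by (simp add: \<omega>_power mult_ac)
  then have finish: "same_order (?b 1) (triangle i (\<omega> ^ (2 ^ d)))"
    using real by (intro tuple_same_order[OF i ball near, of 1]) simp_all
  note br = braid_of_rotates[OF i p rot start finish]
  have "lifts \<gamma> ?b"
    unfolding lifts_def roots_def h_quartic
  proof (intro conjI ballI)
    fix t :: real assume t: "t \<in> {0..1}"
    show "range (($) (?b t)) = {y. quartic (((\<gamma> t)\<^sup>2 - 1) / 4) y = 0}"
      unfolding u[OF t] by (rule range_tuple[OF i near[OF t] roots[OF t]])
  qed (use br(1) in auto)
  then show ?thesis using br(2) by (rule has_monodromyI)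
qed

end

section \<open>The two branches\<close>

lemma sqrt3_bounds: "1732 / 1000 < sqrt 3" "sqrt 3 < 17321 / 10000"
  by (rule real_less_rsqrt, simp add: power2_eq_square) (rule real_less_lsqrt, simp_all add: power2_eq_square)

lemma near_real_nonzero:
  fixes s :: complex
  assumes "norm (s - of_real a) < r" "r \<le> \<bar>a - b\<bar>"
  shows "s \<noteq> of_real b"
proof
  assume "s = of_real b"
  then have "norm (s - of_real a) = \<bar>b - a\<bar>" by (simp flip: of_real_diff)
  then show False using assms by linarith
qed

lemma branch_zero:
  obtains G c \<delta> where "branch G c \<delta> s_zero"
    "\<And>w. w \<in> ball 0 \<delta> \<Longrightarrow> quartic (- (w ^ 3)) (- (w ^ 3) * G w) = 0"
proof -
  define Q where "Q s = 4 / 9 * q3 / (s\<^sup>2 * (s - 1)\<^sup>2)" for s :: complex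
  \<comment> \<open>The poles \<open>0\<close> and \<open>1\<close> are outside this disc, since \<open>s_zero\<close> is about \<open>0.933\<close>.\<close>
  have nz: "s \<noteq> 0 \<and> s \<noteq> 1" if "norm (s - of_real s_zero) < 1 / 20" for s :: complex
    using near_real_nonzero[OF that, of 0] near_real_nonzero[OF that, of 1] sqrt3_bounds
    by (simp add: s_zero_def)
  have hol: "Q holomorphic_on ball (of_real s_zero) (1 / 20)"
    unfolding Q_def by (intro holomorphic_intros) (use nz in \<open>auto simp: dist_norm norm_minus_commute\<close>)
  have sym: "Q (cnj s) = cnj (Q s)" for s by (simp add: Q_def)
  have pos: "Re (Q (of_real s_zero)) > 0"
  proof -
    have "Q (of_real s_zero) = of_real (4 / 9 * sqrt 3 / (s_zero\<^sup>2 * (s_zero - 1)\<^sup>2))" by (simp add: Q_def)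
    moreover have "s_zero \<noteq> 0" "s_zero \<noteq> 1" using nz[of "of_real s_zero"] by auto
    ultimately show ?thesis by simp
  qed
  obtain G c \<delta> where G: "c > 0" "\<delta> > 0" "continuous_on (ball 0 \<delta>) G"
    "\<And>v. v \<in> ball 0 \<delta> \<Longrightarrow> norm (G v - of_real s_zero) < 1 / 100"
    "\<And>v. v \<in> ball 0 \<delta> \<Longrightarrow> (G v - of_real s_zero) ^ 3 * Q (G v) = v ^ 3"
    "\<And>v. v \<in> ball 0 \<delta> \<Longrightarrow> G (cnj v) = cnj (G v)"
    "\<And>v w. v \<in> ball 0 \<delta> \<Longrightarrow> w \<in> ball 0 \<delta> \<Longrightarrow>
       norm (G v - G w - of_real c * (v - w)) \<le> 1 / 100 * c * norm (v - w)"
    by (rule local_cube_root[OF _ hol sym pos, of "1 / 100"]) simp_all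
  show thesis
  proof
    show "branch G c \<delta> s_zero" using G by unfold_locales
    fix w :: complex assume w: "w \<in> ball 0 \<delta>"
    have ne: "G w \<noteq> 0" "G w - 1 \<noteq> 0" using nz[of "G w"] G(4)[OF w] by auto
    have "(G w - of_real s_zero) ^ 3 * (4 / 9 * q3) = w ^ 3 * ((G w)\<^sup>2 * (G w - 1)\<^sup>2)"
      using G(5)[OF w] ne by (simp add: Q_def divide_simps mult_ac)
    then have "- (w ^ 3) * (G w)\<^sup>2 * (G w - 1)\<^sup>2 + 4 / 9 * q3 * (G w - of_real s_zero) ^ 3 = 0"
      by (simp add: mult_ac)
    then show "quartic (- (w ^ 3)) (- (w ^ 3) * G w) = 0"
      unfolding quartic_scale by simp
  qed
qed

lemma branch_crit:
  obtains G c \<delta> where "branch G c \<delta> s_crit"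
    "\<And>w. w \<in> ball 0 \<delta> \<Longrightarrow> quartic (w ^ 3 - 1 / 4) ((w ^ 3 - 1 / 4) * G w) = 0"
proof -
  define Q where "Q s = (s - of_real s_free) / (4 * s\<^sup>2 * (s - 1)\<^sup>2)" for s :: complex
  \<comment> \<open>Here \<open>s_crit\<close> is about \<open>1.366\<close>, and \<open>s_free\<close> is less than \<open>1\<close>.\<close>
  have nz: "s \<noteq> 0 \<and> s \<noteq> 1" if "norm (s - of_real s_crit) < 1 / 5" for s :: complex
    using near_real_nonzero[OF that, of 0] near_real_nonzero[OF that, of 1] sqrt3_bounds
    by (simp add: s_crit_def)
  have hol: "Q holomorphic_on ball (of_real s_crit) (1 / 5)"
    unfolding Q_def by (intro holomorphic_intros) (use nz in \<open>auto simp: dist_norm norm_minus_commute\<close>)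
  have sym: "Q (cnj s) = cnj (Q s)" for s by (simp add: Q_def)
  have pos: "Re (Q (of_real s_crit)) > 0"
  proof -
    have "Q (of_real s_crit) = of_real ((s_crit - s_free) / (4 * s_crit\<^sup>2 * (s_crit - 1)\<^sup>2))" by (simp add: Q_def)
    moreover have "s_crit \<noteq> 0" "s_crit \<noteq> 1" using nz[of "of_real s_crit"] by auto
    moreover have "s_crit > s_free" using sqrt3_bounds by (simp add: s_crit_def s_free_def)
    ultimately show ?thesis by simp
  qed
  obtain G c \<delta> where G: "c > 0" "\<delta> > 0" "continuous_on (ball 0 \<delta>) G"
    "\<And>v. v \<in> ball 0 \<delta> \<Longrightarrow> norm (G v - of_real s_crit) < 1 / 100"
    "\<And>v. v \<in> ball 0 \<delta> \<Longrightarrow> (G v - of_real s_crit) ^ 3 * Q (G v) = v ^ 3"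
    "\<And>v. v \<in> ball 0 \<delta> \<Longrightarrow> G (cnj v) = cnj (G v)"
    "\<And>v w. v \<in> ball 0 \<delta> \<Longrightarrow> w \<in> ball 0 \<delta> \<Longrightarrow>
       norm (G v - G w - of_real c * (v - w)) \<le> 1 / 100 * c * norm (v - w)"
    by (rule local_cube_root[OF _ hol sym pos, of "1 / 100"]) simp_all
  show thesis
  proof
    show "branch G c \<delta> s_crit" using G by unfold_locales
    fix w :: complex assume w: "w \<in> ball 0 \<delta>"
    have ne: "G w \<noteq> 0" "G w - 1 \<noteq> 0" using nz[of "G w"] G(4)[OF w] by auto
    have "(G w - of_real s_crit) ^ 3 * (G w - of_real s_free) = w ^ 3 * (4 * (G w)\<^sup>2 * (G w - 1)\<^sup>2)"
      using G(5)[OF w] ne by (simp add: Q_def divide_simps mult_ac)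
    then show "quartic (w ^ 3 - 1 / 4) ((w ^ 3 - 1 / 4) * G w) = 0"
      unfolding quartic_scale_crit by simp
  qed
qed

text \<open>
  At \<open>u = - 1 / 4\<close> the fourth root exceeds the triple root by \<open>sqrt 3 / 18\<close>.  This is
  more than the sum of the errors in \<open>far_crit\<close>.
\<close>

lemma far_crit_arith:
  fixes a b c d e q s x :: real
  assumes abce: "a + s / 4 \<le> 1 / 100" "b + s / 4 \<le> 1 / 100" "c + s / 4 \<le> 1 / 100" "e + s / 4 \<le> 1 / 100"
    and x: "- (51 / 200) \<le> x" and s: "s = (1 + q) / 2" and d: "d = 2 * x - 4 / 9 * q - (a + b + c)"
    and q: "1732 / 1000 < q"
  shows "e < d"
proof -
  define m S T where "m = a + b + c" and "S = 1 / 25 - s" and "T = 2 * x - 4 / 9 * q"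
  have "-51 / 200 \<le> x" using x by simp
  then have "1 / 25 - 1 / 2 - q / 2 < 2 * x - 4 * q / 9" using q by linarith
  moreover have "1 / 25 - 1 / 2 - q / 2 = S" by (simp add: S_def s field_simps)
  moreover have "2 * x - 4 * q / 9 = T" by (simp add: T_def)
  ultimately have "S < T" by simp
  moreover have "m + e \<le> S" using abce unfolding m_def S_def by linarith
  moreover have "d = T - m" using d by (simp add: T_def m_def)
  ultimately show ?thesis by linarith
qed

context branch
begin

lemma tuple_entry_bound:
  assumes i: "i = 1 \<or> i = 2" and w: "w \<in> ball 0 \<delta>" and k: "k \<in> {i, i + 1, i + 2}"
  shows "norm (tuple i u w $ k - u * of_real s0) \<le> norm u / 100"
proof -
  have "- (triangle i 1 $ k) * w \<in> ball 0 \<delta>" using w norm_corner[OF i k, of 1] by (simp add: norm_mult)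
  then have "norm (u * (G (- (triangle i 1 $ k) * w) - of_real s0)) \<le> norm u * (1 / 100)"
    unfolding norm_mult using near by (intro mult_left_mono) (auto intro: less_imp_le)
  then show ?thesis unfolding tuple_cluster[OF i k] by (simp add: algebra_simps)
qed

lemma tuple_rest: "tuple 1 u w $ 4 = 2 * u - 4 / 9 * q3 - (tuple 1 u w $ 1 + tuple 1 u w $ 2 + tuple 1 u w $ 3)"
  "tuple 2 u w $ 1 = 2 * u - 4 / 9 * q3 - (tuple 2 u w $ 2 + tuple 2 u w $ 3 + tuple 2 u w $ 4)"
  by (simp_all add: tuple_def)

lemma far_zero:
  assumes s0: "s0 = s_zero" and w: "w \<in> ball 0 \<delta>" and u: "norm u < 1 / 50"
  shows "far 1 (tuple 1 u w)"
proof -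
  have "0 < s0" "s0 < 1" unfolding s0 s_zero_def using sqrt3_bounds by simp_all
  then have "norm (u * of_real s0) \<le> norm u" by (simp add: norm_mult mult_left_le)
  then have small: "norm (tuple 1 u w $ k) \<le> 1 / 20" if "k \<in> {1, 2, 3}" for k
    using tuple_entry_bound[of 1 w k u] w that u norm_triangle_ineq2[of "tuple 1 u w $ k" "u * of_real s0"] by simp
  have "Re (tuple 1 u w $ 4) < Re (tuple 1 u w $ k)" if "k \<in> {1, 2, 3}" for k
    using small[of 1] small[of 2] small[of 3] small[OF that] u
      abs_Re_le_cmod[of "tuple 1 u w $ 1"] abs_Re_le_cmod[of "tuple 1 u w $ 2"] abs_Re_le_cmod[of "tuple 1 u w $ 3"]
      abs_Re_le_cmod[of "tuple 1 u w $ k"] abs_Re_le_cmod[of u] sqrt3_bounds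
    unfolding tuple_rest by simp
  then show ?thesis unfolding far_def using exhaust_4 by (metis insertCI neq_4(1))
qed

lemma far_crit:
  assumes s0: "s0 = s_crit" and w: "w \<in> ball 0 \<delta>" and u: "norm (u + 1 / 4) < 1 / 200"
  shows "far 2 (tuple 2 u w)"
proof -
  have s: "0 < s0" "s0 < 1.4" unfolding s0 s_crit_def using sqrt3_bounds by simp_all
  have "norm u \<le> norm (u + 1 / 4) + norm (1 / 4 :: complex)" using norm_triangle_ineq4[of "u + 1 / 4" "1 / 4"] by simp
  then have nu: "norm u \<le> 3 / 10" using u by simp
  have b: "\<bar>Re (tuple 2 u w $ k) + s0 / 4\<bar> \<le> 1 / 100" if "k \<in> {2, 3, 4}" for k
  proof -
    have "norm (tuple 2 u w $ k - u * of_real s0) \<le> 3 / 1000"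
      using tuple_entry_bound[of 2 w k u] w that nu by simp
    moreover have "norm ((u + 1 / 4) * of_real s0) \<le> 1 / 200 * 1.4"
      unfolding norm_mult using u s by (intro mult_mono) auto
    moreover have eq: "tuple 2 u w $ k + of_real (s0 / 4) = (tuple 2 u w $ k - u * of_real s0) + (u + 1 / 4) * of_real s0"
      by (simp add: algebra_simps)
    ultimately have "norm (tuple 2 u w $ k + of_real (s0 / 4)) \<le> 1 / 100"
      using norm_triangle_ineq[of "tuple 2 u w $ k - u * of_real s0" "(u + 1 / 4) * of_real s0"] unfolding eq by linarith
    then show ?thesis using abs_Re_le_cmod[of "tuple 2 u w $ k + of_real (s0 / 4)"] by simp
  qed
  have "\<bar>Re u + 1 / 4\<bar> \<le> 1 / 200" using abs_Re_le_cmod[of "u + 1 / 4"] u by simp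
  then have u': "- (51 / 200) \<le> Re u" by arith
  have s0': "s0 = (1 + sqrt 3) / 2" by (simp add: s0 s_crit_def)
  have rest: "Re (tuple 2 u w $ 1) = 2 * Re u - 4 / 9 * sqrt 3
      - (Re (tuple 2 u w $ 2) + Re (tuple 2 u w $ 3) + Re (tuple 2 u w $ 4))"
    unfolding tuple_rest by simp
  have b': "Re (tuple 2 u w $ l) + s0 / 4 \<le> 1 / 100" if "l \<in> {2, 3, 4}" for l
    using b[OF that] by arith
  have "Re (tuple 2 u w $ k) < Re (tuple 2 u w $ 1)" if "k \<in> {2, 3, 4}" for k
  proof -
    have "Re (tuple 2 u w $ 2) + s0 / 4 \<le> 1 / 100" "Re (tuple 2 u w $ 3) + s0 / 4 \<le> 1 / 100"
      "Re (tuple 2 u w $ 4) + s0 / 4 \<le> 1 / 100" by (intro b'; simp)+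
    then show ?thesis by (rule far_crit_arith[OF _ _ _ b'[OF that] u' s0' rest sqrt3_bounds(1)])
  qed
  then show ?thesis unfolding far_def using exhaust_4 by (metis insertCI neq_4(1))
qed

end

section \<open>Arcs around the discriminant points\<close>

text \<open>
  If \<open>A\<close> is nearly positive, then \<open>- x\<close> has nearly the direction \<open>\<theta>\<close>.
\<close>

lemma nearly_positive_direction:
  fixes x A :: complex
  assumes eq: "- x = of_real \<rho> * cis \<theta> * A" and \<rho>: "\<rho> > 0" and a: "a > 0" and near: "norm (A - of_real a) \<le> a / 50"
  shows "norm (- x - of_real (norm x) * cis \<theta>) \<le> norm x / 10"
proof -
  have n: "norm x = \<rho> * norm A" using arg_cong[OF eq, of norm] \<rho> by (simp add: norm_mult)
  have "\<bar>norm A - a\<bar> \<le> norm (A - of_real a)" using norm_triangle_ineq3[of A "of_real a"] a by simp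
  then have A: "\<bar>norm A - a\<bar> \<le> a / 50" using near by linarith
  have "norm (A - of_real (norm A)) \<le> norm (A - of_real a) + norm (of_real (a - norm A) :: complex)"
    using norm_triangle_ineq[of "A - of_real a" "of_real (a - norm A)"] by simp
  also have "norm (of_real (a - norm A) :: complex) = \<bar>norm A - a\<bar>" unfolding norm_of_real by simp
  finally have "norm (A - of_real (norm A)) \<le> norm A / 10" using A near a by linarith
  then have "\<rho> * norm (A - of_real (norm A)) \<le> \<rho> * (norm A / 10)" using \<rho> by (intro mult_left_mono) auto
  moreover have "- x - of_real (norm x) * cis \<theta> = of_real \<rho> * cis \<theta> * (A - of_real (norm A))"
    unfolding eq n by (simp add: algebra_simps)
  then have "norm (- x - of_real (norm x) * cis \<theta>) = \<rho> * norm (A - of_real (norm A))"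
    using \<rho> by (simp only: norm_mult norm_of_real norm_cis abs_of_pos mult_1_right)
  ultimately show ?thesis unfolding n by simp
qed

context branch
begin

text \<open>
  With \<open>x = 1 + \<epsilon> * cis \<psi>\<close> one has \<open>u = z * (1 + z)\<close> for \<open>z = \<epsilon> / 2 * cis \<psi>\<close>.  So \<open>w\<close>,
  a cube root of \<open>- u\<close>, has about a third of the angle of \<open>u\<close>, and \<open>u * w\<close> turns four thirds as fast as
  \<open>x\<close> does.  The start \<open>\<psi>0 = pi\<close> is for the circle around \<open>-1\<close>, reflected at the origin.
\<close>

lemma has_monodromy_arc_zero:
  assumes s0: "s0 = s_zero"
    and roots: "\<And>w. w \<in> ball 0 \<delta> \<Longrightarrow> quartic (- (w ^ 3)) (- (w ^ 3) * G w) = 0"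
  obtains e where "e > 0" "\<And>\<epsilon> \<psi>0 d \<gamma>. 0 < \<epsilon> \<Longrightarrow> \<epsilon> < e \<Longrightarrow> \<psi>0 = 0 \<or> \<psi>0 = pi \<Longrightarrow> 0 < d \<Longrightarrow>
     (\<And>t. t \<in> {0..1} \<Longrightarrow> \<gamma> t = 1 + of_real \<epsilon> * cis (\<psi>0 + 2 ^ d * t * pi / 2)) \<Longrightarrow>
     has_monodromy \<gamma> ((\<sigma> 1 \<otimes>\<^bsub>B4\<^esub> \<sigma> 2) [^]\<^bsub>B4\<^esub> ((2::nat) ^ d))"
proof -
  \<comment> \<open>The cube root of \<open>1 + z\<close> that is close to \<open>1\<close>.\<close>
  define E where "E z = exp (Ln (1 + z) / 3)" for z :: complex
  have "isCont (\<lambda>z. E z ^ 4) 0"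
    unfolding E_def by (intro continuous_intros) auto
  then obtain r where r: "r > 0" "\<And>z. dist z 0 < r \<Longrightarrow> dist (E z ^ 4) (E 0 ^ 4) < 1 / 50"
    unfolding continuous_at_eps_delta by (metis zero_less_divide_1_iff zero_less_numeral)
  have E0: "E 0 = 1" by (simp add: E_def)
  define e where "e = Min {1 / 50, r, \<delta> ^ 3}"
  have e: "e > 0" "e \<le> 1 / 50" "e \<le> r" "e \<le> \<delta> ^ 3" using r \<delta> by (simp_all add: e_def)
  show thesis
  proof
    show "e > 0" by fact
    fix \<epsilon> \<psi>0 :: real and d :: nat and \<gamma> :: "real \<Rightarrow> complex"
    assume \<epsilon>: "0 < \<epsilon>" "\<epsilon> < e" and \<psi>0: "\<psi>0 = 0 \<or> \<psi>0 = pi" and d: "0 < d"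
      and \<gamma>: "\<And>t. t \<in> {0..1} \<Longrightarrow> \<gamma> t = 1 + of_real \<epsilon> * cis (\<psi>0 + 2 ^ d * t * pi / 2)"
    define \<psi> where "\<psi> t = \<psi>0 + 2 ^ d * t * pi / 2" for t
    define z where "z t = of_real (\<epsilon> / 2) * cis (\<psi> t)" for t
    define R where "R = root 3 (\<epsilon> / 2)"
    \<comment> \<open>A cube root of unity; it chooses the cube root of \<open>- u\<close> for which the triangle starts at angle \<open>0\<close>.\<close>
    define \<kappa> where "\<kappa> = cis (- (4 * \<psi>0 / 3))"
    define w where "w t = - (\<kappa> * of_real R * cis (\<psi> t / 3) * E (z t))" for t
    define u where "u t = - (w t ^ 3)" for t
    have R: "R > 0" "R ^ 3 = \<epsilon> / 2" using \<epsilon> by (simp_all add: R_def)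
    have nz: "norm (z t) = \<epsilon> / 2" for t using \<epsilon> by (simp add: z_def norm_mult)
    have zr: "norm (z t) < r" "norm (z t) < 1 / 50" for t using nz[of t] \<epsilon> e by simp_all
    have z1: "1 + z t \<notin> \<real>\<^sub>\<le>\<^sub>0" "1 + z t \<noteq> 0" for t
    proof -
      have "Re (1 + z t) > 0" using abs_Re_le_cmod[of "z t"] zr(2)[of t] by (simp add: abs_le_iff)
      then show "1 + z t \<notin> \<real>\<^sub>\<le>\<^sub>0" "1 + z t \<noteq> 0" by (auto simp: complex_nonpos_Reals_iff complex_eq_iff)
    qed
    have E3: "E (z t) ^ 3 = 1 + z t" for t
      using z1(2)[of t] by (simp add: E_def flip: exp_of_nat_mult)
    have Enz: "E (z t) \<noteq> 0" for t by (simp add: E_def)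
    have "cis (- (4 * pi)) = cis (- (2 * pi)) * cis (- (2 * pi))" unfolding cis_mult by simp
    also have "cis (- (2 * pi)) = 1" by (simp add: complex_eq_iff)
    finally have \<kappa>3: "\<kappa> ^ 3 = 1" using \<psi>0 by (auto simp: \<kappa>_def Complex.DeMoivre)
    have w3: "w t ^ 3 = - (z t * (1 + z t))" for t
    proof -
      have "w t ^ 3 = - (\<kappa> ^ 3 * of_real (R ^ 3) * cis (\<psi> t / 3) ^ 3 * E (z t) ^ 3)"
        by (simp add: w_def power_mult_distrib power3_eq_cube)
      also have "cis (\<psi> t / 3) ^ 3 = cis (\<psi> t)" by (simp add: Complex.DeMoivre)
      finally have eq: "w t ^ 3 = - (\<kappa> ^ 3 * of_real (R ^ 3) * cis (\<psi> t) * E (z t) ^ 3)" .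
      show ?thesis unfolding eq \<kappa>3 R(2) E3 by (simp add: z_def)
    qed
    have u_eq: "u t = z t * (1 + z t)" for t by (simp add: u_def w3)
    have nu: "norm (u t) < \<epsilon>" for t
    proof -
      have "norm (1 + z t) \<le> 1 + norm (z t)" using norm_triangle_ineq[of 1 "z t"] by simp
      then have "norm (1 + z t) \<le> 51 / 50" using zr(2)[of t] by simp
      then have "norm (u t) \<le> \<epsilon> / 2 * (51 / 50)"
        unfolding u_eq norm_mult nz using \<epsilon> by (intro mult_left_mono) auto
      then show ?thesis using \<epsilon> by simp
    qed
    have wball: "w t \<in> ball 0 \<delta>" for t
    proof -
      have "norm (w t) ^ 3 = norm (u t)" by (simp add: u_def norm_power)
      also have "\<dots> < \<delta> ^ 3" using nu[of t] \<epsilon> e by simp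
      finally have "norm (w t) < \<delta>" using \<delta> power_less_imp_less_base by (metis less_imp_le)
      then show ?thesis by simp
    qed
    have wnz: "w t \<noteq> 0" for t using R Enz by (simp add: w_def \<kappa>_def)
    have unz: "u t \<noteq> 0" for t using wnz by (simp add: u_def)
    have contz: "continuous_on {0..1} z" unfolding z_def \<psi>_def by (intro continuous_intros) auto
    have contE: "continuous_on {0..1} (\<lambda>t. E (z t))"
      unfolding E_def using z1 by (intro continuous_intros contz) auto
    have contw: "continuous_on {0..1} w"
      unfolding w_def \<psi>_def by (intro continuous_intros contE) auto
    have contu: "continuous_on {0..1} u" unfolding u_def by (intro continuous_intros contw)
    have real_ends: "u t \<in> \<real>" "E (z t) \<in> \<real>" if t01: "t = 0 \<or> t = 1" for t
    proof -
      obtain m :: int where m: "\<psi> t = pi * of_int m"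
      proof -
        have "\<exists>m. \<psi> t = pi * of_int m"
        proof -
          obtain d' where d': "d = Suc d'" using d gr0_implies_Suc by blast
          have "\<psi> t = \<psi>0 + 2 ^ d' * t * pi" by (simp add: \<psi>_def d')
          then show ?thesis using t01 \<psi>0
            by (intro exI[of _ "(if \<psi>0 = 0 then 0 else 1) + (if t = 0 then 0 else 2 ^ d')"]) (auto simp: algebra_simps)
        qed
        then show thesis using \<open>\<And>m. \<psi> t = pi * of_int m \<Longrightarrow> thesis\<close> by blast
      qed
      have "sin (\<psi> t) = 0" unfolding m by (simp add: sin_zero_iff_int2)
      then have "Im (z t) = 0" by (simp add: z_def)
      then have zR: "z t = of_real (Re (z t))" by (simp add: complex_eq_iff)
      then have "z t \<in> \<real>" by (metis Reals_of_real)
      then show "u t \<in> \<real>" unfolding u_eq by (intro Reals_mult Reals_add) auto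
      have pos: "1 + Re (z t) > 0" using abs_Re_le_cmod[of "z t"] zr(2)[of t] by (simp add: abs_le_iff)
      have "E (z t) = exp (Ln (of_real (1 + Re (z t))) / 3)" unfolding E_def using zR by simp
      also have "Ln (of_real (1 + Re (z t))) = of_real (ln (1 + Re (z t)))" using pos by (intro Ln_of_real)
      also have "exp (complex_of_real (ln (1 + Re (z t))) / 3) = of_real (exp (ln (1 + Re (z t)) / 3))"
        by (simp add: exp_of_real[symmetric])
      finally show "E (z t) \<in> \<real>" by simp
    qed
    have cisR: "cis (pi * of_int m) \<in> \<real>" for m :: int
    proof -
      have "sin (pi * of_int m) = 0" by (simp add: sin_zero_iff_int2)
      then show ?thesis by (simp add: complex_is_Real_iff)
    qed
    have w0: "w 0 \<in> \<real>"
    proof -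
      have "\<kappa> * cis (\<psi> 0 / 3) = cis (- \<psi>0)" by (simp add: \<kappa>_def \<psi>_def cis_mult)
      moreover have "cis (- \<psi>0) \<in> \<real>" using \<psi>0 by (auto simp: complex_is_Real_iff)
      moreover have "w 0 = - (\<kappa> * cis (\<psi> 0 / 3) * of_real R * E (z 0))" by (simp add: w_def)
      ultimately show ?thesis using real_ends(2)[of 0] by (auto intro!: Reals_mult Reals_minus)
    qed
    have w1: "\<omega> ^ (2 * 2 ^ d) * w 1 \<in> \<real>"
    proof -
      obtain d' where d': "d = Suc d'" using d gr0_implies_Suc by blast
      have "\<omega> ^ (2 * 2 ^ d) * \<kappa> * cis (\<psi> 1 / 3) = cis (2 * pi * real (2 * 2 ^ d) / 3 - 4 * \<psi>0 / 3 + \<psi> 1 / 3)"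
        by (simp add: \<omega>_power \<kappa>_def cis_mult)
      also have "2 * pi * real (2 * 2 ^ d) / 3 - 4 * \<psi>0 / 3 + \<psi> 1 / 3 = pi * of_int (3 * 2 ^ d') - \<psi>0"
        by (simp add: \<psi>_def d' field_simps)
      finally have eq: "\<omega> ^ (2 * 2 ^ d) * \<kappa> * cis (\<psi> 1 / 3) = cis (pi * of_int (3 * 2 ^ d')) * cis (- \<psi>0)"
        by (simp add: cis_mult)
      have "cis (- \<psi>0) \<in> \<real>" using \<psi>0 by (auto simp: complex_is_Real_iff)
      then have "\<omega> ^ (2 * 2 ^ d) * \<kappa> * cis (\<psi> 1 / 3) \<in> \<real>" unfolding eq using cisR by (intro Reals_mult)
      moreover have "\<omega> ^ (2 * 2 ^ d) * w 1 = - (\<omega> ^ (2 * 2 ^ d) * \<kappa> * cis (\<psi> 1 / 3) * of_real R * E (z 1))"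
        by (simp add: w_def)
      ultimately show ?thesis using real_ends(2)[of 1] by (auto intro!: Reals_mult Reals_minus)
    qed
    have dir: "norm (- (u t * w t) - of_real (norm (u t * w t)) * cis (2 * pi / 3 * (2 ^ d * t))) \<le> norm (u t * w t) / 10" for t
    proof -
      let ?\<theta> = "2 * pi / 3 * (2 ^ d * t)" and ?A = "E (z t) ^ 4"
      define \<rho> where "\<rho> = R ^ 4"
      have "- (u t * w t) = w t ^ 4" by (simp add: u_def power4_eq_xxxx power3_eq_cube)
      also have "\<dots> = of_real \<rho> * (\<kappa> ^ 4 * cis (\<psi> t / 3) ^ 4) * ?A"
        by (simp add: w_def \<rho>_def power_mult_distrib)
      also have "\<kappa> ^ 4 = \<kappa>" using \<kappa>3 by (simp add: power4_eq_xxxx power3_eq_cube)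
      also have "cis (\<psi> t / 3) ^ 4 = cis (4 * \<psi> t / 3)" unfolding Complex.DeMoivre by simp
      also have "\<kappa> * cis (4 * \<psi> t / 3) = cis ?\<theta>" by (simp add: \<kappa>_def cis_mult \<psi>_def field_simps)
      finally have eq: "- (u t * w t) = of_real \<rho> * cis ?\<theta> * ?A" .
      have A: "norm (?A - of_real 1) \<le> 1 / 50" using r(2)[of "z t"] zr(1)[of t] by (simp add: dist_norm E0)
      have "\<rho> > 0" using R by (simp add: \<rho>_def)
      then show ?thesis by (rule nearly_positive_direction[OF eq _ _ A]) simp
    qed
    have rt: "quartic (u t) (u t * G (\<zeta> * w t)) = 0" if "\<zeta> ^ 3 = 1" for t \<zeta>
    proof -
      have "\<zeta> * w t \<in> ball 0 \<delta>" using wball[of t] norm_cube_root_of_unity[OF that] by (simp add: norm_mult)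
      then show ?thesis using roots[of "\<zeta> * w t"] that by (simp add: u_def power_mult_distrib)
    qed
    have far: "far 1 (tuple 1 (u t) (w t))" for t
      using nu[of t] \<epsilon> e by (intro far_zero s0 wball) simp
    have "((\<gamma> t)\<^sup>2 - 1) / 4 = u t" if "t \<in> {0..1}" for t
      unfolding \<gamma>[OF that] u_eq z_def \<psi>_def by (simp add: power2_eq_square field_simps)
    then have "has_monodromy \<gamma> ((\<sigma> 1 \<otimes>\<^bsub>B4\<^esub> \<sigma> (1 + 1)) [^]\<^bsub>B4\<^esub> ((2::nat) ^ d))"
      using contu contw wball unz wnz dir far rt real_ends(1) w0 w1
      by (intro has_monodromy_arc[where u = u and w = w]) auto
    then show "has_monodromy \<gamma> ((\<sigma> 1 \<otimes>\<^bsub>B4\<^esub> \<sigma> 2) [^]\<^bsub>B4\<^esub> ((2::nat) ^ d))" by simp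
  qed
qed

text \<open>
  With \<open>x = \<epsilon> * cis \<psi>\<close> one has \<open>u + 1 / 4 = x\<^sup>2 / 4\<close>.  So \<open>w\<close>, a cube root of this number,
  turns two thirds as fast as \<open>x\<close>, while \<open>u\<close> is nearly constant.
\<close>

lemma has_monodromy_arc_crit:
  assumes s0: "s0 = s_crit"
    and roots: "\<And>w. w \<in> ball 0 \<delta> \<Longrightarrow> quartic (w ^ 3 - 1 / 4) ((w ^ 3 - 1 / 4) * G w) = 0"
  obtains e where "e > 0" "\<And>\<epsilon> d \<gamma>. 0 < \<epsilon> \<Longrightarrow> \<epsilon> < e \<Longrightarrow>
     (\<And>t. t \<in> {0..1} \<Longrightarrow> \<gamma> t = of_real \<epsilon> * cis (2 ^ d * t * pi)) \<Longrightarrow>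
     has_monodromy \<gamma> ((\<sigma> 2 \<otimes>\<^bsub>B4\<^esub> \<sigma> 3) [^]\<^bsub>B4\<^esub> ((2::nat) ^ d))"
proof -
  define e where "e = Min {1 / 20, \<delta> ^ 3}"
  have e: "e > 0" "e \<le> 1 / 20" "e \<le> \<delta> ^ 3" using \<delta> by (simp_all add: e_def)
  show thesis
  proof
    show "e > 0" by fact
    fix \<epsilon> :: real and d :: nat and \<gamma> :: "real \<Rightarrow> complex"
    assume \<epsilon>: "0 < \<epsilon>" "\<epsilon> < e"
      and \<gamma>: "\<And>t. t \<in> {0..1} \<Longrightarrow> \<gamma> t = of_real \<epsilon> * cis (2 ^ d * t * pi)"
    define \<theta> where "\<theta> t = 2 * pi / 3 * (2 ^ d * t)" for t :: real
    define R where "R = root 3 (\<epsilon>\<^sup>2 / 4)"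
    define w where "w t = of_real R * cis (\<theta> t)" for t
    define u where "u t = w t ^ 3 - 1 / 4" for t
    have R: "R > 0" "R ^ 3 = \<epsilon>\<^sup>2 / 4" using \<epsilon> by (simp_all add: R_def)
    have e2: "\<epsilon>\<^sup>2 / 4 < 1 / 200" "\<epsilon>\<^sup>2 / 4 < \<delta> ^ 3"
    proof -
      have "\<epsilon> * \<epsilon> \<le> \<epsilon> * (1 / 20)" using \<epsilon> e by (intro mult_left_mono) auto
      then have "\<epsilon>\<^sup>2 \<le> \<epsilon> / 20" by (simp add: power2_eq_square)
      then show "\<epsilon>\<^sup>2 / 4 < 1 / 200" "\<epsilon>\<^sup>2 / 4 < \<delta> ^ 3" using \<epsilon> e by linarith+
    qed
    have w3: "w t ^ 3 = of_real (\<epsilon>\<^sup>2 / 4) * cis (3 * \<theta> t)" for t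
    proof -
      have "w t ^ 3 = of_real (R ^ 3) * cis (\<theta> t) ^ 3" by (simp add: w_def power_mult_distrib)
      then show ?thesis by (simp add: R(2) Complex.DeMoivre)
    qed
    have nw3: "norm (w t ^ 3) < 1 / 200" for t
      unfolding w3 norm_mult norm_of_real norm_cis using e2(1) by simp
    have wball: "w t \<in> ball 0 \<delta>" for t
    proof -
      have "R ^ 3 < \<delta> ^ 3" unfolding R(2) by (rule e2(2))
      then have "R < \<delta>" using \<delta> power_less_imp_less_base by (metis less_imp_le)
      then show ?thesis using R by (simp add: w_def norm_mult)
    qed
    have wnz: "w t \<noteq> 0" for t using R by (simp add: w_def)
    have nu: "norm (u t + 1 / 4) < 1 / 200" for t using nw3[of t] by (simp add: u_def)
    have unz: "u t \<noteq> 0" for t using nu[of t] by auto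
    have contw: "continuous_on {0..1} w" unfolding w_def \<theta>_def by (intro continuous_intros) auto
    have contu: "continuous_on {0..1} u" unfolding u_def by (intro continuous_intros contw)
    have u_eq: "u t = ((of_real \<epsilon> * cis (2 ^ d * t * pi))\<^sup>2 - 1) / 4" for t
    proof -
      have sq: "(of_real \<epsilon> * cis (2 ^ d * t * pi))\<^sup>2 = of_real (\<epsilon>\<^sup>2) * cis (3 * \<theta> t)"
        by (simp add: power_mult_distrib Complex.DeMoivre \<theta>_def mult_ac)
      show ?thesis unfolding u_def w3 sq by simp
    qed
    have real_ends: "u t \<in> \<real>" if "t = 0 \<or> t = 1" for t
    proof -
      have "3 * \<theta> t = of_int (2 ^ d * (if t = 0 then 0 else 1)) * (2 * pi)" using that by (auto simp: \<theta>_def)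
      then have "sin (3 * \<theta> t) = 0" by (simp only: sin_zero_iff_int2) (rule exI[of _ "2 * (2 ^ d * (if t = 0 then 0 else 1))"], simp)
      then have "w t ^ 3 \<in> \<real>" unfolding w3 by (simp add: complex_is_Real_iff)
      then show ?thesis unfolding u_def by (intro Reals_diff Reals_divide) auto
    qed
    have w0: "w 0 \<in> \<real>" by (simp add: w_def \<theta>_def)
    have w1: "\<omega> ^ (2 * 2 ^ d) * w 1 \<in> \<real>"
    proof -
      have "cis (\<theta> 1) = \<omega> ^ (2 ^ d)" by (simp add: \<theta>_def \<omega>_power mult_ac)
      then have "\<omega> ^ (2 * 2 ^ d) * w 1 = of_real R * (\<omega> ^ 3) ^ (2 ^ d)"
        by (simp add: w_def flip: power_mult power_add)
      then show ?thesis by (simp add: \<omega>_cube)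
    qed
    have dir: "norm (- (u t * w t) - of_real (norm (u t * w t)) * cis (2 * pi / 3 * (2 ^ d * t))) \<le> norm (u t * w t) / 10" for t
    proof -
      have "- (u t * w t) = of_real R * cis (2 * pi / 3 * (2 ^ d * t)) * (- u t)" by (simp add: w_def \<theta>_def)
      moreover have "norm (- u t - of_real (1 / 4)) \<le> 1 / 4 / 50" using nw3[of t] by (simp add: u_def)
      ultimately show ?thesis using R(1) by (intro nearly_positive_direction[where a = "1 / 4"]) auto
    qed
    have rt: "quartic (u t) (u t * G (\<zeta> * w t)) = 0" if "\<zeta> ^ 3 = 1" for t \<zeta>
    proof -
      have "\<zeta> * w t \<in> ball 0 \<delta>" using wball[of t] norm_cube_root_of_unity[OF that] by (simp add: norm_mult)
      then show ?thesis using roots[of "\<zeta> * w t"] that by (simp add: u_def power_mult_distrib)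
    qed
    have far: "far 2 (tuple 2 (u t) (w t))" for t
      using nu[of t] by (intro far_crit s0 wball)
    have "((\<gamma> t)\<^sup>2 - 1) / 4 = u t" if "t \<in> {0..1}" for t
      unfolding \<gamma>[OF that] u_eq ..
    then have "has_monodromy \<gamma> ((\<sigma> 2 \<otimes>\<^bsub>B4\<^esub> \<sigma> (2 + 1)) [^]\<^bsub>B4\<^esub> ((2::nat) ^ d))"
      using contu contw wball unz wnz dir far rt real_ends w0 w1
      by (intro has_monodromy_arc[where u = u and w = w]) auto
    then show "has_monodromy \<gamma> ((\<sigma> 2 \<otimes>\<^bsub>B4\<^esub> \<sigma> 3) [^]\<^bsub>B4\<^esub> ((2::nat) ^ d))" by simp
  qed
qed

end

section \<open>Real values of the parameter\<close>

lemma near_triangle_Re: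
  assumes i: "i = 1 \<or> i = 2" and near: "near_triangle i 0 z"
  shows "Re (z $ i) > Re (z $ (i + 2))" "Re (z $ (i + 1)) > Re (z $ (i + 2))"
proof -
  obtain \<rho> where \<rho>: "\<rho> > 0" and est: "\<And>j k. j \<in> {i, i + 1, i + 2} \<Longrightarrow> k \<in> {i, i + 1, i + 2} \<Longrightarrow>
        norm (z $ j - z $ k - complex_of_real \<rho> * cis 0 * (triangle i 1 $ j - triangle i 1 $ k)) \<le> \<rho> / 2"
    using near by (elim near_triangleE) blast
  have T: "triangle i 1 $ i = Complex (1 / 2) (sqrt 3 / 2)" "triangle i 1 $ (i + 1) = Complex (1 / 2) (- sqrt 3 / 2)"
    "triangle i 1 $ (i + 2) = -1"
    using i by (elim disjE; simp add: triangle_def)+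
  have *: "\<bar>Re (z $ j - z $ (i + 2)) - \<rho> * (3 / 2)\<bar> \<le> \<rho> / 2" if "j = i \<or> j = i + 1" for j
  proof -
    let ?e = "z $ j - z $ (i + 2) - complex_of_real \<rho> * cis 0 * (triangle i 1 $ j - triangle i 1 $ (i + 2))"
    have "Re ?e = Re (z $ j - z $ (i + 2)) - \<rho> * (3 / 2)" using that T by (elim disjE) simp_all
    moreover have "norm ?e \<le> \<rho> / 2" using that by (intro est) auto
    ultimately show ?thesis using abs_Re_le_cmod[of ?e] by linarith
  qed
  show "Re (z $ i) > Re (z $ (i + 2))" "Re (z $ (i + 1)) > Re (z $ (i + 2))"
  proof -
    have "Re (z $ j - z $ (i + 2)) \<ge> \<rho>" if "j = i \<or> j = i + 1" for j
      using *[OF that] unfolding abs_le_iff by linarith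
    then have "Re (z $ i - z $ (i + 2)) \<ge> \<rho>" "Re (z $ (i + 1) - z $ (i + 2)) \<ge> \<rho>" by simp_all
    then show "Re (z $ i) > Re (z $ (i + 2))" "Re (z $ (i + 1)) > Re (z $ (i + 2))" using \<rho> by simp_all
  qed
qed

context branch
begin

lemma tuple_real:
  fixes u w :: real
  assumes i: "i = 1 \<or> i = 2" and w: "\<bar>w\<bar> < \<delta>" and neg: "u * w < 0"
    and far: "far i (tuple i (of_real u) (of_real w))"
    and roots: "\<And>\<zeta>. \<zeta> ^ 3 = 1 \<Longrightarrow> quartic (of_real u) (of_real u * G (\<zeta> * of_real w)) = 0"
  shows "near_triangle i 0 (tuple i (of_real u) (of_real w))"
    "same_order (tuple i (of_real u) (of_real w)) (triangle i 1)"
    "range (($) (tuple i (of_real u) (of_real w))) = {y. quartic (of_real u) y = 0}"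
proof -
  have w': "complex_of_real w \<in> ball 0 \<delta>" using w by simp
  have "norm (complex_of_real u * of_real w) = - (u * w)" using neg by (simp flip: of_real_mult)
  then have "- (complex_of_real u * of_real w) - of_real (norm (complex_of_real u * of_real w)) * cis 0 = 0" by simp
  then show near: "near_triangle i 0 (tuple i (of_real u) (of_real w))"
    using neg by (intro tuple_near_triangle i w' far) (auto simp: norm_mult)
  show "same_order (tuple i (of_real u) (of_real w)) (triangle i 1)"
    using tuple_same_order[OF i w' near, of 0] by simp
  show "range (($) (tuple i (of_real u) (of_real w))) = {y. quartic (of_real u) y = 0}"
    by (rule range_tuple[OF i near roots])
qed

text \<open>
  The real cube root of \<open>- u\<close> has the sign opposite to \<open>u\<close>, so that \<open>- (u * w)\<close> is positive for
  both signs of \<open>u\<close>.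
\<close>

lemma tuple_real_zero:
  assumes s0: "s0 = s_zero"
    and roots: "\<And>w. w \<in> ball 0 \<delta> \<Longrightarrow> quartic (- (w ^ 3)) (- (w ^ 3) * G w) = 0"
    and u: "u \<noteq> 0" "\<bar>u\<bar> < 1 / 50" "\<bar>u\<bar> < \<delta> ^ 3"
  defines "z \<equiv> tuple 1 (of_real u) (of_real (root 3 (- u)))"
  shows "\<bar>root 3 (- u)\<bar> < \<delta>" "near_triangle 1 0 z" "same_order z (triangle 1 1)"
    "range (($) z) = {y. quartic (of_real u) y = 0}"
proof -
  let ?w = "root 3 (- u)"
  have w3: "?w ^ 3 = - u" by (rule odd_real_root_pow) simp
  have "\<bar>?w\<bar> ^ 3 = \<bar>u\<bar>" using w3 by (simp flip: power_abs)
  then have "\<bar>?w\<bar> ^ 3 < \<delta> ^ 3" using u by simp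
  then show w: "\<bar>?w\<bar> < \<delta>" using \<delta> power_less_imp_less_base by (metis less_imp_le)
  have neg: "u * ?w < 0"
  proof (cases "u > 0")
    case True then show ?thesis by (simp add: mult_less_0_iff)
  next
    case False then show ?thesis using u(1) by (simp add: mult_less_0_iff)
  qed
  have uw: "complex_of_real u = - (of_real ?w ^ 3)" using w3 by (simp flip: of_real_power)
  have rt: "quartic (of_real u) (of_real u * G (\<zeta> * of_real ?w)) = 0" if "\<zeta> ^ 3 = 1" for \<zeta>
  proof -
    have "\<zeta> * of_real ?w \<in> ball 0 \<delta>" using w norm_cube_root_of_unity[OF that] by (simp add: norm_mult)
    then show ?thesis using roots[of "\<zeta> * of_real ?w"] that by (simp add: uw power_mult_distrib)
  qed
  have "far 1 z" unfolding z_def using u w by (intro far_zero s0) auto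
  then show "near_triangle 1 0 z" "same_order z (triangle 1 1)" "range (($) z) = {y. quartic (of_real u) y = 0}"
    using tuple_real[OF _ w neg _ rt, of 1] unfolding z_def by auto
qed

lemma tuple_real_crit:
  assumes s0: "s0 = s_crit"
    and roots: "\<And>w. w \<in> ball 0 \<delta> \<Longrightarrow> quartic (w ^ 3 - 1 / 4) ((w ^ 3 - 1 / 4) * G w) = 0"
    and u: "- 1 / 4 < u" "u + 1 / 4 < 1 / 200" "u + 1 / 4 < \<delta> ^ 3"
  defines "z \<equiv> tuple 2 (of_real u) (of_real (root 3 (u + 1 / 4)))"
  shows "near_triangle 2 0 z" "same_order z (triangle 2 1)" "range (($) z) = {y. quartic (of_real u) y = 0}"
proof -
  let ?w = "root 3 (u + 1 / 4)"
  have w3: "?w ^ 3 = u + 1 / 4" by (rule odd_real_root_pow) simp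
  have wpos: "?w > 0" using u(1) by simp
  have "?w ^ 3 < \<delta> ^ 3" using u w3 by simp
  then have "?w < \<delta>" using \<delta> power_less_imp_less_base by (metis less_imp_le)
  then have w: "\<bar>?w\<bar> < \<delta>" using wpos by simp
  have neg: "u * ?w < 0" using wpos u(2) by (intro mult_neg_pos) auto
  have uw: "complex_of_real u = of_real ?w ^ 3 - 1 / 4" using w3 by (simp flip: of_real_power)
  have rt: "quartic (of_real u) (of_real u * G (\<zeta> * of_real ?w)) = 0" if "\<zeta> ^ 3 = 1" for \<zeta>
  proof -
    have "\<zeta> * of_real ?w \<in> ball 0 \<delta>" using w norm_cube_root_of_unity[OF that] by (simp add: norm_mult)
    then show ?thesis using roots[of "\<zeta> * of_real ?w"] that by (simp add: uw power_mult_distrib)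
  qed
  have "complex_of_real u + 1 / 4 = of_real (u + 1 / 4)" by simp
  then have "norm (complex_of_real u + 1 / 4) = \<bar>u + 1 / 4\<bar>" by (simp only: norm_of_real)
  then have "far 2 z" unfolding z_def using u w by (intro far_crit s0) auto
  then show "near_triangle 2 0 z" "same_order z (triangle 2 1)" "range (($) z) = {y. quartic (of_real u) y = 0}"
    using tuple_real[OF _ w neg _ rt, of 2] unfolding z_def by auto
qed

text \<open>
  Over the real axis to the right of \<open>1\<close> the order of the roots never changes.
\<close>

lemma has_monodromy_right:
  assumes s0: "s0 = s_zero"
    and roots: "\<And>w. w \<in> ball 0 \<delta> \<Longrightarrow> quartic (- (w ^ 3)) (- (w ^ 3) * G w) = 0"
    and ab: "1 < a" "1 < b" and bound: "\<And>x. x \<in> {a, b} \<Longrightarrow> x\<^sup>2 - 1 < 1 / 50 \<and> x\<^sup>2 - 1 < \<delta> ^ 3"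
  shows "has_monodromy (linepath (of_real a) (of_real b)) \<one>\<^bsub>B4\<^esub>"
proof -
  define x where "x t = (1 - t) * a + t * b" for t
  define u where "u t = ((x t)\<^sup>2 - 1) / 4" for t
  define z where "z t = tuple 1 (of_real (u t)) (of_real (root 3 (- u t)))" for t
  have u: "u t \<noteq> 0 \<and> \<bar>u t\<bar> < 1 / 50 \<and> \<bar>u t\<bar> < \<delta> ^ 3" if t: "t \<in> {0..1}" for t
  proof -
    have "min a b \<le> x t" "x t \<le> max a b"
      using convex_bound_le[of a "max a b" b "1 - t" t] convex_bound_le[of "- a" "- min a b" "- b" "1 - t" t] t
      by (auto simp: x_def)
    then have x: "1 < x t" "x t \<le> max a b" using ab by auto
    then have "(x t)\<^sup>2 \<le> (max a b)\<^sup>2" by (intro power_mono) auto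
    moreover have "(max a b)\<^sup>2 - 1 < 1 / 50 \<and> (max a b)\<^sup>2 - 1 < \<delta> ^ 3" using bound by (auto simp: max_def)
    moreover have "1 < (x t)\<^sup>2" using x(1) by (simp add: one_less_power)
    ultimately show ?thesis by (simp add: u_def)
  qed
  have zt: "\<bar>root 3 (- u t)\<bar> < \<delta>" "near_triangle 1 0 (z t)" "same_order (z t) (triangle 1 1)"
    "range (($) (z t)) = {y. quartic (of_real (u t)) y = 0}" if t: "t \<in> {0..1}" for t
    using tuple_real_zero[OF s0 roots, of "u t"] u[OF t] unfolding z_def by auto
  have p: "path z"
    unfolding path_def z_def
  proof (rule continuous_tuple)
    show "continuous_on {0..1} (\<lambda>t. complex_of_real (u t))" unfolding u_def x_def by (intro continuous_intros) auto
    show "continuous_on {0..1} (\<lambda>t. complex_of_real (root 3 (- u t)))"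
      unfolding u_def x_def by (intro continuous_intros) auto
  qed (use zt(1) in auto)
  have "z t \<in> conf" if "t \<in> {0..1}" for t using near_triangle_conf[OF _ zt(2)[OF that]] by simp
  then have c: "conf_path z" using p by (auto simp: path_image_def)
  have ux: "((linepath (complex_of_real a) (of_real b) t)\<^sup>2 - 1) / 4 = of_real (u t)" for t
    by (simp add: u_def x_def linepath_of_real)
  have "lifts (linepath (of_real a) (of_real b)) z"
    unfolding lifts_def roots_def h_quartic ux using c zt(4) by auto
  moreover have "braid_of z = \<one>\<^bsub>B4\<^esub>"
    using zt(3)[of 0] zt(3) by (intro braid_of_constant_order c) (meson same_order_sym same_order_trans atLeastAtMost_iff order_refl zero_le_one)
  ultimately show ?thesis by (rule has_monodromyI)
qed

end

section \<open>Between the discriminant points\<close>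

definition quartic_real :: "real \<Rightarrow> real \<Rightarrow> real" where
  "quartic_real u y = y\<^sup>2 * (y - u)\<^sup>2 + 4 / 9 * sqrt 3 * (y - s_zero * u) ^ 3"

lemma quartic_of_real: "quartic (of_real u) (of_real y) = of_real (quartic_real u y)"
  by (simp add: quartic_def quartic_real_def)

definition branch_map :: "real \<Rightarrow> real" where
  "branch_map s = - (4 / 9 * sqrt 3 * (s - s_zero) ^ 3 / (s\<^sup>2 * (s - 1)\<^sup>2))"

lemma quartic_real_branch_map:
  assumes "s \<noteq> 0" "s \<noteq> 1" "u \<noteq> 0"
  shows "quartic_real u (u * s) = 0 \<longleftrightarrow> u = branch_map s"
proof -
  define k where "k = 4 / 9 * sqrt 3"
  have "quartic_real u (u * s) = u ^ 3 * (u * (s\<^sup>2 * (s - 1)\<^sup>2) + 4 / 9 * sqrt 3 * (s - s_zero) ^ 3)"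
    unfolding quartic_real_def k_def[symmetric] by (simp add: power2_eq_square power3_eq_cube algebra_simps)
  then have "quartic_real u (u * s) = 0 \<longleftrightarrow> u * (s\<^sup>2 * (s - 1)\<^sup>2) + 4 / 9 * sqrt 3 * (s - s_zero) ^ 3 = 0"
    using assms by simp
  also have "\<dots> \<longleftrightarrow> u * (s\<^sup>2 * (s - 1)\<^sup>2) = - (4 / 9 * sqrt 3 * (s - s_zero) ^ 3)" by linarith
  also have "\<dots> \<longleftrightarrow> u = branch_map s"
  proof -
    define P K where "P = s\<^sup>2 * (s - 1)\<^sup>2" and "K = 4 / 9 * sqrt 3 * (s - s_zero) ^ 3"
    have "P \<noteq> 0" using assms by (simp add: P_def)
    then have "u * P = - K \<longleftrightarrow> u = - (K / P)" by (simp add: field_simps)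
    then show ?thesis unfolding branch_map_def P_def K_def .
  qed
  finally show ?thesis .
qed

lemma critical_identity:
  "3 * (s * (s - 1)) - 2 * (2 * s - 1) * (s - s_zero) = - ((s - s_crit)\<^sup>2)"
  by (simp add: s_zero_def s_crit_def power2_eq_square field_simps)

text \<open>
  The derivative vanishes to second order at \<open>s_crit\<close> and does not change its sign there, which
  makes \<open>branch_map\<close> monotone on the two intervals that follow.
\<close>

lemma branch_map_deriv:
  assumes "s \<noteq> 0" "s \<noteq> 1"
  shows "(branch_map has_real_derivative
     4 / 9 * sqrt 3 * (s - s_zero)\<^sup>2 * (s - s_crit)\<^sup>2 / (s ^ 3 * (s - 1) ^ 3)) (at s)"
proof -
  let ?k = "4 / 9 * sqrt 3"
  have N: "((\<lambda>s. k * (s - r) ^ 3) has_real_derivative k * (3 * (s - r)\<^sup>2)) (at s)" for k r :: real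
    by (auto intro!: derivative_eq_intros)
  have D: "((\<lambda>s. s\<^sup>2 * (s - 1)\<^sup>2) has_real_derivative 2 * s * (s - 1)\<^sup>2 + s\<^sup>2 * (2 * (s - 1))) (at s)"
    by (auto intro!: derivative_eq_intros simp: power2_eq_square algebra_simps)
  have "(branch_map has_real_derivative
      - ((?k * (3 * (s - s_zero)\<^sup>2) * (s\<^sup>2 * (s - 1)\<^sup>2) - ?k * (s - s_zero) ^ 3 * (2 * s * (s - 1)\<^sup>2 + s\<^sup>2 * (2 * (s - 1))))
        / ((s\<^sup>2 * (s - 1)\<^sup>2) * (s\<^sup>2 * (s - 1)\<^sup>2)))) (at s)"
    using DERIV_minus[OF DERIV_divide[OF N[of ?k s_zero] D]] assms unfolding branch_map_def by simp
  moreover have "- ((?k * (3 * (s - s_zero)\<^sup>2) * (s\<^sup>2 * (s - 1)\<^sup>2) - ?k * (s - s_zero) ^ 3 * (2 * s * (s - 1)\<^sup>2 + s\<^sup>2 * (2 * (s - 1))))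
        / ((s\<^sup>2 * (s - 1)\<^sup>2) * (s\<^sup>2 * (s - 1)\<^sup>2)))
      = ?k * (s - s_zero)\<^sup>2 * (s - s_crit)\<^sup>2 / (s ^ 3 * (s - 1) ^ 3)"
  proof -
    have "k * (3 * (s - r)\<^sup>2) * (s\<^sup>2 * (s - 1)\<^sup>2) - k * (s - r) ^ 3 * (2 * s * (s - 1)\<^sup>2 + s\<^sup>2 * (2 * (s - 1)))
      = k * (s - r)\<^sup>2 * (s * (s - 1)) * (3 * (s * (s - 1)) - 2 * (2 * s - 1) * (s - r))" for k r :: real
      by (simp add: power2_eq_square power3_eq_cube algebra_simps)
    then have "?k * (3 * (s - s_zero)\<^sup>2) * (s\<^sup>2 * (s - 1)\<^sup>2) - ?k * (s - s_zero) ^ 3 * (2 * s * (s - 1)\<^sup>2 + s\<^sup>2 * (2 * (s - 1)))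
      = ?k * (s - s_zero)\<^sup>2 * (s * (s - 1)) * (3 * (s * (s - 1)) - 2 * (2 * s - 1) * (s - s_zero))" .
    also have "\<dots> = - (s * (s - 1) * (?k * (s - s_zero)\<^sup>2 * (s - s_crit)\<^sup>2))"
      unfolding critical_identity by simp
    finally have num: "?k * (3 * (s - s_zero)\<^sup>2) * (s\<^sup>2 * (s - 1)\<^sup>2) - ?k * (s - s_zero) ^ 3 * (2 * s * (s - 1)\<^sup>2 + s\<^sup>2 * (2 * (s - 1)))
      = - (s * (s - 1) * (?k * (s - s_zero)\<^sup>2 * (s - s_crit)\<^sup>2))" .
    have den: "(s\<^sup>2 * (s - 1)\<^sup>2) * (s\<^sup>2 * (s - 1)\<^sup>2) = s * (s - 1) * (s ^ 3 * (s - 1) ^ 3)"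
      by (simp add: power2_eq_square power3_eq_cube)
    have "s * (s - 1) \<noteq> 0" using assms by simp
    then show ?thesis unfolding num den by simp
  qed
  ultimately show ?thesis by simp
qed

lemma branch_map_decreasing:
  assumes "s_zero < s" "s < t" "t < 1" shows "branch_map t < branch_map s"
proof (rule DERIV_neg_imp_decreasing[OF assms(2)])
  fix x assume x: "s \<le> x" "x \<le> t"
  have b: "0 < x" "x < 1" "s_zero < x" "x < s_crit"
    using x assms sqrt3_bounds by (simp_all add: s_zero_def s_crit_def)
  have "x ^ 3 * (x - 1) ^ 3 < 0" using b by (intro mult_pos_neg) (simp_all add: power_less_zero_eq)
  moreover have "4 / 9 * sqrt 3 * (x - s_zero)\<^sup>2 * (x - s_crit)\<^sup>2 > 0" using b by (intro mult_pos_pos) simp_all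
  ultimately have "4 / 9 * sqrt 3 * (x - s_zero)\<^sup>2 * (x - s_crit)\<^sup>2 / (x ^ 3 * (x - 1) ^ 3) < 0"
    by (rule divide_pos_neg[rotated])
  moreover have "x \<noteq> 0" "x \<noteq> 1" using b by auto
  ultimately show "\<exists>y. (branch_map has_real_derivative y) (at x) \<and> y < 0"
    using branch_map_deriv[of x] by blast
qed

lemma branch_map_increasing:
  assumes "1 < s" "s < t" shows "branch_map s < branch_map t"
proof -
  have step: "branch_map s < branch_map t" if "1 < s" "s < t" "s_crit \<notin> {s<..<t}" for s t
  proof (rule DERIV_pos_imp_increasing_open[OF that(2)])
    fix x assume x: "s < x" "x < t"
    have b: "0 < x" "1 < x" "s_zero < x" "x \<noteq> s_crit"
      using x that sqrt3_bounds by (auto simp: s_zero_def)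
    have "4 / 9 * sqrt 3 * (x - s_zero)\<^sup>2 * (x - s_crit)\<^sup>2 > 0" using b by (intro mult_pos_pos) simp_all
    then have "4 / 9 * sqrt 3 * (x - s_zero)\<^sup>2 * (x - s_crit)\<^sup>2 / (x ^ 3 * (x - 1) ^ 3) > 0"
      using b by (intro divide_pos_pos mult_pos_pos) simp_all
    then show "\<exists>y. (branch_map has_real_derivative y) (at x) \<and> y > 0"
      using branch_map_deriv[of x] b by (metis less_irrefl)
  next
    show "continuous_on {s..t} branch_map"
      by (intro continuous_at_imp_continuous_on ballI DERIV_isCont[OF branch_map_deriv]) (use that in auto)
  qed
  show ?thesis
  proof (cases "s_crit \<in> {s<..<t}")
    case True
    have "branch_map s < branch_map s_crit" "branch_map s_crit < branch_map t"
      using True assms by (auto intro!: step)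
    then show ?thesis by simp
  qed (use step assms in auto)
qed

lemma quartic_real_signs:
  assumes "u < 0" shows "quartic_real u 0 > 0" "quartic_real u u < 0" "quartic_real u (s_zero * u) > 0"
proof -
  have s: "0 < s_zero" "s_zero < 1" using sqrt3_bounds by (simp_all add: s_zero_def)
  have "quartic_real u 0 = - (4 / 9 * sqrt 3 * (s_zero * u) ^ 3)" by (simp add: quartic_real_def)
  moreover have "s_zero * u < 0" using assms s by (simp add: mult_pos_neg)
  then have "(s_zero * u) ^ 3 < 0" by (simp add: power_less_zero_eq)
  then have "4 / 9 * sqrt 3 * (s_zero * u) ^ 3 < 0" by (intro mult_pos_neg) auto
  ultimately show "quartic_real u 0 > 0" by simp
  have "quartic_real u u = 4 / 9 * sqrt 3 * ((1 - s_zero) * u) ^ 3" by (simp add: quartic_real_def algebra_simps)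
  moreover have "(1 - s_zero) * u < 0" using assms s by (simp add: mult_pos_neg)
  then have "((1 - s_zero) * u) ^ 3 < 0" by (simp add: power_less_zero_eq)
  then have "4 / 9 * sqrt 3 * ((1 - s_zero) * u) ^ 3 < 0" by (intro mult_pos_neg) auto
  ultimately show "quartic_real u u < 0" by simp
  have "quartic_real u (s_zero * u) = (s_zero * u)\<^sup>2 * ((s_zero - 1) * u)\<^sup>2" by (simp add: quartic_real_def algebra_simps)
  then show "quartic_real u (s_zero * u) > 0" using assms s by simp
qed

lemma quartic_real_root_cases:
  assumes u: "u < 0" and y: "quartic_real u y = 0"
  shows "u < y \<and> y < s_zero * u \<or> y < u"
proof -
  define s where "s = y / u"
  have ys: "y = u * s" using u by (simp add: s_def)
  have s: "s \<noteq> 0" "s \<noteq> 1" using quartic_real_signs[OF u] y by (auto simp: ys)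
  have "branch_map s < 0" using quartic_real_branch_map[OF s, of u] y u by (simp add: ys)
  moreover have "s\<^sup>2 * (s - 1)\<^sup>2 > 0" using s by simp
  ultimately have "4 / 9 * sqrt 3 * (s - s_zero) ^ 3 > 0" by (simp add: branch_map_def zero_less_divide_iff)
  then have "s > s_zero" by (simp add: zero_less_mult_iff zero_less_power_eq)
  then show ?thesis using u s(2) by (cases "s < 1") (auto simp: ys mult.commute[of u])
qed

lemma quartic_real_unique:
  assumes u: "u < 0" and roots: "quartic_real u x = 0" "quartic_real u y = 0"
    and side: "(u < x \<and> u < y) \<or> (x < u \<and> y < u)"
  shows "x = y"
proof (rule ccontr)
  assume "x \<noteq> y"
  define s t where "s = x / u" and "t = y / u"
  have xy: "x = u * s" "y = u * t" using u by (simp_all add: s_def t_def)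
  have ne: "s \<noteq> t" using \<open>x \<noteq> y\<close> by (auto simp: xy)
  have nz: "s \<noteq> 0" "s \<noteq> 1" "t \<noteq> 0" "t \<noteq> 1" using quartic_real_signs[OF u] roots by (auto simp: xy)
  then have eq: "branch_map s = branch_map t"
    using quartic_real_branch_map[of s u] quartic_real_branch_map[of t u] roots u by (simp add: xy)
  have c: "s_zero < s \<and> s < 1 \<or> 1 < s" "s_zero < t \<and> t < 1 \<or> 1 < t"
    using quartic_real_root_cases[OF u roots(1)] quartic_real_root_cases[OF u roots(2)] u
    by (auto simp: xy mult.commute[of u])
  have d: "s < 1 \<and> t < 1 \<or> 1 < s \<and> 1 < t" using side u by (auto simp: xy)
  show False
    using ne eq c d branch_map_decreasing[of s t] branch_map_decreasing[of t s]
      branch_map_increasing[of s t] branch_map_increasing[of t s] by (smt (verit))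
qed

text \<open>
  A double root would be a critical point of \<open>branch_map\<close>, and the critical values are \<open>0\<close> and
  \<open>- 1 / 4\<close>.
\<close>

lemma quartic_real_simple:
  assumes u: "- 1 / 4 < u" "u < 0" and y: "quartic_real u y = 0"
  shows "2 * y * (y - u)\<^sup>2 + 2 * y\<^sup>2 * (y - u) + 4 / 3 * sqrt 3 * (y - s_zero * u)\<^sup>2 \<noteq> 0"
proof
  define k where "k = 4 / 9 * sqrt 3"
  define r where "r = y - s_zero * u"
  assume "2 * y * (y - u)\<^sup>2 + 2 * y\<^sup>2 * (y - u) + 4 / 3 * sqrt 3 * (y - s_zero * u)\<^sup>2 = 0"
  then have D: "2 * y * (y - u)\<^sup>2 + 2 * y\<^sup>2 * (y - u) + 3 * k * r\<^sup>2 = 0" by (simp add: k_def r_def)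
  have E: "y\<^sup>2 * (y - u)\<^sup>2 + k * r ^ 3 = 0" using y by (simp add: quartic_real_def k_def r_def)
  have "k * r\<^sup>2 * (3 * y * (y - u) - 2 * (2 * y - u) * r) = 0"
    using D E by algebra
  moreover have "3 * y * (y - u) - 2 * (2 * y - u) * r = - ((y - s_crit * u)\<^sup>2)"
    by (simp add: r_def s_zero_def s_crit_def power2_eq_square field_simps)
  ultimately have "r = 0 \<or> y = s_crit * u" by (auto simp: k_def)
  then show False
  proof
    assume "r = 0"
    then show False using quartic_real_signs(3)[OF u(2)] y by (simp add: r_def)
  next
    assume "y = s_crit * u"
    then have "quartic (of_real u) (of_real u * of_real s_crit) = 0"
      using quartic_of_real[of u y] y by (simp add: mult.commute)
    then have "complex_of_real u ^ 3 * ((of_real u + 1 / 4) * (of_real s_crit)\<^sup>2 * (of_real s_crit - 1)\<^sup>2) = 0"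
      unfolding quartic_scale_crit by simp
    moreover have "s_crit > 1" using sqrt3_bounds by (simp add: s_crit_def)
    then have "complex_of_real s_crit \<noteq> 0" "complex_of_real (s_crit - 1) \<noteq> 0"
      unfolding of_real_eq_0_iff by auto
    ultimately have "complex_of_real u + 1 / 4 = 0" using u by simp
    then have "u + 1 / 4 = 0" by (simp add: complex_eq_iff)
    then show False using u by simp
  qed
qed

definition upper_root :: "real \<Rightarrow> real" where
  "upper_root u = (THE y. u < y \<and> quartic_real u y = 0)"

definition lower_root :: "real \<Rightarrow> real" where
  "lower_root u = (THE y. y < u \<and> quartic_real u y = 0)"

lemma continuous_quartic_real [continuous_intros]:
  "continuous_on S f \<Longrightarrow> continuous_on S g \<Longrightarrow> continuous_on S (\<lambda>x. quartic_real (f x) (g x))"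
  unfolding quartic_real_def by (intro continuous_intros)

lemma continuous_quartic_real_2: "continuous_on S (quartic_real u)"
  using continuous_quartic_real[OF continuous_on_const continuous_on_id, of S u] by simp

lemma upper_root:
  assumes "u < 0" shows "u < upper_root u" "upper_root u < s_zero * u" "quartic_real u (upper_root u) = 0"
proof -
  have s: "s_zero < 1" using sqrt3_bounds by (simp add: s_zero_def)
  have "u \<le> s_zero * u" using assms s mult_right_mono_neg[of s_zero 1 u] by simp
  then obtain y where y: "u \<le> y" "y \<le> s_zero * u" "quartic_real u y = 0"
    using IVT'[of "quartic_real u" u 0 "s_zero * u"] quartic_real_signs[OF assms] continuous_quartic_real_2
    by auto
  then have "u < y" using quartic_real_signs(2)[OF assms] by (cases "u = y") auto
  then have "\<exists>!y. u < y \<and> quartic_real u y = 0"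
    using y(3) quartic_real_unique[OF assms] by blast
  then have "u < upper_root u \<and> quartic_real u (upper_root u) = 0"
    unfolding upper_root_def by (rule theI')
  then show "u < upper_root u" "upper_root u < s_zero * u" "quartic_real u (upper_root u) = 0"
    using quartic_real_root_cases[OF assms, of "upper_root u"] by auto
qed

lemma lower_root:
  assumes "- 1 / 4 < u" "u < 0"
  shows "lower_root u < u" "- 2 \<le> lower_root u" "quartic_real u (lower_root u) = 0"
proof -
  have s: "0 < s_zero" using sqrt3_bounds by (simp add: s_zero_def)
  have "quartic_real u (- 2) > 0"
  proof -
    have "(7 / 4)\<^sup>2 \<le> (2 + u)\<^sup>2" using assms by (intro power_mono) auto
    then have 1: "(- 2)\<^sup>2 * (- 2 - u)\<^sup>2 \<ge> 49 / 4" by (simp add: power2_eq_square algebra_simps)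
    have "s_zero * u < 0" using assms s by (simp add: mult_pos_neg)
    then have "2 + s_zero * u \<le> 2" by simp
    then have "(2 + s_zero * u) ^ 3 \<le> 2 ^ 3" by (intro power_mono_odd) auto
    then have "4 / 9 * sqrt 3 * (2 + s_zero * u) ^ 3 \<le> 4 / 9 * sqrt 3 * 2 ^ 3" by (intro mult_left_mono) auto
    moreover have "4 / 9 * sqrt 3 * 2 ^ 3 < (49 / 4 :: real)" using sqrt3_bounds by simp
    moreover have "(- 2 - s_zero * u) ^ 3 = - ((2 + s_zero * u) ^ 3)"
      by (simp add: power3_eq_cube algebra_simps)
    then have "quartic_real u (- 2) = (- 2)\<^sup>2 * (- 2 - u)\<^sup>2 - 4 / 9 * sqrt 3 * (2 + s_zero * u) ^ 3"
      by (simp add: quartic_real_def)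
    ultimately show ?thesis using 1 by linarith
  qed
  then obtain y where y: "- 2 \<le> y" "y \<le> u" "quartic_real u y = 0"
    using IVT2'[of "quartic_real u" u 0 "- 2"] quartic_real_signs[OF assms(2)] assms continuous_quartic_real_2
    by auto
  then have yu: "y < u" using quartic_real_signs(2)[OF assms(2)] by (cases "u = y") auto
  have ex1: "\<exists>!y. y < u \<and> quartic_real u y = 0"
    using y(3) yu quartic_real_unique[OF assms(2)] by blast
  then have l: "lower_root u < u \<and> quartic_real u (lower_root u) = 0"
    unfolding lower_root_def by (rule theI')
  moreover have "lower_root u = y" using ex1 l y(3) yu by blast
  ultimately show "lower_root u < u" "- 2 \<le> lower_root u" "quartic_real u (lower_root u) = 0"
    using y(1) by auto
qed

text \<open>
  A bounded function with closed graph is continuous, and the graph is cut out by closed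
  conditions since the root is unique on its side of \<open>u\<close>.
\<close>

lemma continuous_upper_root:
  assumes "- 1 / 4 < u1" "u2 < 0" shows "continuous_on {u1..u2} upper_root"
proof (rule continuous_from_closed_graph)
  have s: "0 < s_zero" using sqrt3_bounds by (simp add: s_zero_def)
  show "compact {- 1..0::real}" by simp
  show "upper_root \<in> {u1..u2} \<rightarrow> {- 1..0}"
  proof
    fix u assume "u \<in> {u1..u2}"
    then have u: "- 1 / 4 < u" "u < 0" using assms by auto
    then have "s_zero * u < 0" using s by (simp add: mult_pos_neg)
    then show "upper_root u \<in> {- 1..0}" using upper_root[OF u(2)] u by auto
  qed
  have "(\<lambda>u. (u, upper_root u)) ` {u1..u2} =
      ({u1..u2} \<times> UNIV) \<inter> {p. fst p \<le> snd p} \<inter> {p. quartic_real (fst p) (snd p) = 0}" (is "?L = ?R")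
  proof (intro equalityI subsetI)
    fix p assume "p \<in> ?L"
    then obtain u where u: "p = (u, upper_root u)" "u \<in> {u1..u2}" by auto
    then have "u < 0" using assms by auto
    then show "p \<in> ?R" using u upper_root[of u] by auto
  next
    fix p assume p: "p \<in> ?R"
    then have f: "fst p < 0" using assms by auto
    have r: "quartic_real (fst p) (snd p) = 0" "fst p \<le> snd p" using p by simp_all
    then have "fst p < snd p" using quartic_real_signs(2)[OF f] by (cases "fst p = snd p") auto
    then have "fst p < snd p \<and> fst p < upper_root (fst p) \<or> snd p < fst p \<and> upper_root (fst p) < fst p"
      using upper_root(1)[OF f] by blast
    then have "snd p = upper_root (fst p)" by (rule quartic_real_unique[OF f r(1) upper_root(3)[OF f]])
    then show "p \<in> ?L" using p by (intro image_eqI[of _ _ "fst p"]) (auto simp: prod_eq_iff)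
  qed
  moreover have "closed ?R"
  proof (intro closed_Int)
    show "closed ({u1..u2} \<times> (UNIV :: real set))" by (intro closed_Times) auto
    show "closed {p. quartic_real (fst p) (snd p) = 0}"
      by (intro closed_Collect_eq continuous_quartic_real continuous_on_fst continuous_on_snd continuous_on_id continuous_on_const)
  qed (intro closed_Collect_le continuous_on_fst continuous_on_snd continuous_on_id)
  ultimately show "closed ((\<lambda>u. (u, upper_root u)) ` {u1..u2})" by simp
qed

lemma continuous_lower_root:
  assumes "- 1 / 4 < u1" "u2 < 0" shows "continuous_on {u1..u2} lower_root"
proof (rule continuous_from_closed_graph)
  show "compact {- 2..0::real}" by simp
  show "lower_root \<in> {u1..u2} \<rightarrow> {- 2..0}"
  proof
    fix u assume "u \<in> {u1..u2}"
    then have u: "- 1 / 4 < u" "u < 0" using assms by auto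
    then show "lower_root u \<in> {- 2..0}" using lower_root[OF u] by auto
  qed
  have "(\<lambda>u. (u, lower_root u)) ` {u1..u2} =
      ({u1..u2} \<times> UNIV) \<inter> {p. snd p \<le> fst p} \<inter> {p. quartic_real (fst p) (snd p) = 0}" (is "?L = ?R")
  proof (intro equalityI subsetI)
    fix p assume "p \<in> ?L"
    then obtain u where u: "p = (u, lower_root u)" "u \<in> {u1..u2}" by auto
    then have "- 1 / 4 < u" "u < 0" using assms by auto
    then show "p \<in> ?R" using u lower_root[of u] by auto
  next
    fix p assume p: "p \<in> ?R"
    then have f: "- 1 / 4 < fst p" "fst p < 0" using assms by auto
    have r: "quartic_real (fst p) (snd p) = 0" "snd p \<le> fst p" using p by simp_all
    then have "snd p < fst p" using quartic_real_signs(2)[OF f(2)] by (cases "fst p = snd p") auto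
    then have "fst p < snd p \<and> fst p < lower_root (fst p) \<or> snd p < fst p \<and> lower_root (fst p) < fst p"
      using lower_root(1)[OF f] by blast
    then have "snd p = lower_root (fst p)" by (rule quartic_real_unique[OF f(2) r(1) lower_root(3)[OF f]])
    then show "p \<in> ?L" using p by (intro image_eqI[of _ _ "fst p"]) (auto simp: prod_eq_iff)
  qed
  moreover have "closed ?R"
  proof (intro closed_Int)
    show "closed ({u1..u2} \<times> (UNIV :: real set))" by (intro closed_Times) auto
    show "closed {p. quartic_real (fst p) (snd p) = 0}"
      by (intro closed_Collect_eq continuous_quartic_real continuous_on_fst continuous_on_snd continuous_on_id continuous_on_const)
  qed (intro closed_Collect_le continuous_on_fst continuous_on_snd continuous_on_id)
  ultimately show "closed ((\<lambda>u. (u, lower_root u)) ` {u1..u2})" by simp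
qed

text \<open>
  \<open>pair_sum u\<close> and \<open>pair_prod u\<close> are the sum and the product of the two roots that are left after division by
  the two real ones.
\<close>

definition pair_sum :: "real \<Rightarrow> real" where
  "pair_sum u = 2 * u - 4 / 9 * sqrt 3 - upper_root u - lower_root u"

definition pair_prod :: "real \<Rightarrow> real" where
  "pair_prod u = u\<^sup>2 - 4 / 3 * sqrt 3 * s_zero * u - upper_root u * lower_root u
     - (upper_root u + lower_root u) * pair_sum u"

lemma quartic_factor:
  assumes u: "- 1 / 4 < u" "u < 0"
  shows "quartic (of_real u) y = (y - of_real (upper_root u)) * (y - of_real (lower_root u)) *
     (y\<^sup>2 - of_real (pair_sum u) * y + of_real (pair_prod u))"
proof -
  define k r where "k = 4 / 9 * q3" and "r = complex_of_real s_zero"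
  define a b where "a = complex_of_real (upper_root u)" and "b = complex_of_real (lower_root u)"
  define U where "U = complex_of_real u"
  define S P where "S = complex_of_real (pair_sum u)" and "P = complex_of_real (pair_prod u)"
  have S: "S = 2 * U - k - a - b" by (simp add: S_def pair_sum_def U_def k_def a_def b_def)
  have P: "P = U\<^sup>2 - 3 * k * r * U - a * b - (a + b) * S"
    by (simp add: P_def pair_prod_def S_def U_def k_def a_def b_def r_def)
  define B where "B = 3 * k * r\<^sup>2 * U\<^sup>2 + (a + b) * P + a * b * S"
  define C where "C = - k * r ^ 3 * U ^ 3 - a * b * P"
  have eq: "quartic U y = (y - a) * (y - b) * (y\<^sup>2 - S * y + P) + (B * y + C)" for y
    unfolding quartic_def k_def[symmetric] r_def[symmetric] B_def C_def P S by algebra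
  have "quartic U a = 0" "quartic U b = 0"
    unfolding U_def a_def b_def quartic_of_real using upper_root(3)[OF u(2)] lower_root(3)[OF u] by simp_all
  then have "B * a + C = 0" "B * b + C = 0" unfolding eq by simp_all
  moreover have "a \<noteq> b" unfolding a_def b_def using upper_root(1)[OF u(2)] lower_root(1)[OF u] by simp
  ultimately have "B = 0" by (metis add_right_cancel mult_cancel_left)
  then have "C = 0" using \<open>B * a + C = 0\<close> by simp
  then show ?thesis using eq[of y] \<open>B = 0\<close> unfolding U_def a_def b_def S_def P_def by simp
qed

lemma quartic_real_factor:
  assumes u: "- 1 / 4 < u" "u < 0"
  shows "quartic_real u y = (y - upper_root u) * (y - lower_root u) * (y\<^sup>2 - pair_sum u * y + pair_prod u)"
proof -
  have "complex_of_real (quartic_real u y)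
      = of_real ((y - upper_root u) * (y - lower_root u) * (y\<^sup>2 - pair_sum u * y + pair_prod u))"
    unfolding quartic_of_real[symmetric] quartic_factor[OF u] by simp
  then show ?thesis by (simp only: of_real_eq_iff)
qed

text \<open>
  Otherwise the quadratic factor would have a real root.  It would be one of the two real roots
  found before, and hence a double root of the quartic.
\<close>

lemma pair_discriminant:
  assumes u: "- 1 / 4 < u" "u < 0"
  shows "pair_prod u - (pair_sum u / 2)\<^sup>2 > 0"
proof (rule ccontr)
  assume "\<not> ?thesis"
  then have D: "(pair_sum u / 2)\<^sup>2 - pair_prod u \<ge> 0" by simp
  define a b where "a = upper_root u" and "b = lower_root u"
  define M where "M y = y\<^sup>2 - pair_sum u * y + pair_prod u" for y
  define e where "e = pair_sum u / 2 + sqrt ((pair_sum u / 2)\<^sup>2 - pair_prod u)"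
  \<comment> \<open>\<open>e\<close> is a real root of the quadratic factor.\<close>
  have Me: "M e = 0"
  proof -
    have "(e - pair_sum u / 2)\<^sup>2 = (pair_sum u / 2)\<^sup>2 - pair_prod u" using D by (simp add: e_def)
    then show ?thesis unfolding M_def by (simp add: power2_eq_square field_simps)
  qed
  have fac: "quartic_real u y = (y - a) * (y - b) * M y" for y
    using quartic_real_factor[OF u] by (simp add: a_def b_def M_def)
  have qe: "quartic_real u e = 0" by (simp add: fac Me)
  have "e = a \<or> e = b"
  proof -
    have "u < e \<or> e < u" using quartic_real_root_cases[OF u(2) qe] by blast
    then show ?thesis
    proof
      assume "u < e"
      then show ?thesis
        using quartic_real_unique[OF u(2) qe upper_root(3)[OF u(2)]] upper_root(1)[OF u(2)] by (simp add: a_def)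
    next
      assume "e < u"
      then show ?thesis
        using quartic_real_unique[OF u(2) qe lower_root(3)[OF u]] lower_root(1)[OF u] by (simp add: b_def)
    qed
  qed
  moreover have "((\<lambda>y. (y - a) * (y - b) * M y) has_real_derivative
      (e - b) * M e + (e - a) * M e + (e - a) * (e - b) * (2 * e - pair_sum u)) (at e)"
    unfolding M_def by (auto intro!: derivative_eq_intros simp: algebra_simps)
  moreover have "((\<lambda>y. quartic_real u y) has_real_derivative
      2 * e * (e - u)\<^sup>2 + 2 * e\<^sup>2 * (e - u) + 4 / 3 * sqrt 3 * (e - s_zero * u)\<^sup>2) (at e)"
    unfolding quartic_real_def by (auto intro!: derivative_eq_intros simp: algebra_simps)
  ultimately have "2 * e * (e - u)\<^sup>2 + 2 * e\<^sup>2 * (e - u) + 4 / 3 * sqrt 3 * (e - s_zero * u)\<^sup>2 = 0"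
    unfolding fac using Me DERIV_unique by fastforce
  then show False using quartic_real_simple[OF u qe] by simp
qed

text \<open>
  The conjugate pair comes first, as in \<open>gap_cell\<close>.
\<close>

definition segment_tuple :: "real \<Rightarrow> complex ^ 4" where
  "segment_tuple u = vector
     [Complex (pair_sum u / 2) (sqrt (pair_prod u - (pair_sum u / 2)\<^sup>2)),
      Complex (pair_sum u / 2) (- sqrt (pair_prod u - (pair_sum u / 2)\<^sup>2)),
      of_real (upper_root u), of_real (lower_root u)]"

lemma range_segment_tuple:
  assumes u: "- 1 / 4 < u" "u < 0"
  shows "range (($) (segment_tuple u)) = {y. quartic (of_real u) y = 0}"
proof -
  let ?D = "sqrt (pair_prod u - (pair_sum u / 2)\<^sup>2)"
  have "?D * ?D = pair_prod u - (pair_sum u / 2)\<^sup>2" using pair_discriminant[OF u] by simp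
  then have "y\<^sup>2 - of_real (pair_sum u) * y + of_real (pair_prod u)
    = (y - Complex (pair_sum u / 2) ?D) * (y - Complex (pair_sum u / 2) (- ?D))" for y
    by (simp add: complex_eq_iff power2_eq_square algebra_simps)
  then show ?thesis
    unfolding range_4 segment_tuple_def using quartic_factor[OF u] by auto
qed

lemma segment_tuple_cell:
  assumes u: "- 1 / 4 < u" "u < 0"
  shows "segment_tuple u \<in> cell gap_cell"
proof -
  have "sqrt (pair_prod u - (pair_sum u / 2)\<^sup>2) > 0" using pair_discriminant[OF u] by simp
  moreover have "lower_root u < upper_root u" using upper_root(1)[OF u(2)] lower_root(1)[OF u] by simp
  ultimately show ?thesis
    unfolding cell_def mem_Collect_eq forall_before by (simp add: segment_tuple_def gap_cell_def)
qed

lemma continuous_segment_tuple: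
  assumes "- 1 / 4 < u1" "u2 < 0" shows "continuous_on {u1..u2} segment_tuple"
proof -
  have ab: "continuous_on {u1..u2} upper_root" "continuous_on {u1..u2} lower_root"
    using continuous_upper_root[OF assms] continuous_lower_root[OF assms] by auto
  have S: "continuous_on {u1..u2} pair_sum" unfolding pair_sum_def by (intro continuous_intros ab)
  have P: "continuous_on {u1..u2} pair_prod" unfolding pair_prod_def by (intro continuous_intros ab S)
  have "continuous_on {u1..u2} (\<lambda>u. segment_tuple u $ k)" for k
  proof -
    have "continuous_on {u1..u2} (\<lambda>u. segment_tuple u $ 1)" "continuous_on {u1..u2} (\<lambda>u. segment_tuple u $ 2)"
      "continuous_on {u1..u2} (\<lambda>u. segment_tuple u $ 3)" "continuous_on {u1..u2} (\<lambda>u. segment_tuple u $ 4)"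
      unfolding segment_tuple_def vector_4 Complex_eq by (intro continuous_intros ab S P; simp)+
    then show ?thesis using exhaust_4[of k] by auto
  qed
  then show ?thesis using continuous_on_vec_lambda[of "{u1..u2}" "\<lambda>k u. segment_tuple u $ k"] by simp
qed

text \<open>
  Serves to match two descriptions of the same four roots near \<open>u = 0\<close>: two points with equal
  real part must be the two rightmost ones.
\<close>

lemma pair_is_rightmost:
  fixes k1 k2 k3 z1 z2 z3 z4 :: complex
  assumes "k1 \<in> {z1, z2, z3, z4}" "k2 \<in> {z1, z2, z3, z4}" "k3 \<in> {z1, z2, z3, z4}"
    and "k1 \<noteq> k2" "k1 \<noteq> k3" "k2 \<noteq> k3" "Re k1 = Re k2"
    and "Re z3 < Re z1" "Re z3 < Re z2" "Re z4 < Re z3"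
  shows "Re k3 < Re k2"
  using assms by (simp only: insert_iff empty_iff simp_thms) (elim disjE; simp)

text \<open>
  The analogue near \<open>u = - 1 / 4\<close>, where the pair lies between the two real roots.
\<close>

lemma pair_is_in_the_middle:
  fixes k1 k2 k3 k4 z1 z2 z3 z4 :: complex
  assumes "k1 \<in> {z1, z2, z3, z4}" "k2 \<in> {z1, z2, z3, z4}" "k3 \<in> {z1, z2, z3, z4}" "k4 \<in> {z1, z2, z3, z4}"
    and "k1 \<noteq> k2" "k1 \<noteq> k3" "k2 \<noteq> k3" "k1 \<noteq> k4" "k2 \<noteq> k4" "Re k1 = Re k2" "Re k4 < Re k3"
    and "Re z4 < Re z2" "Re z4 < Re z3" "Re z2 < Re z1" "Re z3 < Re z1"
  shows "Re k1 < Re k3 \<and> Re k4 < Re k2"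
  using assms by (simp only: insert_iff empty_iff simp_thms) (elim disjE; simp)

lemma sorted_segment_tuple_zero:
  fixes z :: "complex ^ 4"
  assumes u: "- 1 / 4 < u" "u < 0" and rng: "range (($) z) = {y. quartic (of_real u) y = 0}"
    and Re: "Re (z $ 3) < Re (z $ 1)" "Re (z $ 3) < Re (z $ 2)" "Re (z $ 4) < Re (z $ 3)"
  shows "sorted4 (segment_tuple u)"
proof -
  let ?K = "segment_tuple u"
  have D: "sqrt (pair_prod u - (pair_sum u / 2)\<^sup>2) > 0" using pair_discriminant[OF u] by simp
  have K: "Re (?K $ 1) = Re (?K $ 2)" "Im (?K $ 1) > 0" "Im (?K $ 2) < 0" "Im (?K $ 3) = 0" "Im (?K $ 4) = 0"
    "Re (?K $ 4) < Re (?K $ 3)"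
    using D upper_root(1)[OF u(2)] lower_root(1)[OF u] by (simp_all add: segment_tuple_def)
  have eq: "{?K $ 1, ?K $ 2, ?K $ 3, ?K $ 4} = {z $ 1, z $ 2, z $ 3, z $ 4}"
    using range_segment_tuple[OF u] rng unfolding range_4 by simp
  then have mem: "?K $ 1 \<in> {z $ 1, z $ 2, z $ 3, z $ 4}" "?K $ 2 \<in> {z $ 1, z $ 2, z $ 3, z $ 4}"
    "?K $ 3 \<in> {z $ 1, z $ 2, z $ 3, z $ 4}" by blast+
  have ne: "?K $ 1 \<noteq> ?K $ 2" "?K $ 1 \<noteq> ?K $ 3" "?K $ 2 \<noteq> ?K $ 3" using K by auto
  have "Re (?K $ 3) < Re (?K $ 2)" by (rule pair_is_rightmost[OF mem ne K(1) Re])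
  then show ?thesis using K unfolding sorted4_def lexpos_def by simp
qed

lemma sorted_segment_tuple_crit:
  fixes z :: "complex ^ 4"
  assumes u: "- 1 / 4 < u" "u < 0" and rng: "range (($) z) = {y. quartic (of_real u) y = 0}"
    and Re: "Re (z $ 4) < Re (z $ 2)" "Re (z $ 4) < Re (z $ 3)" "Re (z $ 2) < Re (z $ 1)" "Re (z $ 3) < Re (z $ 1)"
  shows "sorted4 (vector [segment_tuple u $ 3, segment_tuple u $ 1, segment_tuple u $ 2, segment_tuple u $ 4])"
proof -
  let ?K = "segment_tuple u"
  have D: "sqrt (pair_prod u - (pair_sum u / 2)\<^sup>2) > 0" using pair_discriminant[OF u] by simp
  have K: "Re (?K $ 1) = Re (?K $ 2)" "Im (?K $ 1) > 0" "Im (?K $ 2) < 0" "Im (?K $ 3) = 0" "Im (?K $ 4) = 0"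
    "Re (?K $ 4) < Re (?K $ 3)"
    using D upper_root(1)[OF u(2)] lower_root(1)[OF u] by (simp_all add: segment_tuple_def)
  have eq: "{?K $ 1, ?K $ 2, ?K $ 3, ?K $ 4} = {z $ 1, z $ 2, z $ 3, z $ 4}"
    using range_segment_tuple[OF u] rng unfolding range_4 by simp
  then have mem: "?K $ 1 \<in> {z $ 1, z $ 2, z $ 3, z $ 4}" "?K $ 2 \<in> {z $ 1, z $ 2, z $ 3, z $ 4}"
    "?K $ 3 \<in> {z $ 1, z $ 2, z $ 3, z $ 4}" "?K $ 4 \<in> {z $ 1, z $ 2, z $ 3, z $ 4}" by blast+
  have ne: "?K $ 1 \<noteq> ?K $ 2" "?K $ 1 \<noteq> ?K $ 3" "?K $ 2 \<noteq> ?K $ 3" "?K $ 1 \<noteq> ?K $ 4" "?K $ 2 \<noteq> ?K $ 4"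
    using K by auto
  have "Re (?K $ 1) < Re (?K $ 3) \<and> Re (?K $ 4) < Re (?K $ 2)"
    by (rule pair_is_in_the_middle[OF mem ne K(1,6) Re])
  then show ?thesis using K unfolding sorted4_def lexpos_def by simp
qed

text \<open>
  All configurations on the way lie in \<open>gap_cell\<close>, so the orders at the two ends suffice.
\<close>

lemma has_monodromy_segment:
  fixes x y :: real
  assumes x: "0 < x" "x < 1" and y: "0 < y" "y < 1"
    and start: "sorted4 (segment_tuple ((x\<^sup>2 - 1) / 4))"
    and finish: "sorted4 (vector [segment_tuple ((y\<^sup>2 - 1) / 4) $ 3, segment_tuple ((y\<^sup>2 - 1) / 4) $ 1,
       segment_tuple ((y\<^sup>2 - 1) / 4) $ 2, segment_tuple ((y\<^sup>2 - 1) / 4) $ 4])"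
  shows "has_monodromy (linepath (of_real x) (of_real y)) (inv\<^bsub>B4\<^esub> (\<sigma> 2) \<otimes>\<^bsub>B4\<^esub> \<sigma> 1)"
proof -
  define l where "l t = (1 - t) * x + t * y" for t
  define u where "u t = ((l t)\<^sup>2 - 1) / 4" for t
  define b where "b t = segment_tuple (u t)" for t
  define m M where "m = ((min x y)\<^sup>2 - 1) / 4" and "M = ((max x y)\<^sup>2 - 1) / 4"
  have mM: "- 1 / 4 < m" "M < 0"
    using x y by (auto simp: m_def M_def min_def max_def abs_square_less_1 power_less_one_iff)
  have u_in: "u t \<in> {m..M}" if t: "t \<in> {0..1}" for t
  proof -
    have "min x y \<le> l t" "l t \<le> max x y"
      using convex_bound_le[of x "max x y" y "1 - t" t] convex_bound_le[of "- x" "- min x y" "- y" "1 - t" t] t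
      by (auto simp: l_def)
    moreover have "0 < min x y" using x y by simp
    ultimately have "(min x y)\<^sup>2 \<le> (l t)\<^sup>2" "(l t)\<^sup>2 \<le> (max x y)\<^sup>2" by (auto intro!: power_mono)
    then show ?thesis by (simp add: u_def m_def M_def)
  qed
  have ut: "- 1 / 4 < u t" "u t < 0" if "t \<in> {0..1}" for t using u_in[OF that] mM by auto
  have "continuous_on {0..1} u" unfolding u_def l_def by (intro continuous_intros) auto
  then have p: "path b"
    unfolding path_def b_def using u_in
    by (intro continuous_on_compose2[OF continuous_segment_tuple[OF mM]]) auto
  have cellb: "b t \<in> cell gap_cell" if "t \<in> {0..1}" for t
    unfolding b_def by (intro segment_tuple_cell ut that)
  then have ib: "path_image b \<subseteq> cell gap_cell" by (auto simp: path_image_def)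
  have "b t \<in> conf" if "t \<in> {0..1}" for t
    using segment_cell[OF cellb[OF that] cellb[OF that]] by simp
  then have c: "conf_path b" using p by (auto simp: path_image_def)
  have "braid_of b = inv\<^bsub>B4\<^esub> (\<sigma> 2) \<otimes>\<^bsub>B4\<^esub> \<sigma> 1"
    using start finish by (intro braid_of_passing[OF c ib]) (simp_all add: pathstart_def pathfinish_def b_def u_def l_def)
  moreover have ul: "((linepath (complex_of_real x) (of_real y) t)\<^sup>2 - 1) / 4 = of_real (u t)" for t
    by (simp add: u_def l_def linepath_of_real)
  have "lifts (linepath (of_real x) (of_real y)) b"
    unfolding lifts_def roots_def h_quartic ul using c range_segment_tuple[OF ut] by (simp add: b_def)
  ultimately show ?thesis by (intro has_monodromyI)
qed

section \<open>The factorization\<close>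

text \<open>
  The conjugating word of the second loop, as it arises from the geometry.
\<close>

lemma (in group) half_turn_then_passing:
  assumes "a \<in> carrier G" "b \<in> carrier G"
  shows "(a \<otimes> b) [^] (2::nat) \<otimes> (inv b \<otimes> a) = a \<otimes> b \<otimes> a [^] (2::nat)"
proof -
  have "b \<otimes> (inv b \<otimes> a) = a" using assms by (simp flip: m_assoc)
  then show ?thesis using assms by (simp add: numeral_2_eq_2 nat_pow_Suc m_assoc)
qed

text \<open>
  The conjugating word of the third loop.  The letters \<open>inv a\<close> and \<open>c\<close> commute, and afterwards
  \<open>a \<otimes> b \<otimes> a = b \<otimes> a \<otimes> b\<close> is used twice, in opposite directions.
\<close>

lemma (in group) third_transport:
  assumes car: "a \<in> carrier G" "b \<in> carrier G" "c \<in> carrier G"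
    and braid: "a \<otimes> b \<otimes> a = b \<otimes> a \<otimes> b" and comm: "a \<otimes> c = c \<otimes> a"
  shows "a \<otimes> b \<otimes> a [^] (2::nat) \<otimes> (b \<otimes> c \<otimes> inv (inv b \<otimes> a)) = b \<otimes> a [^] (2::nat) \<otimes> b \<otimes> c \<otimes> b"
proof -
  have br: "a \<otimes> (b \<otimes> (a \<otimes> z)) = b \<otimes> (a \<otimes> (b \<otimes> z))" if "z \<in> carrier G" for z
  proof -
    have "a \<otimes> b \<otimes> a \<otimes> z = b \<otimes> a \<otimes> b \<otimes> z" unfolding braid ..
    then show ?thesis using car that by (simp add: m_assoc)
  qed
  have "inv a \<otimes> (a \<otimes> c) \<otimes> inv a = inv a \<otimes> (c \<otimes> a) \<otimes> inv a" unfolding comm ..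
  moreover have "inv a \<otimes> (a \<otimes> c) \<otimes> inv a = c \<otimes> inv a" using car by (simp flip: m_assoc)
  moreover have "inv a \<otimes> (c \<otimes> a) \<otimes> inv a = inv a \<otimes> c" using car by (simp add: m_assoc)
  ultimately have ci: "c \<otimes> inv a = inv a \<otimes> c" by simp
  define y where "y = inv a \<otimes> (c \<otimes> b)"
  have y: "y \<in> carrier G" "a \<otimes> y = c \<otimes> b" using car by (simp_all add: y_def flip: m_assoc)
  have "c \<otimes> inv (inv b \<otimes> a) = y"
  proof -
    have "c \<otimes> inv (inv b \<otimes> a) = c \<otimes> inv a \<otimes> b" using car by (simp add: inv_mult_group m_assoc)
    then show ?thesis unfolding ci y_def using car by (simp add: m_assoc)
  qed
  then have "a \<otimes> b \<otimes> a [^] (2::nat) \<otimes> (b \<otimes> c \<otimes> inv (inv b \<otimes> a)) = a \<otimes> (b \<otimes> (a \<otimes> (a \<otimes> (b \<otimes> y))))"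
    using car y(1) by (simp add: numeral_2_eq_2 nat_pow_Suc m_assoc)
  also have "\<dots> = b \<otimes> (a \<otimes> (b \<otimes> (a \<otimes> (b \<otimes> y))))" using car y(1) by (intro br) simp
  also have "b \<otimes> (a \<otimes> (b \<otimes> y)) = a \<otimes> (b \<otimes> (a \<otimes> y))" using br[OF y(1)] by simp
  also have "b \<otimes> (a \<otimes> (a \<otimes> (b \<otimes> (a \<otimes> y)))) = b \<otimes> a [^] (2::nat) \<otimes> b \<otimes> c \<otimes> b"
    unfolding y(2) using car by (simp add: numeral_2_eq_2 nat_pow_Suc m_assoc)
  finally show ?thesis .
qed

lemma (in group) conj_power_shift:
  assumes "a \<in> carrier G" "b \<in> carrier G"
  shows "b \<otimes> (a \<otimes> b) [^] (n::nat) = (b \<otimes> a) [^] n \<otimes> b"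
proof (induction n)
  case (Suc n)
  have "b \<otimes> (a \<otimes> b) [^] Suc n = b \<otimes> (a \<otimes> b) [^] n \<otimes> (a \<otimes> b)" using assms by (simp add: m_assoc)
  also have "\<dots> = (b \<otimes> a) [^] n \<otimes> b \<otimes> (a \<otimes> b)" unfolding Suc ..
  also have "\<dots> = (b \<otimes> a) [^] Suc n \<otimes> b" using assms by (simp add: m_assoc)
  finally show ?case .
qed (use assms in simp)

text \<open>
  Conjugation by \<open>b\<close> exchanges the roles of \<open>a \<otimes> b\<close> and \<open>b \<otimes> a\<close>.
\<close>

lemma (in group) absorb_last_letter:
  assumes car: "a \<in> carrier G" "b \<in> carrier G" and w: "w \<in> carrier G"
  shows "w \<otimes> b \<otimes> ((a \<otimes> b) [^] (n::nat) \<otimes> inv (w \<otimes> b)) = w \<otimes> (b \<otimes> a) [^] n \<otimes> inv w"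
proof -
  have "w \<otimes> b \<otimes> ((a \<otimes> b) [^] n \<otimes> inv (w \<otimes> b)) = w \<otimes> (b \<otimes> (a \<otimes> b) [^] n) \<otimes> (inv b \<otimes> inv w)"
    using car w by (simp add: inv_mult_group m_assoc)
  also have "\<dots> = w \<otimes> ((b \<otimes> a) [^] n \<otimes> b) \<otimes> (inv b \<otimes> inv w)" unfolding conj_power_shift[OF car] ..
  also have "\<dots> = w \<otimes> (b \<otimes> a) [^] n \<otimes> (b \<otimes> inv b) \<otimes> inv w" using car w by (simp only: m_assoc m_closed inv_closed nat_pow_closed)
  also have "\<dots> = w \<otimes> (b \<otimes> a) [^] n \<otimes> inv w" using car w by simp
  finally show ?thesis .
qed

lemma part_circlepath_cis: "part_circlepath z r a b t = z + of_real r * cis ((1 - t) * a + t * b)"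
  by (simp add: part_circlepath_def cis_conv_exp linepath_def algebra_simps)

lemma discr_pt_simps [simp]: "discr_pt 1 = 1" "discr_pt (Suc 0) = 1" "discr_pt 2 = 0" "discr_pt 3 = - 1"
  by (simp_all add: discr_pt_def)

theorem proposition2p4:
  "\<forall>\<^sub>F x0 in at_right (1::real). \<forall>\<^sub>F \<epsilon> in at_right (0::real).
     braid_monodromy_factorization x0 \<epsilon> =
       ((\<sigma> 1 \<otimes>\<^bsub>B4\<^esub> \<sigma> 2) [^]\<^bsub>B4\<^esub> (4::nat),
        (\<sigma> 1 \<otimes>\<^bsub>B4\<^esub> \<sigma> 2 \<otimes>\<^bsub>B4\<^esub> \<sigma> 1 [^]\<^bsub>B4\<^esub> (2::nat))
          \<otimes>\<^bsub>B4\<^esub> (\<sigma> 2 \<otimes>\<^bsub>B4\<^esub> \<sigma> 3) [^]\<^bsub>B4\<^esub> (2::nat)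
          \<otimes>\<^bsub>B4\<^esub> inv\<^bsub>B4\<^esub> (\<sigma> 1 \<otimes>\<^bsub>B4\<^esub> \<sigma> 2 \<otimes>\<^bsub>B4\<^esub> \<sigma> 1 [^]\<^bsub>B4\<^esub> (2::nat)),
        (\<sigma> 2 \<otimes>\<^bsub>B4\<^esub> \<sigma> 1 [^]\<^bsub>B4\<^esub> (2::nat) \<otimes>\<^bsub>B4\<^esub> \<sigma> 2 \<otimes>\<^bsub>B4\<^esub> \<sigma> 3)
          \<otimes>\<^bsub>B4\<^esub> (\<sigma> 2 \<otimes>\<^bsub>B4\<^esub> \<sigma> 1) [^]\<^bsub>B4\<^esub> (4::nat)
          \<otimes>\<^bsub>B4\<^esub> inv\<^bsub>B4\<^esub> (\<sigma> 2 \<otimes>\<^bsub>B4\<^esub> \<sigma> 1 [^]\<^bsub>B4\<^esub> (2::nat) \<otimes>\<^bsub>B4\<^esub> \<sigma> 2 \<otimes>\<^bsub>B4\<^esub> \<sigma> 3))"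
  (is "\<forall>\<^sub>F x0 in _. \<forall>\<^sub>F \<epsilon> in _. ?factorization x0 \<epsilon>")
proof -
  interpret B: group B4 by (rule group_B4)
  obtain G0 c0 \<delta>0 where br0: "branch G0 c0 \<delta>0 s_zero"
    and roots0: "\<And>w. w \<in> ball 0 \<delta>0 \<Longrightarrow> quartic (- (w ^ 3)) (- (w ^ 3) * G0 w) = 0"
    using branch_zero by metis
  obtain G1 c1 \<delta>1 where br1: "branch G1 c1 \<delta>1 s_crit"
    and roots1: "\<And>w. w \<in> ball 0 \<delta>1 \<Longrightarrow> quartic (w ^ 3 - 1 / 4) ((w ^ 3 - 1 / 4) * G1 w) = 0"
    using branch_crit by metis
  interpret Z: branch G0 c0 \<delta>0 s_zero by (rule br0)
  interpret C: branch G1 c1 \<delta>1 s_crit by (rule br1)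
  obtain e0 where e0: "e0 > 0" "\<And>\<epsilon> \<psi>0 d \<gamma>. 0 < \<epsilon> \<Longrightarrow> \<epsilon> < e0 \<Longrightarrow> \<psi>0 = 0 \<or> \<psi>0 = pi \<Longrightarrow> 0 < d \<Longrightarrow>
     (\<And>t. t \<in> {0..1} \<Longrightarrow> \<gamma> t = 1 + of_real \<epsilon> * cis (\<psi>0 + 2 ^ d * t * pi / 2)) \<Longrightarrow>
     has_monodromy \<gamma> ((\<sigma> 1 \<otimes>\<^bsub>B4\<^esub> \<sigma> 2) [^]\<^bsub>B4\<^esub> ((2::nat) ^ d))"
    using Z.has_monodromy_arc_zero[OF refl roots0] by blast
  obtain e1 where e1: "e1 > 0" "\<And>\<epsilon> d \<gamma>. 0 < \<epsilon> \<Longrightarrow> \<epsilon> < e1 \<Longrightarrow>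
     (\<And>t. t \<in> {0..1} \<Longrightarrow> \<gamma> t = of_real \<epsilon> * cis (2 ^ d * t * pi)) \<Longrightarrow>
     has_monodromy \<gamma> ((\<sigma> 2 \<otimes>\<^bsub>B4\<^esub> \<sigma> 3) [^]\<^bsub>B4\<^esub> ((2::nat) ^ d))"
    using C.has_monodromy_arc_crit[OF refl roots1] by blast
  define \<eta> where "\<eta> = Min {1 / 200, \<delta>0 ^ 3 / 4, \<delta>1 ^ 3, e0, e1}"
  have \<eta>: "\<eta> > 0" "\<eta> \<le> 1 / 200" "\<eta> \<le> \<delta>0 ^ 3 / 4" "\<eta> \<le> \<delta>1 ^ 3" "\<eta> \<le> e0" "\<eta> \<le> e1"
    using Z.\<delta> C.\<delta> e0(1) e1(1) by (simp_all add: \<eta>_def)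
  have main: "?factorization x0 \<epsilon>"
    if x0: "1 < x0" "x0 < 1 + \<eta>" and \<epsilon>: "0 < \<epsilon>" "\<epsilon> < \<eta>" for x0 \<epsilon>
  proof -
    let ?a = "\<sigma> 1" and ?b = "\<sigma> 2" and ?c = "\<sigma> 3"
    have car: "?a \<in> carrier B4" "?b \<in> carrier B4" "?c \<in> carrier B4" by (rule \<sigma>_in_carrier; simp)+
    have \<epsilon>': "\<epsilon> < e0" "\<epsilon> < e1" "\<epsilon> < 1 / 200" "4 * \<epsilon> < \<delta>0 ^ 3" "\<epsilon> < \<delta>1 ^ 3" using \<epsilon> \<eta> by simp_all
    have right_bound: "x\<^sup>2 - 1 < 1 / 50 \<and> x\<^sup>2 - 1 < \<delta>0 ^ 3" if "1 < x" "x < 1 + \<eta>" for x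
    proof -
      have "(x - 1) * (x + 1) < \<eta> * 3" using that \<eta>(2) by (intro mult_strict_mono) auto
      then have "x\<^sup>2 - 1 < 3 * \<eta>" by (simp add: power2_eq_square algebra_simps)
      then show ?thesis using \<eta>(1-3) by simp
    qed
    have start: "sorted4 (segment_tuple (((1 - \<epsilon>)\<^sup>2 - 1) / 4))"
    proof -
      let ?u = "((1 - \<epsilon>)\<^sup>2 - 1) / 4"
      have sq: "(1 - \<epsilon>)\<^sup>2 = 1 - \<epsilon> * (2 - \<epsilon>)" by (simp add: power2_eq_square algebra_simps)
      have pos: "0 < (1 - \<epsilon>)\<^sup>2" using \<epsilon>' by (subst zero_less_power2) simp
      have "0 < \<epsilon> * (2 - \<epsilon>)" "\<epsilon> * (2 - \<epsilon>) < \<epsilon> * 2" using \<epsilon> \<epsilon>' by (simp_all)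
      then have "(1 - \<epsilon>)\<^sup>2 < 1" "1 - 2 * \<epsilon> < (1 - \<epsilon>)\<^sup>2" unfolding sq by simp_all
      moreover have "- 1 / 4 < (X - 1) / 4 \<and> (X - 1) / 4 < 0 \<and> - \<epsilon> < (X - 1) / 4"
        if "0 < X" "X < 1" "1 - 2 * \<epsilon> < X" for X :: real
        using that \<epsilon>(1) by auto
      ultimately have u: "- 1 / 4 < ?u" "?u < 0" "- \<epsilon> < ?u" using pos by blast+
      then have "?u \<noteq> 0" "\<bar>?u\<bar> < 1 / 50" "\<bar>?u\<bar> < \<delta>0 ^ 3" using \<epsilon> \<epsilon>' by simp_all
      note z = Z.tuple_real_zero[OF refl roots0 this]
      show ?thesis
        using sorted_segment_tuple_zero[OF u(1,2) z(4)] near_triangle_Re[OF _ z(2)] z(2)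
        unfolding near_triangle_def far_def by simp
    qed
    have finish: "sorted4 (vector [segment_tuple ((\<epsilon>\<^sup>2 - 1) / 4) $ 3, segment_tuple ((\<epsilon>\<^sup>2 - 1) / 4) $ 1,
       segment_tuple ((\<epsilon>\<^sup>2 - 1) / 4) $ 2, segment_tuple ((\<epsilon>\<^sup>2 - 1) / 4) $ 4])"
    proof -
      let ?u = "(\<epsilon>\<^sup>2 - 1) / 4"
      have "\<epsilon> * \<epsilon> < 1 * \<epsilon>" "0 < \<epsilon>\<^sup>2" using \<epsilon> \<epsilon>' by simp_all
      then have "0 < \<epsilon>\<^sup>2" "\<epsilon>\<^sup>2 < \<epsilon>" by (simp_all add: power2_eq_square)
      moreover have "- 1 / 4 < (X - 1) / 4 \<and> (X - 1) / 4 + 1 / 4 < 1 / 200 \<and> (X - 1) / 4 + 1 / 4 < \<delta>1 ^ 3 \<and> (X - 1) / 4 < 0"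
        if "0 < X" "X < \<epsilon>" for X :: real
      proof -
        have "(X - 1) / 4 + 1 / 4 = X / 4" by (simp add: diff_divide_distrib)
        moreover have "- 1 / 4 < (X - 1) / 4" "X / 4 < 1 / 200" "X / 4 < \<delta>1 ^ 3" "(X - 1) / 4 < 0"
          using that \<epsilon>' by simp_all
        ultimately show ?thesis by (simp only: simp_thms)
      qed
      ultimately have u: "- 1 / 4 < ?u" "?u + 1 / 4 < 1 / 200" "?u + 1 / 4 < \<delta>1 ^ 3" "?u < 0" by blast+
      note z = C.tuple_real_crit[OF refl roots1 u(1-3)]
      show ?thesis
        using sorted_segment_tuple_crit[OF u(1,4) z(3)] near_triangle_Re[OF _ z(1)] z(1)
        unfolding near_triangle_def far_def by simp
    qed
    have L: "has_monodromy (approach x0 \<epsilon> 0) \<one>\<^bsub>B4\<^esub>"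
      using Z.has_monodromy_right[OF refl roots0, of x0 "1 + \<epsilon>"] right_bound[of x0] right_bound[of "1 + \<epsilon>"] x0 \<epsilon>
      by auto
    have H1: "has_monodromy (part_circlepath 1 \<epsilon> 0 pi) ((?a \<otimes>\<^bsub>B4\<^esub> ?b) [^]\<^bsub>B4\<^esub> (2::nat))"
      using e0(2)[of \<epsilon> 0 1 "part_circlepath 1 \<epsilon> 0 pi"] \<epsilon> \<epsilon>' by (simp add: part_circlepath_cis)
    have C1: "has_monodromy (circlepath 1 \<epsilon>) ((?a \<otimes>\<^bsub>B4\<^esub> ?b) [^]\<^bsub>B4\<^esub> (4::nat))"
      using e0(2)[of \<epsilon> 0 2 "circlepath 1 \<epsilon>"] \<epsilon> \<epsilon>' by (simp add: circlepath_def part_circlepath_cis mult_ac)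
    have C3: "has_monodromy (circlepath (- 1) \<epsilon>) ((?a \<otimes>\<^bsub>B4\<^esub> ?b) [^]\<^bsub>B4\<^esub> (4::nat))"
    proof -
      have "has_monodromy (\<lambda>t. 1 + of_real \<epsilon> * cis (pi + 2 ^ 2 * t * pi / 2)) ((?a \<otimes>\<^bsub>B4\<^esub> ?b) [^]\<^bsub>B4\<^esub> ((2::nat) ^ 2))"
        using \<epsilon> \<epsilon>' by (intro e0(2)) auto
      then have "has_monodromy (\<lambda>t. 1 + of_real \<epsilon> * cis (pi + 2 ^ 2 * t * pi / 2)) ((?a \<otimes>\<^bsub>B4\<^esub> ?b) [^]\<^bsub>B4\<^esub> (4::nat))"
        by simp
      moreover have "cis (pi + 2 ^ 2 * t * pi / 2) = - cis (t * (2 * pi))" for t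
      proof -
        have "pi + 2 ^ 2 * t * pi / 2 = pi + t * (2 * pi)" by simp
        then show ?thesis by (simp only: cis_mult[symmetric] cis_pi) simp
      qed
      ultimately have "has_monodromy (\<lambda>t. 1 + of_real \<epsilon> * - cis (t * (2 * pi))) ((?a \<otimes>\<^bsub>B4\<^esub> ?b) [^]\<^bsub>B4\<^esub> (4::nat))"
        by simp
      then show ?thesis
        by (rule has_monodromy_cong[OF has_monodromy_uminus]) (simp add: circlepath_def part_circlepath_cis)
    qed
    have H2: "has_monodromy (part_circlepath 0 \<epsilon> 0 pi) (?b \<otimes>\<^bsub>B4\<^esub> ?c)"
      using e1(2)[of \<epsilon> "part_circlepath 0 \<epsilon> 0 pi" 0] \<epsilon> \<epsilon>' car by (simp add: part_circlepath_cis)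
    have C2: "has_monodromy (circlepath 0 \<epsilon>) ((?b \<otimes>\<^bsub>B4\<^esub> ?c) [^]\<^bsub>B4\<^esub> (2::nat))"
      using e1(2)[of \<epsilon> "circlepath 0 \<epsilon>" 1] \<epsilon> \<epsilon>' by (simp add: circlepath_def part_circlepath_cis mult_ac)
    let ?s = "inv\<^bsub>B4\<^esub> ?b \<otimes>\<^bsub>B4\<^esub> ?a"
    have S: "has_monodromy (linepath (1 - of_real \<epsilon>) (of_real \<epsilon>)) ?s"
      using has_monodromy_segment[OF _ _ _ _ start finish] \<epsilon> \<epsilon>' by simp
    have S': "has_monodromy (linepath (- of_real \<epsilon>) (- 1 + of_real \<epsilon>)) (inv\<^bsub>B4\<^esub> ?s)"
    proof -
      have "has_monodromy (linepath (of_real \<epsilon>) (1 - of_real \<epsilon>)) (inv\<^bsub>B4\<^esub> ?s)"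
        using has_monodromy_reverse[OF S] by simp
      then show ?thesis
        by (rule has_monodromy_cong[OF has_monodromy_uminus]) (simp add: linepath_def scaleR_conv_of_real algebra_simps)
    qed
    have ends0: "pathstart (approach x0 \<epsilon> 0) = of_real x0" "pathfinish (approach x0 \<epsilon> 0) = 1 + of_real \<epsilon>" by simp_all
    have arc_ends: "pathstart (part_circlepath z \<epsilon> 0 pi) = z + of_real \<epsilon>" "pathfinish (part_circlepath z \<epsilon> 0 pi) = z - of_real \<epsilon>"
      "pathstart (circlepath z \<epsilon>) = z + of_real \<epsilon>" "pathfinish (circlepath z \<epsilon>) = z + of_real \<epsilon>" for z
      by (simp_all add: pathstart_def pathfinish_def part_circlepath_cis circlepath_def)
    have ap1: "approach x0 \<epsilon> 1 = approach x0 \<epsilon> 0 +++ (part_circlepath 1 \<epsilon> 0 pi +++ linepath (1 - of_real \<epsilon>) (of_real \<epsilon>))"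
      by (simp add: One_nat_def[symmetric] del: One_nat_def) (simp add: discr_pt_def)
    have ap2: "approach x0 \<epsilon> 2 = approach x0 \<epsilon> 1 +++ (part_circlepath 0 \<epsilon> 0 pi +++ linepath (- of_real \<epsilon>) (- 1 + of_real \<epsilon>))"
      by (simp add: numeral_2_eq_2 discr_pt_def)
    let ?A1 = "?a \<otimes>\<^bsub>B4\<^esub> ?b \<otimes>\<^bsub>B4\<^esub> ?a [^]\<^bsub>B4\<^esub> (2::nat)"
    have A1: "has_monodromy (approach x0 \<epsilon> 1) ?A1"
    proof -
      have "has_monodromy (approach x0 \<epsilon> 1) (\<one>\<^bsub>B4\<^esub> \<otimes>\<^bsub>B4\<^esub> ((?a \<otimes>\<^bsub>B4\<^esub> ?b) [^]\<^bsub>B4\<^esub> (2::nat) \<otimes>\<^bsub>B4\<^esub> ?s))"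
        unfolding ap1 using L H1 S
        by (intro has_monodromy_join) (simp_all only: pathstart_join pathfinish_linepath pathstart_linepath arc_ends ends0)
      then show ?thesis using car by (simp add: B.half_turn_then_passing)
    qed
    have ends1: "pathstart (approach x0 \<epsilon> 1) = of_real x0" "pathfinish (approach x0 \<epsilon> 1) = of_real \<epsilon>"
      unfolding ap1 by (simp_all only: pathstart_join pathfinish_join pathfinish_linepath ends0)
    let ?W = "?b \<otimes>\<^bsub>B4\<^esub> ?a [^]\<^bsub>B4\<^esub> (2::nat) \<otimes>\<^bsub>B4\<^esub> ?b \<otimes>\<^bsub>B4\<^esub> ?c"
    have A2: "has_monodromy (approach x0 \<epsilon> 2) (?W \<otimes>\<^bsub>B4\<^esub> ?b)"
    proof -
      have "has_monodromy (approach x0 \<epsilon> 2) (?A1 \<otimes>\<^bsub>B4\<^esub> (?b \<otimes>\<^bsub>B4\<^esub> ?c \<otimes>\<^bsub>B4\<^esub> inv\<^bsub>B4\<^esub> ?s))"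
        unfolding ap2 using A1 H2 S'
        by (intro has_monodromy_join) (simp_all only: pathstart_join pathfinish_linepath pathstart_linepath
            arc_ends ends1 add_0 diff_0)
      then show ?thesis unfolding B.third_transport[OF car \<sigma>_braid \<sigma>_commute] .
    qed
    have ends2: "pathstart (approach x0 \<epsilon> 2) = of_real x0" "pathfinish (approach x0 \<epsilon> 2) = - 1 + of_real \<epsilon>"
      unfolding ap2 by (simp_all only: pathstart_join pathfinish_join pathfinish_linepath ends1)
    have loop: "braid_monodromy (p +++ (c +++ reversepath p)) = g \<otimes>\<^bsub>B4\<^esub> (k \<otimes>\<^bsub>B4\<^esub> inv\<^bsub>B4\<^esub> g)"
      if "has_monodromy p g" "has_monodromy c k" "pathfinish p = pathstart c" "pathfinish c = pathstart c" for p c g k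
      using that by (intro braid_monodromy_eq has_monodromy_join has_monodromy_reverse) simp_all
    have "braid_monodromy (loop_around x0 \<epsilon> 1) = (?a \<otimes>\<^bsub>B4\<^esub> ?b) [^]\<^bsub>B4\<^esub> (4::nat)"
    proof -
      have "loop_around x0 \<epsilon> 1 = approach x0 \<epsilon> 0 +++ (circlepath 1 \<epsilon> +++ reversepath (approach x0 \<epsilon> 0))"
        by (simp add: loop_around_def)
      then show ?thesis using loop[OF L C1] arc_ends ends0 car by simp
    qed
    moreover have "braid_monodromy (loop_around x0 \<epsilon> 2) = ?A1 \<otimes>\<^bsub>B4\<^esub> (?b \<otimes>\<^bsub>B4\<^esub> ?c) [^]\<^bsub>B4\<^esub> (2::nat) \<otimes>\<^bsub>B4\<^esub> inv\<^bsub>B4\<^esub> ?A1"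
    proof -
      have "loop_around x0 \<epsilon> 2 = approach x0 \<epsilon> 1 +++ (circlepath 0 \<epsilon> +++ reversepath (approach x0 \<epsilon> 1))"
        by (simp add: loop_around_def)
      moreover have "pathfinish (approach x0 \<epsilon> 1) = pathstart (circlepath 0 \<epsilon>)" unfolding ends1 arc_ends by simp
      ultimately show ?thesis using loop[OF A1 C2] arc_ends car by (simp add: B.m_assoc)
    qed
    moreover have "braid_monodromy (loop_around x0 \<epsilon> 3) = ?W \<otimes>\<^bsub>B4\<^esub> (?b \<otimes>\<^bsub>B4\<^esub> ?a) [^]\<^bsub>B4\<^esub> (4::nat) \<otimes>\<^bsub>B4\<^esub> inv\<^bsub>B4\<^esub> ?W"
    proof -
      have "loop_around x0 \<epsilon> 3 = approach x0 \<epsilon> 2 +++ (circlepath (- 1) \<epsilon> +++ reversepath (approach x0 \<epsilon> 2))"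
        by (simp add: loop_around_def)
      moreover have "pathfinish (approach x0 \<epsilon> 2) = pathstart (circlepath (- 1) \<epsilon>)" unfolding ends2 arc_ends ..
      ultimately have "braid_monodromy (loop_around x0 \<epsilon> 3)
          = ?W \<otimes>\<^bsub>B4\<^esub> ?b \<otimes>\<^bsub>B4\<^esub> ((?a \<otimes>\<^bsub>B4\<^esub> ?b) [^]\<^bsub>B4\<^esub> (4::nat) \<otimes>\<^bsub>B4\<^esub> inv\<^bsub>B4\<^esub> (?W \<otimes>\<^bsub>B4\<^esub> ?b))"
        using loop[OF A2 C3] arc_ends by simp
      also have "\<dots> = ?W \<otimes>\<^bsub>B4\<^esub> (?b \<otimes>\<^bsub>B4\<^esub> ?a) [^]\<^bsub>B4\<^esub> (4::nat) \<otimes>\<^bsub>B4\<^esub> inv\<^bsub>B4\<^esub> ?W"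
        using car by (intro B.absorb_last_letter) simp_all
      finally show ?thesis .
    qed
    ultimately show ?thesis unfolding braid_monodromy_factorization_def by simp
  qed
  show ?thesis
    unfolding eventually_at_right_field
    using \<eta>(1) main by (intro exI[of _ "1 + \<eta>"] exI[of _ \<eta>] conjI allI impI) auto
qed

end
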